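(* Let $s\ge6$ be an integer and let $q\in\{1,-1\}$. Consider a solution $(\rho,u)$ to the three-dimensional pressureless Euler-Poisson system $$\partial_t\rho+u\cdot\nabla\rho=-\rho\,\mathrm{div}\,u,\qquad \partial_tu+u\cdot\nabla u=q\nabla\Delta^{-1}\rho,\qquad(\rho,u)|_{t=0}=(\rho_0,u_0),$$ with initial data $\rho_0\in C^s_c(\mathbb{R}^3)$, $u_0\in H^s(\mathbb{R}^3)$. Then the corresponding trajectory map $X(\alpha,t)$, solving $$\frac{dX}{dt}(\alpha,t)=u(X(\alpha,t),t),\qquad X(\alpha,0)=\alpha,$$ is analytic in $t$ at $t=0$ for each $\alpha\in\mathbb{R}^3$.
   Context: The unknowns are the density $\rho:\mathbb{R}^3\times\mathbb{R}\to\mathbb{R}^+$ (values $\geq 0$) and velocity $u:\mathbb{R}^3\times\mathbb{R}\to\mathbb{R}^3$ (local-in-time classical solution). $\nabla\Delta^{-1}$ is convolution with $K(y)=\frac{1}{4\pi}\frac{y}{|y|^3}$. $C^s_c$ denotes compactly supported, $s$ times continuously differentiable functions. The case $q=1$ is a repulsive force and $q=-1$ an attractive force. *)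

theory Defs
  imports "HOL-Analysis.Analysis"
begin

type_synonym space = "real ^ 3"

text \<open>\<open>f\<close> is \<open>k\<close> times continuously differentiable on \<open>S\<close>; used for open \<open>S\<close> only.\<close>

primrec Ck_on :: "nat \<Rightarrow> ('a::euclidean_space) set \<Rightarrow> ('a \<Rightarrow> 'b::real_normed_vector) \<Rightarrow> bool" where
  "Ck_on 0 S f \<longleftrightarrow> continuous_on S f"
| "Ck_on (Suc k) S f \<longleftrightarrow>
     (\<forall>x\<in>S. f differentiable (at x)) \<and>
     (\<forall>v. Ck_on k S (\<lambda>x. frechet_derivative f (at x) v))"

definition compactly_supported :: "('a::euclidean_space \<Rightarrow> 'b::real_normed_vector) \<Rightarrow> bool" where
  "compactly_supported f \<longleftrightarrow> compact (closure {x. f x \<noteq> 0})"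

definition Ck_c :: "nat \<Rightarrow> ('a::euclidean_space \<Rightarrow> 'b::real_normed_vector) \<Rightarrow> bool" where
  "Ck_c k f \<longleftrightarrow> Ck_on k UNIV f \<and> compactly_supported f"

definition test_function :: "('a::euclidean_space \<Rightarrow> real) \<Rightarrow> bool" where
  "test_function \<phi> \<longleftrightarrow> (\<forall>k. Ck_c k \<phi>)"

text \<open>A partial derivative of order \<open>m\<close> is encoded by a list of \<open>m\<close> basis vectors
  (the directions of differentiation) instead of a multi-index.\<close>

primrec iter_deriv :: "'a list \<Rightarrow> ('a::euclidean_space \<Rightarrow> 'b::real_normed_vector) \<Rightarrow> 'a \<Rightarrow> 'b" where
  "iter_deriv [] f = f"
| "iter_deriv (v # vs) f = (\<lambda>x. frechet_derivative (iter_deriv vs f) (at x) v)"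

definition L2 :: "('a::euclidean_space \<Rightarrow> 'b::euclidean_space) \<Rightarrow> bool" where
  "L2 f \<longleftrightarrow> f \<in> borel_measurable lebesgue \<and> integrable lebesgue (\<lambda>x. (norm (f x))\<^sup>2)"

definition weak_derivative ::
  "'a list \<Rightarrow> ('a::euclidean_space \<Rightarrow> 'b::euclidean_space) \<Rightarrow> ('a \<Rightarrow> 'b) \<Rightarrow> bool" where
  "weak_derivative vs f g \<longleftrightarrow>
     (\<forall>\<phi>. test_function \<phi> \<longrightarrow>
        (LINT x|lebesgue. iter_deriv vs \<phi> x *\<^sub>R f x)
          = (-1) ^ length vs *\<^sub>R (LINT x|lebesgue. \<phi> x *\<^sub>R g x))"

definition sobolev_H :: "nat \<Rightarrow> ('a::euclidean_space \<Rightarrow> 'b::euclidean_space) \<Rightarrow> bool" where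
  "sobolev_H s f \<longleftrightarrow> L2 f \<and>
     (\<forall>vs. set vs \<subseteq> Basis \<and> length vs \<le> s \<longrightarrow> (\<exists>g. L2 g \<and> weak_derivative vs f g))"

text \<open>The value \<open>K 0 = 0\<close> coming from division by zero is irrelevant in the convolution.\<close>

definition newton_kernel :: "space \<Rightarrow> space" where
  "newton_kernel y = (1 / (4 * pi)) *\<^sub>R (y /\<^sub>R (norm y) ^ 3)"

definition grad_inv_laplacian :: "(space \<Rightarrow> real) \<Rightarrow> space \<Rightarrow> space" where
  "grad_inv_laplacian \<rho> x = (LINT y|lebesgue. \<rho> y *\<^sub>R newton_kernel (x - y))"

definition divergence :: "(space \<Rightarrow> space) \<Rightarrow> space \<Rightarrow> real" where
  "divergence v x = (\<Sum>i\<in>Basis. frechet_derivative v (at x) i \<bullet> i)"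

text \<open>\<open>advect v f\<close> is \<open>v \<cdot> \<nabla> f\<close>.\<close>

definition advect :: "(space \<Rightarrow> space) \<Rightarrow> (space \<Rightarrow> 'b::real_normed_vector) \<Rightarrow> space \<Rightarrow> 'b" where
  "advect v f x = frechet_derivative f (at x) (v x)"

text \<open>
  Local-in-time classical solution on the time interval \<open>(-T, T)\<close>.
  The velocity is required to be bounded on \<open>\<real>\<^sup>3 \<times> [-S, S]\<close> for every \<open>S < T\<close>, which holds
  for every solution that is locally bounded in time with values in \<open>H\<^sup>s\<close>, \<open>s > 3/2\<close>.
  It makes the flow of \<open>u\<close> complete on \<open>(-T, T)\<close> and, by transport of a compactly supported
  initial density, keeps each \<open>\<rho>(\<cdot>, t)\<close> continuous with compact support; hence
  the convolution defining \<open>\<nabla>\<Delta>\<^sup>-\<^sup>1 \<rho>\<close> converges absolutely, and the Bochner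
  integral never takes its default value.
\<close>

definition euler_poisson_solution ::
  "real \<Rightarrow> real \<Rightarrow> (space \<Rightarrow> real) \<Rightarrow> (space \<Rightarrow> space)
    \<Rightarrow> (space \<Rightarrow> real \<Rightarrow> real) \<Rightarrow> (space \<Rightarrow> real \<Rightarrow> space) \<Rightarrow> bool" where
  "euler_poisson_solution q T \<rho>0 u0 \<rho> u \<longleftrightarrow>
     0 < T \<and>
     Ck_on 1 (UNIV \<times> {-T<..<T}) (\<lambda>(x, t). \<rho> x t) \<and>
     Ck_on 1 (UNIV \<times> {-T<..<T}) (\<lambda>(x, t). u x t) \<and>
     (\<forall>S<T. bounded {u x t |x t. t \<in> {-S..S}}) \<and>
     (\<forall>x. \<forall>t\<in>{-T<..<T}. 0 \<le> \<rho> x t) \<and>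
     (\<forall>x. \<forall>t\<in>{-T<..<T}.
        vector_derivative (\<lambda>\<tau>. \<rho> x \<tau>) (at t) + advect (\<lambda>y. u y t) (\<lambda>y. \<rho> y t) x
          = - \<rho> x t * divergence (\<lambda>y. u y t) x) \<and>
     (\<forall>x. \<forall>t\<in>{-T<..<T}.
        vector_derivative (\<lambda>\<tau>. u x \<tau>) (at t) + advect (\<lambda>y. u y t) (\<lambda>y. u y t) x
          = q *\<^sub>R grad_inv_laplacian (\<lambda>y. \<rho> y t) x) \<and>
     (\<forall>x. \<rho> x 0 = \<rho>0 x) \<and>
     (\<forall>x. u x 0 = u0 x)"

definition trajectory_map ::
  "real \<Rightarrow> (space \<Rightarrow> real \<Rightarrow> space) \<Rightarrow> (space \<Rightarrow> real \<Rightarrow> space) \<Rightarrow> bool" where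
  "trajectory_map T u X \<longleftrightarrow>
     (\<forall>\<alpha>. X \<alpha> 0 = \<alpha> \<and>
        (\<forall>t\<in>{-T<..<T}. (X \<alpha> has_vector_derivative u (X \<alpha> t) t) (at t)))"

definition real_analytic_at :: "(real \<Rightarrow> 'b::real_normed_vector) \<Rightarrow> real \<Rightarrow> bool" where
  "real_analytic_at f t0 \<longleftrightarrow>
     (\<exists>a. \<exists>r>0. \<forall>t. \<bar>t - t0\<bar> < r \<longrightarrow> (\<lambda>n. (t - t0) ^ n *\<^sub>R a n) sums f t)"

end

(*
  The acceleration of the particle a is q F(V)(a), where V(a) = X(a) - a is the displacement and
  F(V)(a) is the integral over z of rho0(a + z) K(V(a) - V(a + z) - z): when a moves at
  fixed z, the argument of K changes by V(a) - V(a + z) only, and its differences are small enough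
  near z = 0 to compensate the singularity of K. The kernel extends holomorphically to complex displacements of small Lipschitz constant, so the Picard iteration
  V'' = q F(V), V(0) = 0, V'(0) = u0 can be run in complex time. If the second differences of V are
  bounded by |h| |k|^g then those of F(V) are bounded by C/(g - g') |h| |k|^g' for g' < g, and the loss
  is affordable as in the Cauchy-Kovalevskaya theorem, letting g decrease linearly in |t|. Thus all
  iterates are holomorphic on one disc. F is log-Lipschitz in the sup norm, which makes the iterates
  converge at rate (D|t|)^n, both to a holomorphic limit and, for real t, to the given solution.
  The initial velocity has bounded second differences by Sobolev embedding, and the Lagrangian
  equation follows from mass conservation and a change of variables along the flow.
*)
theory Submission
  imports Defs "HOL-Complex_Analysis.Complex_Analysis"
begin

text \<open>The kernel has size |z|^-2, so a difference of it has size |z|^-3, which just fails to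
  be integrable in three dimensions. This logarithm occurs twice. For mixed differences in space,
  the gain |z|^(g - g') turns it into an integral of order 1/(g - g'). For two displacements at
  distance s it gives s^(1 - e)/e for every e in (0, 1]; with s = (\<theta> x)^n the choice e = 1/n
  yields n (\<theta> x)^(n - 1), and integration over \<theta> cancels the n. Hence a geometric rate
  although the force is not Lipschitz in the sup norm.

  Second differences replace derivatives because bounds on them pass through algebraic operations
  and singular integrals without any differentiation.

  The given flow is controlled on bounded regions and at real times only, while the iterates live on
  all of space and in complex time. Estimates used for both are therefore stated on a closed set
  containing the base point and the support of the density, and the trajectory itself is never
  continued to complex times: it is shown to coincide with the holomorphic limit at real
  ones.\<close>

no_notation fps_nth (infixl "$" 75)

section \<open>Four-point estimates for the kernel\<close>

text \<open>\<open>f1, f2, f3, f4\<close> are values at \<open>a\<close>, \<open>a + h\<close>, \<open>a + k\<close>, \<open>a + h + k\<close>. The differences in \<open>h\<close>, in \<open>k\<close> and in both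
  are bounded relative to the size \<open>A\<close>; with \<open>x * y \<le> w\<close> such bounds survive products, inverses and
  square roots, so that no derivative of the kernel has to be computed.\<close>

definition quad :: "real \<Rightarrow> real \<Rightarrow> real \<Rightarrow> real \<Rightarrow> complex \<Rightarrow> complex \<Rightarrow> complex \<Rightarrow> complex \<Rightarrow> bool" where
  "quad A x y w f1 f2 f3 f4 \<longleftrightarrow> norm f1 \<le> A \<and> norm f2 \<le> A \<and> norm f3 \<le> A \<and> norm f4 \<le> A \<and>
     norm (f1 - f2) \<le> A * x \<and> norm (f3 - f4) \<le> A * x \<and>
     norm (f1 - f3) \<le> A * y \<and> norm (f2 - f4) \<le> A * y \<and>
     norm (f1 - f2 - f3 + f4) \<le> A * w"

lemma quadD:
  assumes "quad A x y w f1 f2 f3 f4"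
  shows "norm f1 \<le> A" "norm f2 \<le> A" "norm f3 \<le> A" "norm f4 \<le> A"
    "norm (f1 - f2) \<le> A * x" "norm (f3 - f4) \<le> A * x"
    "norm (f1 - f3) \<le> A * y" "norm (f2 - f4) \<le> A * y"
    "norm (f1 - f2 - f3 + f4) \<le> A * w" "0 \<le> A"
  using assms norm_ge_zero[of f1] unfolding quad_def by linarith+

context
  fixes x y w :: real
  assumes xyw: "0 \<le> x" "0 \<le> y" "x * y \<le> w"
begin

lemma w_nonneg: "0 \<le> w"
  using xyw mult_nonneg_nonneg[of x y] by linarith

lemma quad_mono:
  assumes "quad A x y w f1 f2 f3 f4" "A \<le> B"
  shows "quad B x y w f1 f2 f3 f4"
  using quadD[OF assms(1)] mult_right_mono[OF assms(2) xyw(1)] mult_right_mono[OF assms(2) xyw(2)]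
    mult_right_mono[OF assms(2) w_nonneg] assms(2)
  unfolding quad_def by linarith

lemma quad_const: "norm c \<le> A \<Longrightarrow> quad A x y w c c c c"
  using xyw w_nonneg order_trans[OF norm_ge_zero, of c A] unfolding quad_def by auto

lemma quad_add:
  assumes f: "quad A x y w f1 f2 f3 f4" and g: "quad B x y w g1 g2 g3 g4"
  shows "quad (A + B) x y w (f1 + g1) (f2 + g2) (f3 + g3) (f4 + g4)"
proof -
  have t: "norm (p + q) \<le> a + b" if "norm p \<le> a" "norm q \<le> b" for p q :: complex and a b
    using that norm_triangle_ineq[of p q] by linarith
  have e: "f1 + g1 - (f2 + g2) = (f1 - f2) + (g1 - g2)" "f3 + g3 - (f4 + g4) = (f3 - f4) + (g3 - g4)"
    "f1 + g1 - (f3 + g3) = (f1 - f3) + (g1 - g3)" "f2 + g2 - (f4 + g4) = (f2 - f4) + (g2 - g4)"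
    "f1 + g1 - (f2 + g2) - (f3 + g3) + (f4 + g4) = (f1 - f2 - f3 + f4) + (g1 - g2 - g3 + g4)"
    by simp_all
  show ?thesis
    unfolding quad_def distrib_right
    using t[OF quadD(1)[OF f] quadD(1)[OF g]] t[OF quadD(2)[OF f] quadD(2)[OF g]]
      t[OF quadD(3)[OF f] quadD(3)[OF g]] t[OF quadD(4)[OF f] quadD(4)[OF g]]
      t[OF quadD(5)[OF f] quadD(5)[OF g], folded e(1)] t[OF quadD(6)[OF f] quadD(6)[OF g], folded e(2)]
      t[OF quadD(7)[OF f] quadD(7)[OF g], folded e(3)] t[OF quadD(8)[OF f] quadD(8)[OF g], folded e(4)]
      t[OF quadD(9)[OF f] quadD(9)[OF g], folded e(5)] by blast
qed

text \<open>The discrete Leibniz rule for a mixed difference has four terms. The two cross terms are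
  of size \<open>A * B * (x * y)\<close> and are absorbed by \<open>x * y \<le> w\<close>, so the 4
  counts the terms.\<close>

lemma quad_mult:
  assumes f: "quad A x y w f1 f2 f3 f4" and g: "quad B x y w g1 g2 g3 g4"
  shows "quad (4 * A * B) x y w (f1 * g1) (f2 * g2) (f3 * g3) (f4 * g4)"
proof -
  note F = quadD[OF f] and G = quadD[OF g]
  have m: "norm (p * q) \<le> a * b" if "norm p \<le> a" "norm q \<le> b" for p q :: complex and a b
    using that by (auto simp: norm_mult intro!: mult_mono intro: order_trans[OF norm_ge_zero])
  have AB: "0 \<le> A * B" using F G by simp
  have one: "norm (p * q - p' * q') \<le> 4 * A * B * v"
    if "norm (p - p') \<le> A * v" "norm (q - q') \<le> B * v" "norm q \<le> B" "norm p' \<le> A" "0 \<le> v" for p q p' q' :: complex and v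
  proof -
    have "p * q - p' * q' = (p - p') * q + p' * (q - q')" by (simp add: algebra_simps)
    then have "norm (p * q - p' * q') \<le> (A * v) * B + A * (B * v)"
      using m[OF that(1,3)] m[OF that(4,2)] norm_triangle_ineq[of "(p - p') * q" "p' * (q - q')"]
      by (simp only:)
    also have "\<dots> \<le> 4 * A * B * v" using mult_nonneg_nonneg[OF AB that(5)] by (simp add: algebra_simps)
    finally show ?thesis .
  qed
  have "f1 * g1 - f2 * g2 - f3 * g3 + f4 * g4 = (f1 - f2 - f3 + f4) * g1 + (f2 - f4) * (g1 - g2)
      + (f3 - f4) * (g1 - g3) + f4 * (g1 - g2 - g3 + g4)" by (simp add: algebra_simps)
  also have "norm \<dots> \<le> (A * w) * B + (A * y) * (B * x) + (A * x) * (B * y) + A * (B * w)"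
    by (intro norm_triangle_le add_mono m F G)
  also have "\<dots> \<le> 4 * A * B * w"
    using mult_left_mono[OF xyw(3) AB] by (simp add: algebra_simps)
  finally have dd: "norm (f1 * g1 - f2 * g2 - f3 * g3 + f4 * g4) \<le> 4 * A * B * w" .
  have bd: "norm (p * q) \<le> 4 * A * B" if "norm p \<le> A" "norm q \<le> B" for p q :: complex
    using m[OF that] AB by simp
  show ?thesis
    unfolding quad_def by (intro conjI bd one dd F G xyw)
qed

text \<open>The first summand of the constant bounds the values, the second the first differences,
  the second and third together the mixed difference; their sum serves for all conditions at
  once.\<close>

lemma quad_inverse:
  assumes f: "quad A x y w f1 f2 f3 f4" and m: "0 < m"
    and lb: "m \<le> norm f1" "m \<le> norm f2" "m \<le> norm f3" "m \<le> norm f4"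
  shows "quad (1 / m + A / m\<^sup>2 + 2 * A\<^sup>2 / m ^ 3) x y w (1 / f1) (1 / f2) (1 / f3) (1 / f4)"
proof -
  note F = quadD[OF f]
  have w: "0 \<le> w" by (rule w_nonneg)
  have nz: "f1 \<noteq> 0" "f2 \<noteq> 0" "f3 \<noteq> 0" "f4 \<noteq> 0" using lb m by auto
  have i: "norm (1 / p) \<le> 1 / m" if "m \<le> norm p" for p :: complex
    using that m by (simp add: norm_divide frac_le)
  have d: "norm (1 / p - 1 / p') \<le> A / m\<^sup>2 * v" if "m \<le> norm p" "m \<le> norm p'" "norm (p - p') \<le> A * v" for p p' :: complex and v
  proof -
    have "p \<noteq> 0" "p' \<noteq> 0" using that m by auto
    then have "norm (1 / p - 1 / p') = norm (p - p') * norm (1 / p) * norm (1 / p')"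
      by (simp add: norm_mult[symmetric] norm_minus_commute field_simps flip: norm_divide)
    also have "\<dots> \<le> (A * v) * (1 / m) * (1 / m)"
      using that i m order_trans[OF norm_ge_zero that(3)] by (intro mult_mono) auto
    finally show ?thesis by (simp add: power2_eq_square)
  qed
  \<comment> \<open>The mixed difference of \<open>f * (1 / f) = 1\<close> vanishes; solving its
    Leibniz rule for the mixed difference of \<open>1 / f\<close> gives this identity.\<close>
  have "(1 / f1 - 1 / f2 - 1 / f3 + 1 / f4)
      = - (1 / f4) * ((f1 - f2 - f3 + f4) * (1 / f1) + (f2 - f4) * (1 / f1 - 1 / f2) + (f3 - f4) * (1 / f1 - 1 / f3))"
    using nz by (simp add: field_simps)
  also have "norm \<dots> \<le> (1 / m) * ((A * w) * (1 / m) + (A * y) * (A / m\<^sup>2 * x) + (A * x) * (A / m\<^sup>2 * y))"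
    unfolding norm_mult norm_minus_cancel
  proof (intro mult_mono norm_triangle_le add_mono)
    show "norm ((f1 - f2 - f3 + f4) * (1 / f1)) \<le> (A * w) * (1 / m)"
      unfolding norm_mult using F i lb m w by (intro mult_mono) auto
    show "norm ((f2 - f4) * (1 / f1 - 1 / f2)) \<le> (A * y) * (A / m\<^sup>2 * x)"
      unfolding norm_mult using F d[OF lb(1,2)] m xyw by (intro mult_mono) auto
    show "norm ((f3 - f4) * (1 / f1 - 1 / f3)) \<le> (A * x) * (A / m\<^sup>2 * y)"
      unfolding norm_mult using F d[OF lb(1,3)] m xyw by (intro mult_mono) auto
  qed (use i lb m in auto)
  also have "\<dots> = A / m\<^sup>2 * w + 2 * A\<^sup>2 / m ^ 3 * (x * y)"
    using m by (simp add: field_simps power2_eq_square power3_eq_cube)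
  also have "\<dots> \<le> A / m\<^sup>2 * w + 2 * A\<^sup>2 / m ^ 3 * w"
    using xyw m by (intro add_left_mono mult_left_mono) auto
  also have "\<dots> \<le> (1 / m + A / m\<^sup>2 + 2 * A\<^sup>2 / m ^ 3) * w"
    using w m by (simp add: algebra_simps)
  finally have dd: "norm (1 / f1 - 1 / f2 - 1 / f3 + 1 / f4) \<le> (1 / m + A / m\<^sup>2 + 2 * A\<^sup>2 / m ^ 3) * w" .
  have nn: "0 \<le> A / m\<^sup>2" "0 \<le> 2 * A\<^sup>2 / m ^ 3" "0 \<le> 1 / m" using F m by auto
  have d': "norm (1 / p - 1 / p') \<le> (1 / m + A / m\<^sup>2 + 2 * A\<^sup>2 / m ^ 3) * v"
    if "m \<le> norm p" "m \<le> norm p'" "norm (p - p') \<le> A * v" "0 \<le> v" for p p' :: complex and v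
    using d[OF that(1-3)] mult_right_mono[OF _ that(4), of "A / m\<^sup>2" "1 / m + A / m\<^sup>2 + 2 * A\<^sup>2 / m ^ 3"] nn by linarith
  have i': "norm (1 / p) \<le> 1 / m + A / m\<^sup>2 + 2 * A\<^sup>2 / m ^ 3" if "m \<le> norm p" for p :: complex
    using i[OF that] nn by linarith
  show ?thesis unfolding quad_def by (intro conjI i' d' dd lb F xyw)
qed

text \<open>Differences of roots are differences of squares divided by sums of roots. Roots with
  real part at least \<open>c / 2\<close> cannot cancel in a sum, so these sums have modulus at
  least \<open>c\<close>.\<close>

lemma quad_sqrt:
  assumes f: "quad A x y w (s1\<^sup>2) (s2\<^sup>2) (s3\<^sup>2) (s4\<^sup>2)" and c: "0 < c"
    and re: "c / 2 \<le> Re s1" "c / 2 \<le> Re s2" "c / 2 \<le> Re s3" "c / 2 \<le> Re s4"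
    and S: "norm s1 \<le> S" "norm s2 \<le> S" "norm s3 \<le> S" "norm s4 \<le> S"
  shows "quad (S + A / c + 2 * A\<^sup>2 / c ^ 3) x y w s1 s2 s3 s4"
proof -
  note F = quadD[OF f]
  have w: "0 \<le> w" by (rule w_nonneg)
  have lb: "c \<le> norm (p + p')" if "c / 2 \<le> Re p" "c / 2 \<le> Re p'" for p p'
    using that complex_Re_le_cmod[of "p + p'"] by simp
  have d: "norm (p - p') \<le> A / c * v" if "c / 2 \<le> Re p" "c / 2 \<le> Re p'" "norm (p\<^sup>2 - p'\<^sup>2) \<le> A * v" for p p' :: complex and v
  proof -
    have "norm (p - p') * c \<le> norm (p - p') * norm (p + p')" using lb[OF that(1,2)] by (intro mult_left_mono) auto
    also have "\<dots> = norm (p\<^sup>2 - p'\<^sup>2)" by (simp add: power2_eq_square algebra_simps flip: norm_mult)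
    finally show ?thesis using that(3) c by (simp add: field_simps)
  qed
  have "(s1 - s2 - s3 + s4) * (s1 + s2) = (s1\<^sup>2 - s2\<^sup>2 - s3\<^sup>2 + s4\<^sup>2) - (s3 - s4) * ((s1 - s3) + (s2 - s4))"
    by (simp add: power2_eq_square algebra_simps)
  also have "norm \<dots> \<le> A * w + (A / c * x) * (A / c * y + A / c * y)"
  proof (intro order_trans[OF norm_triangle_ineq4] add_mono F)
    show "norm ((s3 - s4) * ((s1 - s3) + (s2 - s4))) \<le> (A / c * x) * (A / c * y + A / c * y)"
      unfolding norm_mult using F d re xyw c by (intro mult_mono norm_triangle_le add_mono) auto
  qed
  also have "\<dots> = A * w + 2 * A\<^sup>2 / c\<^sup>2 * (x * y)"
    using c by (simp add: field_simps power2_eq_square)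
  also have "\<dots> \<le> A * w + 2 * A\<^sup>2 / c\<^sup>2 * w"
    using xyw by (intro add_left_mono mult_left_mono) auto
  finally have "norm (s1 - s2 - s3 + s4) * norm (s1 + s2) \<le> A * w + 2 * A\<^sup>2 / c\<^sup>2 * w"
    unfolding norm_mult .
  then have "norm (s1 - s2 - s3 + s4) * norm (s1 + s2) \<le> (A + 2 * A\<^sup>2 / c\<^sup>2) * w"
    by (simp only: distrib_right)
  moreover have "norm (s1 - s2 - s3 + s4) * c \<le> norm (s1 - s2 - s3 + s4) * norm (s1 + s2)"
    using lb[OF re(1,2)] by (intro mult_left_mono) auto
  ultimately have "norm (s1 - s2 - s3 + s4) * c \<le> (A + 2 * A\<^sup>2 / c\<^sup>2) * w" by linarith
  then have dd0: "norm (s1 - s2 - s3 + s4) \<le> (A + 2 * A\<^sup>2 / c\<^sup>2) * w / c"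
    using c by (simp add: pos_le_divide_eq)
  have "(A + 2 * A\<^sup>2 / c\<^sup>2) * w / c = (A / c + 2 * A\<^sup>2 / c ^ 3) * w"
    using c by (simp add: field_simps power2_eq_square power3_eq_cube)
  moreover have nn: "0 \<le> A / c" "0 \<le> 2 * A\<^sup>2 / c ^ 3" "0 \<le> S" using F c order_trans[OF norm_ge_zero S(1)] by auto
  ultimately have dd: "norm (s1 - s2 - s3 + s4) \<le> (S + A / c + 2 * A\<^sup>2 / c ^ 3) * w"
    using dd0 mult_nonneg_nonneg[OF nn(3) w] by (simp add: algebra_simps)
  have d': "norm (p - p') \<le> (S + A / c + 2 * A\<^sup>2 / c ^ 3) * v" if "c / 2 \<le> Re p" "c / 2 \<le> Re p'" "norm (p\<^sup>2 - p'\<^sup>2) \<le> A * v" "0 \<le> v" for p p' :: complex and v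
    using d[OF that(1-3)] mult_right_mono[OF _ that(4), of "A / c" "S + A / c + 2 * A\<^sup>2 / c ^ 3"] nn by linarith
  have S': "norm p \<le> S + A / c + 2 * A\<^sup>2 / c ^ 3" if "norm p \<le> S" for p :: complex
    using nn that by linarith
  show ?thesis unfolding quad_def by (intro conjI S' d' dd S re F xyw)
qed

end

section \<open>The complexified Newton kernel\<close>

type_synonym cspace = "complex ^ 3"

definition cvec :: "space \<Rightarrow> cspace" where
  "cvec v = (\<chi> i. complex_of_real (v $ i))"

text \<open>Bilinear rather than Hermitian: without conjugation \<open>cdot Z Z\<close> is
  holomorphic in \<open>Z\<close>. It may vanish for nonzero \<open>Z\<close>, hence the need for
  \<open>cdot_near\<close>.\<close>

definition cdot :: "cspace \<Rightarrow> cspace \<Rightarrow> complex" where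
  "cdot Z W = (\<Sum>i\<in>UNIV. Z $ i * W $ i)"

text \<open>The holomorphic extension of \<^const>\<open>newton_kernel\<close>: for real \<open>Z\<close> the quotient
  \<open>csqrt (Z \<cdot> Z) / (Z \<cdot> Z)\<^sup>2\<close> is \<open>|Z| powr -3\<close>.\<close>

definition Kc :: "cspace \<Rightarrow> cspace" where
  "Kc Z = (\<chi> i. Z $ i * csqrt (cdot Z Z) * (1 / cdot Z Z)\<^sup>2 / (4 * pi))"

lemma norm_cvec [simp]: "norm (cvec v) = norm v"
  by (simp add: cvec_def norm_vec_def)

lemma cvec_diff: "cvec (a - b) = cvec a - cvec b" and cvec_add: "cvec (a + b) = cvec a + cvec b"
  and cvec_0 [simp]: "cvec 0 = 0"
  by (simp_all add: cvec_def vec_eq_iff)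

lemma cdot_cvec: "cdot (cvec v) (cvec v) = complex_of_real ((norm v)\<^sup>2)"
  by (simp add: cdot_def cvec_def norm_vec_def L2_set_def sum_nonneg power2_eq_square)

lemma Kc_cvec: "Kc (cvec v) = cvec (newton_kernel v)"
proof (cases "v = 0")
  case True
  then show ?thesis by (simp add: Kc_def newton_kernel_def vec_eq_iff cvec_def)
next
  case False
  have "csqrt (complex_of_real ((norm v)\<^sup>2)) = complex_of_real (norm v)"
    by (simp add: csqrt_of_real_nonneg del: of_real_power)
  with False show ?thesis
    by (simp add: Kc_def cdot_cvec newton_kernel_def vec_eq_iff)
      (simp add: cvec_def power2_eq_square power3_eq_cube field_simps)
qed

lemma norm_cdot_le: "norm (cdot Z W) \<le> norm Z * norm W"
proof -
  have "norm (cdot Z W) \<le> (\<Sum>i\<in>UNIV. \<bar>norm (Z $ i)\<bar> * \<bar>norm (W $ i)\<bar>)"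
    unfolding cdot_def by (rule order_trans[OF norm_sum]) (simp add: norm_mult)
  also have "\<dots> \<le> norm Z * norm W" unfolding norm_vec_def by (rule L2_set_mult_ineq)
  finally show ?thesis .
qed

text \<open>With \<open>Z = D - cvec z\<close> one has Z.Z = |z|^2 + D.D - 2 z.D, and the
  perturbation is at most (1/64 + 1/4) |z|^2. For nonzero \<open>z\<close> this keeps
  \<open>cdot Z Z\<close> in the open right half plane, off the branch cut of \<open>csqrt\<close>,
  and comparable to |z|^2.\<close>

lemma cdot_near:
  assumes "norm (Z + cvec z) \<le> norm z / 8"
  shows "(norm z)\<^sup>2 / 2 \<le> Re (cdot Z Z)" "norm (cdot Z Z) \<le> 2 * (norm z)\<^sup>2"
proof -
  define D where "D = Z + cvec z"
  have D: "norm D \<le> norm z / 8" using assms by (simp add: D_def)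
  have "cdot Z Z = complex_of_real ((norm z)\<^sup>2) + (cdot D D - 2 * cdot (cvec z) D)"
    unfolding cdot_cvec[symmetric] by (simp add: D_def cdot_def sum_3 algebra_simps)
  moreover have "norm (cdot D D - 2 * cdot (cvec z) D) \<le> norm D * norm D + 2 * (norm z * norm D)"
    using norm_cdot_le[of D D] norm_cdot_le[of "cvec z" D] norm_triangle_ineq4[of "cdot D D" "2 * cdot (cvec z) D"]
    by (simp add: norm_mult)
  moreover have "norm D * norm D \<le> (norm z / 8) * (norm z / 8)" "norm z * norm D \<le> norm z * (norm z / 8)"
    using D by (intro mult_mono mult_left_mono; simp)+
  moreover have "\<bar>Re (cdot D D - 2 * cdot (cvec z) D)\<bar> \<le> norm (cdot D D - 2 * cdot (cvec z) D)" by (rule abs_Re_le_cmod)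
  moreover have "norm (complex_of_real ((norm z)\<^sup>2) + (cdot D D - 2 * cdot (cvec z) D)) \<le> (norm z)\<^sup>2 + norm (cdot D D - 2 * cdot (cvec z) D)"
    using norm_triangle_ineq[of "complex_of_real ((norm z)\<^sup>2)" "cdot D D - 2 * cdot (cvec z) D"] by (simp add: norm_power)
  ultimately show "(norm z)\<^sup>2 / 2 \<le> Re (cdot Z Z)" "norm (cdot Z Z) \<le> 2 * (norm z)\<^sup>2"
    using zero_le_power2[of "norm z"] unfolding power2_eq_square
    by (simp_all del: of_real_power of_real_mult add: power2_eq_square) 
qed

text \<open>A round upper bound for the product of constants, about 4.1 * 10^15, that
  \<open>quad_Kc\<close> collects from the factors of \<open>Kc\<close>.\<close>

definition CK :: real where "CK = 10 ^ 20"

text \<open>All increments are measured relative to |z|, and the factors of \<open>Kc\<close> have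
  sizes |z|, |z| and twice |z|^-2; the calculus of \<open>quad\<close> therefore returns the size
  |z|^-2 with unchanged relative increments. The argument lies near \<open>- cvec z\<close>, which
  is what the hypotheses \<open>near\<close> say.\<close>

lemma quad_Kc:
  assumes xyw: "0 \<le> x" "0 \<le> y" "x * y \<le> w" and z: "z \<noteq> 0"
    and near: "norm (Z1 + cvec z) \<le> norm z / 8" "norm (Z2 + cvec z) \<le> norm z / 8"
      "norm (Z3 + cvec z) \<le> norm z / 8" "norm (Z4 + cvec z) \<le> norm z / 8"
    and d: "norm (Z1 - Z2) \<le> norm z * x" "norm (Z3 - Z4) \<le> norm z * x"
      "norm (Z1 - Z3) \<le> norm z * y" "norm (Z2 - Z4) \<le> norm z * y"
      "norm (Z1 - Z2 - Z3 + Z4) \<le> norm z * w"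
  shows "quad (CK / (norm z)\<^sup>2) x y w (Kc Z1 $ i) (Kc Z2 $ i) (Kc Z3 $ i) (Kc Z4 $ i)"
proof -
  define r where "r = norm z"
  have r: "0 < r" using z by (simp add: r_def)
  have w: "0 \<le> w" by (rule w_nonneg[OF xyw])
  have nZ: "norm (Z $ i) \<le> 2 * r" if "norm (Z + cvec z) \<le> norm z / 8" for Z :: cspace and i
  proof -
    have "norm Z \<le> norm (Z + cvec z) + norm z"
      using norm_triangle_ineq4[of "Z + cvec z" "cvec z"] by (simp del: norm_triangle_ineq4)
    with that Finite_Cartesian_Product.norm_nth_le[of Z i] r show ?thesis
      unfolding r_def by linarith
  qed
  have comp: "norm (U $ i) \<le> 2 * r * v" if "norm U \<le> norm z * v" "0 \<le> v" for U :: cspace and v i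
    using that Finite_Cartesian_Product.norm_nth_le[of U i] mult_nonneg_nonneg[of r v] r
    unfolding r_def by linarith
  have qZ: "quad (2 * r) x y w (Z1 $ i) (Z2 $ i) (Z3 $ i) (Z4 $ i)" for i
    unfolding quad_def using near d xyw w
    by (intro conjI nZ) (auto intro!: comp simp flip: vector_minus_component vector_add_component)
  let ?D = "\<lambda>Z. cdot Z Z"
  have qD: "quad (48 * r\<^sup>2) x y w (?D Z1) (?D Z2) (?D Z3) (?D Z4)"
  proof -
    have "quad (4 * (2 * r) * (2 * r) + 4 * (2 * r) * (2 * r) + 4 * (2 * r) * (2 * r)) x y w (?D Z1) (?D Z2) (?D Z3) (?D Z4)"
      unfolding cdot_def sum_3 by (intro quad_add quad_mult xyw qZ)
    then show ?thesis by (simp add: power2_eq_square algebra_simps)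
  qed
  have re: "r / 2 \<le> Re (csqrt (?D Z))" if "norm (Z + cvec z) \<le> norm z / 8" for Z
  proof -
    have "r\<^sup>2 / 2 \<le> Re (?D Z)" using cdot_near(1)[OF that] by (simp add: r_def)
    also have "\<dots> = Re ((csqrt (?D Z))\<^sup>2)" by simp
    also have "\<dots> \<le> (Re (csqrt (?D Z)))\<^sup>2" by (simp only: Re_power2) simp
    finally have "r\<^sup>2 / 2 \<le> (Re (csqrt (?D Z)))\<^sup>2" .
    moreover have "(r / 2)\<^sup>2 \<le> r\<^sup>2 / 2" by (simp add: power2_eq_square)
    ultimately have "(r / 2)\<^sup>2 \<le> (Re (csqrt (?D Z)))\<^sup>2" by linarith
    then show ?thesis using Re_csqrt[of "?D Z"] by (rule power2_le_imp_le)
  qed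
  have nS: "norm (csqrt (?D Z)) \<le> 2 * r" if "norm (Z + cvec z) \<le> norm z / 8" for Z
  proof (rule power2_le_imp_le)
    have "(norm (csqrt (?D Z)))\<^sup>2 = norm (?D Z)" by (simp flip: norm_power)
    also have "\<dots> \<le> 2 * r\<^sup>2" using cdot_near(2)[OF that] by (simp add: r_def)
    also have "\<dots> \<le> (2 * r)\<^sup>2" by (simp add: power2_eq_square)
    finally show "(norm (csqrt (?D Z)))\<^sup>2 \<le> (2 * r)\<^sup>2" .
  qed (use r in simp)
  \<comment> \<open>The constant delivered by \<open>quad_sqrt\<close> is 2 + 48 + 2 * 48^2 = 4658,
    rounded up.\<close>
  have qS: "quad (5000 * r) x y w (csqrt (?D Z1)) (csqrt (?D Z2)) (csqrt (?D Z3)) (csqrt (?D Z4))"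
  proof (rule quad_mono[OF xyw])
    show "quad (2 * r + 48 * r\<^sup>2 / r + 2 * (48 * r\<^sup>2)\<^sup>2 / r ^ 3) x y w (csqrt (?D Z1)) (csqrt (?D Z2)) (csqrt (?D Z3)) (csqrt (?D Z4))"
      by (intro quad_sqrt xyw re nS near r) (simp add: qD)
  qed (use r in \<open>simp add: power2_eq_square power3_eq_cube field_simps\<close>)
  \<comment> \<open>With the lower bound \<open>r\<^sup>2 / 2\<close> the constant is 2 + 192 +
    36864 = 37058, rounded up.\<close>
  have qI: "quad (40000 / r\<^sup>2) x y w (1 / ?D Z1) (1 / ?D Z2) (1 / ?D Z3) (1 / ?D Z4)"
  proof (rule quad_mono[OF xyw])
    have m: "r\<^sup>2 / 2 \<le> norm (?D Z)" if "norm (Z + cvec z) \<le> norm z / 8" for Z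
      using order_trans[OF cdot_near(1)[OF that] complex_Re_le_cmod] by (simp only: r_def)
    show "quad (1 / (r\<^sup>2 / 2) + 48 * r\<^sup>2 / (r\<^sup>2 / 2)\<^sup>2 + 2 * (48 * r\<^sup>2)\<^sup>2 / (r\<^sup>2 / 2) ^ 3) x y w (1 / ?D Z1) (1 / ?D Z2) (1 / ?D Z3) (1 / ?D Z4)"
      by (intro quad_inverse xyw qD m near) (use r in simp)
  qed (use r in \<open>simp add: power2_eq_square power3_eq_cube field_simps\<close>)
  have p: "norm (complex_of_real (1 / (4 * pi))) \<le> 1"
    using pi_gt3 by (simp add: norm_divide norm_mult)
  have K: "Kc Z $ i = Z $ i * csqrt (?D Z) * ((1 / ?D Z) * (1 / ?D Z)) * complex_of_real (1 / (4 * pi))" for Z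
    by (simp add: Kc_def power2_eq_square)
  show ?thesis
  proof (rule quad_mono[OF xyw])
    show "quad (4 * (4 * (4 * (2 * r) * (5000 * r)) * (4 * (40000 / r\<^sup>2) * (40000 / r\<^sup>2))) * 1) x y w
        (Kc Z1 $ i) (Kc Z2 $ i) (Kc Z3 $ i) (Kc Z4 $ i)"
      unfolding K by (intro quad_mult quad_const xyw qZ qS qI p)
  qed (use r in \<open>simp add: CK_def r_def[symmetric] power2_eq_square field_simps\<close>)
qed

section \<open>The force as a function of the displacement\<close>

text \<open>The majorant of all integrands below. Its integral over a ball is of order 1/e, the
  source of every loss factor \<open>1 / e\<close> and \<open>1 / (g - g')\<close>. Freezing |z| at
  1 makes all nonpositive powers at least 1, so that bounds without any gain in |z| fit the same
  form.\<close>

definition wt :: "real \<Rightarrow> space \<Rightarrow> real" where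
  "wt e z = min (norm z) 1 powr (e - 3)"

lemma wt_nonneg [simp]: "0 \<le> wt e z"
  by (simp add: wt_def)

lemma wt_measurable [measurable]: "wt e \<in> borel_measurable borel"
  unfolding wt_def by measurable

text \<open>The geometric series over dyadic shells has ratio 2^(-e); this bound makes its sum of
  order 1/e.\<close>

lemma one_minus_two_powr_ge:
  fixes e :: real
  assumes "0 < e" "e \<le> 1"
  shows "e / 4 \<le> 1 - 2 powr (- e)"
proof -
  define x :: real where "x = 2 powr e"
  have "1 + e * ln 2 \<le> x" unfolding x_def powr_def by (simp add: exp_ge_add_one_self)
  moreover have "e * (1/2) \<le> e * ln 2"
    using ln2_ge_two_thirds assms by (intro mult_left_mono) auto
  moreover have x: "x \<le> 2" unfolding x_def using assms powr_mono[of e 1 2] by simp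
  ultimately have "e / 2 \<le> x - 1" "0 < x" "x \<le> 2" using assms by linarith+
  moreover from this have "e * x \<le> e * 2" using assms by (intro mult_left_mono) auto
  ultimately have "e / 4 \<le> (x - 1) / x"
    by (simp add: field_simps)
  then show ?thesis using \<open>0 < x\<close> by (simp add: x_def powr_minus field_simps)
qed

lemma ennreal_le_suminf: "f k \<le> (\<Sum>k. f k)" for f :: "nat \<Rightarrow> ennreal"
  using sum_le_suminf[of f "{k}"] by simp

text \<open>The least m with 2^(-m) < |z| places z in the shell between the radii 2^(-m) and 2^(-k),
  m = k + 1. The weight is estimated at the inner radius but indexed by the outer one, at the price
  2^(3 - e) < 8.\<close>

lemma wt_dyadic:
  assumes "norm z < 1" "z \<noteq> 0" "0 < e" "e \<le> 1"
  obtains k :: nat where "z \<in> cball 0 ((1/2) ^ k)" "wt e z \<le> 8 * (2 powr (3 - e)) ^ k"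
proof -
  obtain n where n: "(1/2) ^ n < norm z" using real_arch_pow_inv[of "norm z" "1/2"] assms by auto
  define m where "m = (LEAST n. (1/2) ^ n < norm z)"
  have m: "(1/2) ^ m < norm z" unfolding m_def by (rule LeastI[of _ n]) (rule n)
  have "m \<noteq> 0" using m assms by (metis not_less_iff_gr_or_eq power_0)
  then obtain k where k: "m = Suc k" using not0_implies_Suc by blast
  have "\<not> (1/2) ^ k < norm z" using not_less_Least[of k "\<lambda>n. (1/2) ^ n < norm z"] k by (simp add: m_def)
  then have 1: "z \<in> cball 0 ((1/2) ^ k)" by simp
  have "wt e z = norm z powr (e - 3)" using assms by (simp add: wt_def)
  also have "\<dots> \<le> ((1/2) ^ m) powr (e - 3)"
    using m assms by (intro powr_mono2') auto
  also have "\<dots> = (2 powr (3 - e)) ^ m"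
    by (simp add: powr_realpow[symmetric] powr_powr powr_divide powr_minus_divide[symmetric] mult.commute flip: powr_minus)
      (simp add: powr_minus field_simps powr_diff)
  also have "\<dots> = 2 powr (3 - e) * (2 powr (3 - e)) ^ k" by (simp add: k)
  also have "\<dots> \<le> 2 powr 3 * (2 powr (3 - e)) ^ k"
    using assms by (intro mult_right_mono powr_mono) auto
  finally have 2: "wt e z \<le> 8 * (2 powr (3 - e)) ^ k" by simp
  show ?thesis by (rule that[OF 1 2])
qed

text \<open>A sum over concentric dyadic balls dominates the singular part, so only volumes of balls
  enter: the ball of radius 2^(-k) contributes at most \<open>8 * c * q ^ k\<close>, and the series
  sums to at most 32 c/e. The points with |z| at least 1 are covered by the volume of
  \<open>cball a R\<close>.\<close>

lemma wt_integral_bound: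
  fixes a :: space and R e :: real
  assumes e: "0 < e" "e \<le> 1" and R: "0 \<le> R"
  shows "integrable lborel (\<lambda>z. indicator (cball a R) z * wt e z)"
    and "(LINT z|lborel. indicator (cball a R) z * wt e z) \<le> unit_ball_vol 3 * (R ^ 3 + 32) / e"
proof -
  define c where "c = unit_ball_vol 3"
  have c: "0 \<le> c" unfolding c_def by (rule unit_ball_vol_nonneg) simp
  define q :: real where "q = 2 powr (- e)"
  have q: "0 \<le> q" "e / 4 \<le> 1 - q" "q < 1"
    using one_minus_two_powr_ge[OF e] e by (auto simp: q_def)
  let ?b = "\<lambda>k z. ennreal (8 * (2 powr (3 - e)) ^ k) * indicator (cball 0 ((1/2) ^ k)) (z::space)"
  have em: "emeasure lborel (cball (x::space) r) = ennreal (c * r ^ 3)" if "0 \<le> r" for x r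
    using emeasure_cball[OF that, of x] by (simp add: c_def)
  have pt: "ennreal (indicator (cball a R) z * wt e z) \<le> indicator (cball a R) z + (\<Sum>k. ?b k z)" for z
  proof (cases "norm z < 1 \<and> z \<noteq> 0")
    case True
    then obtain k where k: "z \<in> cball 0 ((1/2) ^ k)" "wt e z \<le> 8 * (2 powr (3 - e)) ^ k"
      using wt_dyadic e by blast
    have "ennreal (indicator (cball a R) z * wt e z) \<le> ?b k z"
      using k by (auto simp: indicator_def intro: ennreal_leI)
    also have "\<dots> \<le> (\<Sum>k. ?b k z)" by (rule ennreal_le_suminf)
    finally show ?thesis by (rule order_trans) simp
  next
    case False
    \<comment> \<open>This includes \<open>z = 0\<close>, where \<open>0 powr _ = 0\<close>.\<close>
    then have "wt e z \<le> 1" by (auto simp: wt_def min_def)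
    then have "ennreal (indicator (cball a R) z * wt e z) \<le> indicator (cball a R) z"
      by (auto simp: indicator_def)
    then show ?thesis by (rule order_trans) simp
  qed
  have bm: "?b k \<in> borel_measurable lborel" for k
    by (intro borel_measurable_times_ennreal borel_measurable_const borel_measurable_indicator) simp
  have S: "(\<lambda>k. 8 * c * q ^ k) sums (8 * c * (1 / (1 - q)))"
    using q by (intro sums_mult geometric_sums) simp
  have "(\<integral>\<^sup>+z. ennreal (indicator (cball a R) z * wt e z) \<partial>lborel)
      \<le> (\<integral>\<^sup>+z. indicator (cball a R) z + (\<Sum>k. ?b k z) \<partial>lborel)"
    by (intro nn_integral_mono pt)
  also have "\<dots> = emeasure lborel (cball a R) + (\<Sum>k. \<integral>\<^sup>+z. ?b k z \<partial>lborel)"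
  proof -
    have "(\<integral>\<^sup>+z. (\<Sum>k. ?b k z) \<partial>lborel) = (\<Sum>k. \<integral>\<^sup>+z. ?b k z \<partial>lborel)"
      by (rule nn_integral_suminf) (rule bm)
    moreover have "(\<integral>\<^sup>+z. indicator (cball a R) z + (\<Sum>k. ?b k z) \<partial>lborel)
        = (\<integral>\<^sup>+z. indicator (cball a R) z \<partial>lborel) + (\<integral>\<^sup>+z. (\<Sum>k. ?b k z) \<partial>lborel)"
      by (rule nn_integral_add) (rule borel_measurable_indicator, simp, rule borel_measurable_suminf_order, rule bm)
    moreover have "(\<integral>\<^sup>+z. indicator (cball a R) z \<partial>lborel) = emeasure lborel (cball a R)"
      by (rule nn_integral_indicator) simp
    ultimately show ?thesis by simp
  qed
  also have "(\<lambda>k. \<integral>\<^sup>+z. ?b k z \<partial>lborel) = (\<lambda>k. ennreal (8 * c * q ^ k))"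
  proof
    fix k :: nat
    have "(2 powr (3 - e)) ^ k * ((1/2) ^ k) ^ 3 = q ^ k"
    proof -
      have "2 powr (3 - e) * (1/2) ^ 3 = q" by (simp add: q_def powr_diff powr_minus field_simps)
      then have "q ^ k = (2 powr (3 - e)) ^ k * ((1/2) ^ 3) ^ k" by (metis power_mult_distrib)
      then show ?thesis by (simp only: power_mult[symmetric] mult.commute[of k 3])
    qed
    then have "8 * (2 powr (3 - e)) ^ k * (c * ((1/2) ^ k) ^ 3) = 8 * c * q ^ k" by (metis mult.assoc mult.commute)
    moreover have "(\<integral>\<^sup>+z. ?b k z \<partial>lborel) = ennreal (8 * (2 powr (3 - e)) ^ k) * ennreal (c * ((1/2) ^ k) ^ 3)"
      by (subst nn_integral_cmult_indicator) (simp_all add: em)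
    moreover have "\<dots> = ennreal (8 * (2 powr (3 - e)) ^ k * (c * ((1/2) ^ k) ^ 3))"
      by (rule ennreal_mult'[symmetric]) (use c in simp)
    ultimately show "(\<integral>\<^sup>+z. ?b k z \<partial>lborel) = ennreal (8 * c * q ^ k)"
      by (simp only:)
  qed
  also have "(\<Sum>k. ennreal (8 * c * q ^ k)) = ennreal (8 * c * (1 / (1 - q)))"
    using S q c by (intro suminf_ennreal_eq) auto
  also have "emeasure lborel (cball a R) + ennreal (8 * c * (1 / (1 - q))) = ennreal (c * R ^ 3 + 8 * c * (1 / (1 - q)))"
    unfolding em[OF R] by (rule ennreal_plus[symmetric]) (use c q R in auto)
  finally have nn: "(\<integral>\<^sup>+z. ennreal (indicator (cball a R) z * wt e z) \<partial>lborel) \<le> ennreal (c * R ^ 3 + 8 * c * (1 / (1 - q)))" .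
  show I: "integrable lborel (\<lambda>z. indicator (cball a R) z * wt e z)"
  proof (rule integrableI_nonneg)
    show "(\<integral>\<^sup>+z. ennreal (indicator (cball a R) z * wt e z) \<partial>lborel) < \<infinity>"
      using nn by (rule order_le_less_trans) simp
  qed (auto intro!: borel_measurable_times borel_measurable_indicator wt_measurable)
  have "ennreal (LINT z|lborel. indicator (cball a R) z * wt e z) \<le> ennreal (c * R ^ 3 + 8 * c * (1 / (1 - q)))"
    using nn by (subst nn_integral_eq_integral[symmetric, OF I]) auto
  then have "(LINT z|lborel. indicator (cball a R) z * wt e z) \<le> c * R ^ 3 + 8 * c * (1 / (1 - q))"
    using c q R by (subst (asm) ennreal_le_iff) auto
  also have "\<dots> \<le> c * R ^ 3 / e + 8 * c * (4 / e)"
  proof (intro add_mono mult_left_mono)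
    show "c * R ^ 3 \<le> c * R ^ 3 / e" using mult_left_mono[OF mult_right_mono[OF e(2), of "R ^ 3"] c] R e
      by (simp add: field_simps)
    show "1 / (1 - q) \<le> 4 / e" using q e by (simp add: field_simps)
  qed (use c in auto)
  also have "\<dots> = c * (R ^ 3 + 32) / e" by (simp add: algebra_simps add_divide_distrib)
  finally show "(LINT z|lborel. indicator (cball a R) z * wt e z) \<le> unit_ball_vol 3 * (R ^ 3 + 32) / e"
    by (simp add: c_def)
qed

section \<open>Displacements with small Lipschitz constant and their force\<close>

lemma norm_cspace_le:
  fixes Z :: cspace
  assumes "\<And>i. norm (Z $ i) \<le> K"
  shows "norm Z \<le> 3 * K"
proof -
  have "norm Z \<le> (\<Sum>i\<in>UNIV. norm (Z $ i))" unfolding norm_vec_def by (rule L2_set_le_sum) simp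
  also have "\<dots> \<le> (\<Sum>i\<in>(UNIV::3 set). K)" by (intro sum_mono assms)
  finally show ?thesis by simp
qed

text \<open>Interpolation: a difference bounded both by the increment and by |z| is bounded by any
  geometric mean of the two, which trades regularity in the increment for integrability in
  z.\<close>

lemma min_le_powr:
  fixes p q s :: real
  assumes "0 \<le> p" "0 \<le> q" "0 \<le> s" "s \<le> 1"
  shows "min p q \<le> p powr s * q powr (1 - s)"
proof (cases "min p q = 0")
  case True
  then show ?thesis by simp
next
  case False
  then have m: "0 < min p q" "0 < p" "0 < q" using assms by (auto simp: min_def split: if_splits)
  have "min p q = min p q powr s * min p q powr (1 - s)" using m by (simp add: powr_add[symmetric])
  also have "\<dots> \<le> p powr s * q powr (1 - s)"
    using m assms by (intro mult_mono powr_mono2) auto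
  finally show ?thesis .
qed

text \<open>The constant 1/8 is the margin required by \<open>cdot_near\<close>. The set
  \<open>B\<close> is all of space for the Picard iterates and a ball for the given flow.\<close>

definition lip_on :: "space set \<Rightarrow> (space \<Rightarrow> cspace) \<Rightarrow> bool" where
  "lip_on B V \<longleftrightarrow> (\<forall>a\<in>B. \<forall>b\<in>B. norm (V a - V b) \<le> norm (a - b) / 8)"

text \<open>The displacement gradient is small and, in terms of second differences, Hoelder continuous
  with exponent \<open>g\<close>.\<close>

definition adm :: "real \<Rightarrow> (space \<Rightarrow> cspace) \<Rightarrow> bool" where
  "adm g V \<longleftrightarrow> lip_on UNIV V \<and>
     (\<forall>a h k. norm (V (a + h + k) - V (a + h) - V (a + k) + V a) \<le> norm h * norm k powr g)"

text \<open>If \<open>V\<close> is the displacement X(a) - a, this is X(a) - X(a + z), the argument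
  of the kernel for the source particle at label a + z.\<close>

definition Zd :: "(space \<Rightarrow> cspace) \<Rightarrow> space \<Rightarrow> space \<Rightarrow> cspace" where
  "Zd V a z = V a - V (a + z) - cvec z"

definition G :: "(space \<Rightarrow> real) \<Rightarrow> (space \<Rightarrow> cspace) \<Rightarrow> space \<Rightarrow> 3 \<Rightarrow> space \<Rightarrow> complex" where
  "G \<rho> V a i z = complex_of_real (\<rho> (a + z)) * Kc (Zd V a z) $ i"

definition lag_force :: "(space \<Rightarrow> real) \<Rightarrow> (space \<Rightarrow> cspace) \<Rightarrow> space \<Rightarrow> cspace" where
  "lag_force \<rho> V a = (\<chi> i. LINT z|lborel. G \<rho> V a i z)"

lemma Zd_near:
  assumes "lip_on B V" "a \<in> B" "a + z \<in> B"
  shows "norm (Zd V a z + cvec z) \<le> norm z / 8"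
  using bspec[OF bspec[OF assms(1)[unfolded lip_on_def] assms(2)] assms(3)] by (simp add: Zd_def)

lemma Kc_0 [simp]: "Kc 0 $ i = 0"
  by (simp add: Kc_def)

lemma Zd_0 [simp]: "Zd V a 0 = 0"
  by (simp add: Zd_def)

text \<open>One constant \<open>M\<close> serves for all exponents \<open>g\<close>, because the
  exponent of the iterates varies with time. The asymmetry of \<open>d2\<close>, Lipschitz in h and
  Hoelder in k, matches the bound on the displacement in \<open>adm\<close>.\<close>

locale compact_density =
  fixes \<rho> :: "space \<Rightarrow> real" and R M :: real
  assumes R: "0 \<le> R" and supp: "\<And>y. \<rho> y \<noteq> 0 \<Longrightarrow> y \<in> cball 0 R"
    and cont: "continuous_on UNIV \<rho>" and bd: "\<And>y. \<bar>\<rho> y\<bar> \<le> M"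
    and d1: "\<And>a h. \<bar>\<rho> (a + h) - \<rho> a\<bar> \<le> M * norm h"
    and d1': "\<And>a h g. \<lbrakk>0 < g; g \<le> 1\<rbrakk> \<Longrightarrow> \<bar>\<rho> (a + h) - \<rho> a\<bar> \<le> M * norm h powr g"
    and d2: "\<And>a h k g. \<lbrakk>0 < g; g \<le> 1\<rbrakk> \<Longrightarrow>
      \<bar>\<rho> (a + h + k) - \<rho> (a + h) - \<rho> (a + k) + \<rho> a\<bar> \<le> M * norm h * norm k powr g"
begin

text \<open>One factor 4 comes from multiplying density and kernel by \<open>quad_mult\<close>, the
  other from the at most four translates of the support that occur in a mixed difference.\<close>

definition CI :: real where "CI = 16 * M * CK * (unit_ball_vol 3 * (R ^ 3 + 32))"

lemma M_nonneg: "0 \<le> M"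
  using bd[of 0] by linarith

lemma CI_nonneg: "0 \<le> CI"
  unfolding CI_def CK_def using M_nonneg R by (intro mult_nonneg_nonneg) auto

lemma rho_measurable [measurable]: "\<rho> \<in> borel_measurable borel"
  by (rule borel_measurable_continuous_onI[OF cont])

text \<open>The common last step of all force estimates: \<open>f\<close> is a combination of
  integrands centred at the points of \<open>A\<close>, so its support lies in the union of the
  balls of radius \<open>R\<close> about \<open>- c\<close>; \<open>K\<close> carries the increments
  and \<open>e\<close> the remaining integrability.\<close>

lemma integral_wt_bound:
  fixes f :: "space \<Rightarrow> complex"
  assumes e: "0 < e" "e \<le> 1" and K: "0 \<le> K"
    and [measurable]: "f \<in> borel_measurable lborel" and A: "finite A" "card A \<le> 4"
    and b: "\<And>z. z \<noteq> 0 \<Longrightarrow> norm (f z) \<le> 4 * M * CK * K * wt e z" "f 0 = 0"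
    and s: "\<And>z. (\<And>c. c \<in> A \<Longrightarrow> \<rho> (c + z) = 0) \<Longrightarrow> f z = 0"
  shows "integrable lborel f" "norm (LINT z|lborel. f z) \<le> CI * K / e"
proof -
  define L where "L = 4 * M * CK * K"
  have L: "0 \<le> L" unfolding L_def CK_def using M_nonneg K by (intro mult_nonneg_nonneg) auto
  let ?w = "\<lambda>z. L * (\<Sum>c\<in>A. indicator (cball (-c) R) z * wt e z)"
  have b': "norm (f z) \<le> ?w z" for z
  proof (cases "f z = 0")
    case True
    then show ?thesis using L by (auto intro!: mult_nonneg_nonneg sum_nonneg)
  next
    case False
    then obtain c where c: "c \<in> A" "\<rho> (c + z) \<noteq> 0" using s by blast
    from supp[OF c(2)] have "z \<in> cball (-c) R" by (simp add: dist_norm norm_minus_commute add.commute)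
    then have "wt e z \<le> indicator (cball (-c) R) z * wt e z" by simp
    also have "\<dots> \<le> (\<Sum>c\<in>A. indicator (cball (-c) R) z * wt e z)"
      using c A by (intro member_le_sum) auto
    finally have "L * wt e z \<le> ?w z" using L by (rule mult_left_mono)
    moreover have "z \<noteq> 0" using False b(2) by metis
    ultimately show ?thesis using b(1) unfolding L_def by (meson order_trans)
  qed
  have iw: "integrable lborel ?w"
    using wt_integral_bound(1)[OF e R] by (intro integrable_mult_right Bochner_Integration.integrable_sum)
  show I: "integrable lborel f"
    by (rule Bochner_Integration.integrable_bound[OF iw]) (use b' L in \<open>auto intro!: AE_I2 order_trans[OF b']\<close>)
  have "norm (LINT z|lborel. f z) \<le> (LINT z|lborel. ?w z)"
    by (rule order_trans[OF integral_norm_bound Bochner_Integration.integral_mono[OF integrable_norm[OF I] iw b']])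
  also have "\<dots> = L * (\<Sum>c\<in>A. LINT z|lborel. indicator (cball (-c) R) z * wt e z)"
    using wt_integral_bound(1)[OF e R] by (subst integral_mult_right_zero, subst Bochner_Integration.integral_sum) auto
  also have "\<dots> \<le> L * (\<Sum>c\<in>A. unit_ball_vol 3 * (R ^ 3 + 32) / e)"
    by (intro mult_left_mono L sum_mono wt_integral_bound(2)[OF e R])
  also have "\<dots> \<le> L * (4 * (unit_ball_vol 3 * (R ^ 3 + 32) / e))"
  proof (intro mult_left_mono L)
    have "0 \<le> unit_ball_vol 3 * (R ^ 3 + 32) / e" using e R by auto
    then show "(\<Sum>c\<in>A. unit_ball_vol 3 * (R ^ 3 + 32) / e) \<le> 4 * (unit_ball_vol 3 * (R ^ 3 + 32) / e)"
      using A(2) by (simp only: sum_constant) (intro mult_right_mono, auto)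
  qed
  also have "\<dots> = CI * K / e" by (simp add: L_def CI_def)
  finally show "norm (LINT z|lborel. f z) \<le> CI * K / e" .
qed

text \<open>Combines the kernel size |z|^-2 with the power of |z| in the relative increment into one
  integrable weight.\<close>

lemma wt_ge:
  assumes "z \<noteq> 0" "e \<le> 1" "p = min (norm z) 1"
  shows "p powr (e - 1) / (norm z)\<^sup>2 \<le> wt e z"
proof -
  have p: "0 < p" "p \<le> norm z" using assms by auto
  have "p powr (e - 1) / (norm z)\<^sup>2 \<le> p powr (e - 1) / p\<^sup>2"
    using p assms(1) by (intro divide_left_mono power_mono mult_pos_pos) auto
  also have "\<dots> = p powr (e - 3)" using p by (simp add: powr_diff power2_eq_square power3_eq_cube)
  finally show ?thesis by (simp add: wt_def assms)
qed

text \<open>Since \<open>V\<close> is controlled on \<open>B\<close> only, the integrand is known to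
  be continuous only where \<open>a + z \<in> B\<close> and \<open>z \<noteq> 0\<close>. Elsewhere
  it is zero, by the support of the density or by the value of \<open>Kc\<close> at 0.\<close>

lemma G_measurable:
  assumes V: "lip_on B V" and B: "closed B" "cball 0 R \<subseteq> B" "a \<in> B"
  shows "G \<rho> V a i \<in> borel_measurable borel"
proof -
  define S where "S = {z. a + z \<in> B} - {0}"
  have clS: "closed {z. a + z \<in> B}"
    using continuous_closed_vimage[OF B(1), of "\<lambda>z. a + z"] by (auto simp: vimage_def intro!: continuous_intros)
  then have S: "S \<in> sets borel" unfolding S_def by auto
  have cV: "continuous_on B V"
    by (rule lipschitz_on_continuous_on[where L = "1/8"], rule lipschitz_onI)
      (use V in \<open>auto simp: lip_on_def dist_norm\<close>)
  have cZ: "continuous_on S (Zd V a)"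
    unfolding Zd_def cvec_def
    by (intro continuous_intros continuous_on_compose2[OF cV] continuous_on_vec_lambda) (auto simp: S_def)
  have Sz: "z \<noteq> 0" "a + z \<in> B" if "z \<in> S" for z using that by (auto simp: S_def)
  have re: "0 < Re (cdot (Zd V a z) (Zd V a z))" if "z \<in> S" for z
  proof -
    have "0 < (norm z)\<^sup>2 / 2" using Sz[OF that] by simp
    also have "\<dots> \<le> Re (cdot (Zd V a z) (Zd V a z))"
      by (rule cdot_near(1)[OF Zd_near[OF V B(3) Sz(2)[OF that]]])
    finally show ?thesis .
  qed
  have cD: "continuous_on S (\<lambda>z. cdot (Zd V a z) (Zd V a z))"
    unfolding cdot_def by (intro continuous_intros cZ)
  have cs: "continuous_on S (\<lambda>z. csqrt (cdot (Zd V a z) (Zd V a z)))"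
    by (rule continuous_on_compose2[OF continuous_on_csqrt cD])
      (use re in \<open>force simp: complex_nonpos_Reals_iff\<close>)
  have nz: "cdot (Zd V a z) (Zd V a z) \<noteq> 0" if "z \<in> S" for z using re[OF that] by force
  have "continuous_on S (G \<rho> V a i)"
    unfolding G_def Kc_def vec_lambda_beta
    by (intro continuous_intros cs cD cZ continuous_on_compose2[OF cont])
      (use nz in auto)
  from borel_measurable_continuous_on_indicator[OF S this]
  have "(\<lambda>z. indicator S z *\<^sub>R G \<rho> V a i z) \<in> borel_measurable borel" .
  moreover have "(\<lambda>z. indicator S z *\<^sub>R G \<rho> V a i z) = G \<rho> V a i"
  proof
    fix z
    have "G \<rho> V a i z = 0" if "z \<notin> S"
    proof (cases "z = 0")
      case True
      then show ?thesis by (simp add: G_def)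
    next
      case False
      then have "a + z \<notin> B" using that by (auto simp: S_def)
      then have "\<rho> (a + z) = 0" using supp B(2) by blast
      then show ?thesis by (simp add: G_def)
    qed
    then show "indicator S z *\<^sub>R G \<rho> V a i z = G \<rho> V a i z" by (cases "z \<in> S") auto
  qed
  ultimately show ?thesis by simp
qed

section \<open>Size, log-Lipschitz dependence and spatial regularity of the force\<close>

lemma quad_rho_const: "quad M 0 0 0 (complex_of_real (\<rho> y)) (complex_of_real (\<rho> y)) (complex_of_real (\<rho> y)) (complex_of_real (\<rho> y))"
  using bd[of y] by (intro quad_const) auto

lemma norm_G_le:
  assumes V: "lip_on B V" "cball 0 R \<subseteq> B" "a \<in> B" and z: "z \<noteq> 0"
  shows "norm (G \<rho> V a i z) \<le> 4 * M * CK / (norm z)\<^sup>2"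
proof (cases "\<rho> (a + z) = 0")
  case True
  then show ?thesis using M_nonneg by (simp add: G_def CK_def)
next
  case False
  then have "a + z \<in> B" using supp V by blast
  note n = Zd_near[OF V(1,3) this]
  have "quad (CK / (norm z)\<^sup>2) 0 0 0 (Kc (Zd V a z) $ i) (Kc (Zd V a z) $ i) (Kc (Zd V a z) $ i) (Kc (Zd V a z) $ i)"
    by (rule quad_Kc[OF _ _ _ z n n n n]) auto
  from quadD(1)[OF quad_mult[OF _ _ _ quad_rho_const[of "a + z"] this]]
  show ?thesis by (simp add: G_def)
qed

lemma norm_G_le_wt:
  assumes V: "lip_on B V" "cball 0 R \<subseteq> B" "a \<in> B" and z: "z \<noteq> 0"
  shows "norm (G \<rho> V a i z) \<le> 4 * M * CK * 1 * wt 1 z"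
proof -
  have "4 * M * CK * (1 / (norm z)\<^sup>2) \<le> 4 * M * CK * wt 1 z"
    using wt_ge[OF z order_refl refl, simplified] z M_nonneg
    by (intro mult_left_mono) (auto simp: CK_def min_def split: if_splits)
  with norm_G_le[OF assms, of i] show ?thesis unfolding mult_1_right times_divide_eq_right by linarith
qed

lemma G_integrable:
  assumes V: "lip_on B V" "closed B" "cball 0 R \<subseteq> B" "a \<in> B"
  shows "integrable lborel (G \<rho> V a i)"
    and "norm (LINT z|lborel. G \<rho> V a i z) \<le> CI"
proof -
  have m: "G \<rho> V a i \<in> borel_measurable lborel" using G_measurable[OF V] by simp
  have z: "G \<rho> V a i z = 0" if "\<And>c. c \<in> {a} \<Longrightarrow> \<rho> (c + z) = 0" for z
    using that by (simp add: G_def)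
  have 0: "G \<rho> V a i 0 = 0" by (simp add: G_def)
  note I = integral_wt_bound[OF zero_less_one order_refl zero_le_one m _ _ norm_G_le_wt[OF V(1,3,4)] 0 z, of "{a}"]
  show "integrable lborel (G \<rho> V a i)" "norm (LINT z|lborel. G \<rho> V a i z) \<le> CI"
    using I by auto
qed

lemma norm_lag_force_le:
  assumes V: "lip_on B V" "closed B" "cball 0 R \<subseteq> B" "a \<in> B"
  shows "norm (lag_force \<rho> V a) \<le> 3 * CI"
  by (rule norm_cspace_le) (simp add: lag_force_def G_integrable(2)[OF V])

text \<open>The two kernel arguments differ by at most \<open>2 * s\<close> and, both displacements
  being Lipschitz, by at most |z|. Interpolation gives
  \<open>2 * s powr (1 - e) * norm z powr e\<close>, and the spare power of |z| makes the integral
  converge at the price 1/e. Keeping \<open>e\<close> free encodes the log-Lipschitz modulus without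
  logarithms.\<close>

lemma lag_force_diff_le:
  assumes V: "lip_on B V" and W: "lip_on B W" and B: "closed B" "cball 0 R \<subseteq> B" "a \<in> B"
    and s: "\<And>b. b \<in> B \<Longrightarrow> norm (V b - W b) \<le> s" and e: "0 < e" "e \<le> 1"
  shows "norm (lag_force \<rho> V a - lag_force \<rho> W a) \<le> 6 * CI / e * s powr (1 - e)"
proof -
  have s0: "0 \<le> s" using s[OF B(3)] norm_ge_zero order_trans by blast
  have "norm (lag_force \<rho> V a $ i - lag_force \<rho> W a $ i) \<le> CI * (2 * s powr (1 - e)) / e" for i
  proof -
    let ?f = "\<lambda>z. G \<rho> V a i z - G \<rho> W a i z"
    have m: "?f \<in> borel_measurable lborel" using G_measurable[OF V B] G_measurable[OF W B] by simp
    have b: "norm (?f z) \<le> 4 * M * CK * (2 * s powr (1 - e)) * wt e z" if z: "z \<noteq> 0" for z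
    proof (cases "\<rho> (a + z) = 0")
      case True
      then show ?thesis using M_nonneg by (simp add: G_def CK_def)
    next
      case False
      then have az: "a + z \<in> B" using supp B by blast
      note nV = Zd_near[OF V B(3) az] and nW = Zd_near[OF W B(3) az]
      define x where "x = 2 * s powr (1 - e) * norm z powr (e - 1)"
      have eq: "Zd V a z - Zd W a z = (V a - W a) - (V (a + z) - W (a + z))" by (simp add: Zd_def)
      have 1: "norm (Zd V a z - Zd W a z) \<le> 2 * s"
        unfolding eq using norm_triangle_ineq4[of "V a - W a" "V (a + z) - W (a + z)"] s[OF B(3)] s[OF az] by linarith
      have 2: "norm (Zd V a z - Zd W a z) \<le> norm z"
      proof -
        have "Zd V a z - Zd W a z = (Zd V a z + cvec z) - (Zd W a z + cvec z)" by simp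
        then have "norm (Zd V a z - Zd W a z) \<le> norm (Zd V a z + cvec z) + norm (Zd W a z + cvec z)"
          by (simp only: norm_triangle_ineq4)
        with nV nW norm_ge_zero[of z] show ?thesis by linarith
      qed
      have "norm (Zd V a z - Zd W a z) \<le> min (2 * s) (norm z)" using 1 2 by simp
      also have "\<dots> \<le> (2 * s) powr (1 - e) * norm z powr (1 - (1 - e))"
        using s0 e by (intro min_le_powr) auto
      also have "\<dots> \<le> 2 * s powr (1 - e) * norm z powr e"
      proof -
        have "(2 * s) powr (1 - e) = 2 powr (1 - e) * s powr (1 - e)" using s0 by (simp add: powr_mult)
        moreover have "2 powr (1 - e) \<le> (2::real) powr 1" using e by (intro powr_mono) auto
        ultimately show ?thesis by (auto intro!: mult_right_mono)
      qed
      also have "\<dots> = norm z * x" using z by (simp add: x_def powr_diff)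
      finally have 3: "norm (Zd V a z - Zd W a z) \<le> norm z * x" .
      have x0: "0 \<le> x" using s0 by (simp add: x_def)
      \<comment> \<open>Only the comparison of \<open>V\<close> with \<open>W\<close> is wanted: the
        first direction of \<open>quad\<close> exchanges them and the second is trivial.\<close>
      have "quad (CK / (norm z)\<^sup>2) x 0 0 (Kc (Zd V a z) $ i) (Kc (Zd W a z) $ i) (Kc (Zd V a z) $ i) (Kc (Zd W a z) $ i)"
        by (rule quad_Kc[OF x0 _ _ z nV nW nV nW 3 3]) auto
      moreover have "quad M x 0 0 (complex_of_real (\<rho> (a + z))) (complex_of_real (\<rho> (a + z))) (complex_of_real (\<rho> (a + z))) (complex_of_real (\<rho> (a + z)))"
        using bd[of "a + z"] x0 by (intro quad_const) auto
      ultimately have "quad (4 * M * (CK / (norm z)\<^sup>2)) x 0 0 (G \<rho> V a i z) (G \<rho> W a i z) (G \<rho> V a i z) (G \<rho> W a i z)"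
        unfolding G_def using x0 by (intro quad_mult) auto
      from quadD(5)[OF this] have "norm (?f z) \<le> 4 * M * (CK / (norm z)\<^sup>2) * x" .
      also have "\<dots> = 4 * M * CK * (2 * s powr (1 - e)) * (norm z powr (e - 1) / (norm z)\<^sup>2)"
        by (simp add: x_def)
      also have "\<dots> \<le> 4 * M * CK * (2 * s powr (1 - e)) * wt e z"
      proof (intro mult_left_mono)
        have "norm z powr (e - 1) \<le> min (norm z) 1 powr (e - 1)" using z e by (intro powr_mono2') auto
        then have "norm z powr (e - 1) / (norm z)\<^sup>2 \<le> min (norm z) 1 powr (e - 1) / (norm z)\<^sup>2" by (intro divide_right_mono) auto
        also have "\<dots> \<le> wt e z" by (rule wt_ge[OF z e(2) refl])
        finally show "norm z powr (e - 1) / (norm z)\<^sup>2 \<le> wt e z" .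
      qed (use M_nonneg s0 in \<open>auto simp: CK_def\<close>)
      finally show ?thesis .
    qed
    have z: "?f z = 0" if "\<And>c. c \<in> {a} \<Longrightarrow> \<rho> (c + z) = 0" for z
      using that by (simp add: G_def)
    have 0: "?f 0 = 0" by (simp add: G_def)
    have K: "0 \<le> 2 * s powr (1 - e)" by simp
    have "norm (LINT z|lborel. ?f z) \<le> CI * (2 * s powr (1 - e)) / e"
      by (rule integral_wt_bound(2)[OF e K m _ _ b 0 z, of "{a}"]) auto
    then show ?thesis
      using G_integrable(1)[OF V B] G_integrable(1)[OF W B] by (simp add: lag_force_def)
  qed
  then have "norm (lag_force \<rho> V a - lag_force \<rho> W a) \<le> 3 * (CI * (2 * s powr (1 - e)) / e)"
    by (intro norm_cspace_le) simp
  then show ?thesis by (simp add: algebra_simps)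
qed

text \<open>In h the argument changes by a second difference with increments h and z, of size |h|
  |z|^g. In k it changes by at most min(|k|, |z|), which is interpolated. The mixed difference is
  bounded by 2 |h| |k|^g and by 2 |h| |z|^g, and the power g of min(|k|, |z|) is split into g' and g
  - g'. Dividing by |z| gives the relative increments; \<open>p\<close> replaces |z| so that they
  also dominate the increments of the density, which do not improve for small z.\<close>

lemma quad_G:
  assumes V: "adm g V" and g: "0 < g'" "g' \<le> g" "g \<le> 1" and z: "z \<noteq> 0"
    and p: "p = min (norm z) 1"
  shows "quad (4 * M * (CK / (norm z)\<^sup>2)) (norm h * p powr (g - 1)) (norm k powr g' * p powr (- g'))
      (2 * norm h * norm k powr g' * p powr (g - g' - 1))
      (G \<rho> V a i z) (G \<rho> V (a + h) i z) (G \<rho> V (a + k) i z) (G \<rho> V (a + h + k) i z)"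
    (is "quad _ ?x ?y ?w _ _ _ _")
proof -
  define r where "r = norm z"
  have r: "0 < r" "0 < p" "p \<le> r" "p \<le> 1" using z p by (auto simp: r_def)
  have lip: "lip_on UNIV V" and ad: "\<And>a h k. norm (V (a + h + k) - V (a + h) - V (a + k) + V a) \<le> norm h * norm k powr g"
    using V by (auto simp: adm_def)
  have lip': "norm (V a - V b) \<le> norm (a - b) / 8" for a b using lip by (simp add: lip_on_def)
  have near: "norm (Zd V b z + cvec z) \<le> norm z / 8" for b by (rule Zd_near[OF lip]) auto
  have xyw: "0 \<le> ?x" "0 \<le> ?y" "?x * ?y \<le> ?w"
  proof -
    have "p powr (g - 1) * p powr (- g') = p powr (g - g' - 1)"
      using r by (simp flip: powr_add add: algebra_simps)
    moreover have "?x * ?y = norm h * norm k powr g' * (p powr (g - 1) * p powr (- g'))" by (simp only: ac_simps)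
    ultimately have "?x * ?y = norm h * norm k powr g' * p powr (g - g' - 1)" by (simp only:)
    moreover have "?w = 2 * (norm h * norm k powr g' * p powr (g - g' - 1))" "0 \<le> norm h * norm k powr g' * p powr (g - g' - 1)"
      by (simp_all only: mult.assoc mult_nonneg_nonneg norm_ge_zero powr_ge_zero)
    ultimately show "?x * ?y \<le> ?w" by linarith
  qed auto
  have p1: "1 \<le> p powr t" if "t \<le> 0" for t
    using r that powr_mono2'[of t p 1] by simp
  have rp: "r powr t \<le> p powr t" if "t \<le> 0" for t
    using r that by (intro powr_mono2') auto
  have qr: "quad M ?x ?y ?w (complex_of_real (\<rho> (a + z))) (complex_of_real (\<rho> (a + h + z)))
      (complex_of_real (\<rho> (a + k + z))) (complex_of_real (\<rho> (a + h + k + z)))"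
  proof -
    have g'1: "g' \<le> 1" using g by simp
    have x: "\<bar>\<rho> (b + h + z) - \<rho> (b + z)\<bar> \<le> M * ?x" for b
    proof -
      have "M * norm h * 1 \<le> M * norm h * p powr (g - 1)" using g M_nonneg by (intro mult_left_mono p1) auto
      with d1[of "b + z" h] show ?thesis by (simp add: algebra_simps)
    qed
    have y: "\<bar>\<rho> (b + k + z) - \<rho> (b + z)\<bar> \<le> M * ?y" for b
    proof -
      have "M * norm k powr g' * 1 \<le> M * norm k powr g' * p powr (- g')" using g M_nonneg by (intro mult_left_mono p1) auto
      with d1'[OF g(1) g'1, of "b + z" k] show ?thesis by (simp add: algebra_simps)
    qed
    have "M * norm h * norm k powr g' * 1 \<le> M * norm h * norm k powr g' * (2 * p powr (g - g' - 1))"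
      using g M_nonneg p1[of "g - g' - 1"] by (intro mult_left_mono) auto
    with d2[OF g(1) g'1, of "a + z" h k]
    have w: "\<bar>\<rho> (a + h + k + z) - \<rho> (a + h + z) - \<rho> (a + k + z) + \<rho> (a + z)\<bar> \<le> M * ?w"
      by (simp add: algebra_simps)
    have w': "\<bar>\<rho> (a + z) - \<rho> (a + h + z) - \<rho> (a + k + z) + \<rho> (a + h + k + z)\<bar> \<le> M * ?w"
      using w by (simp add: algebra_simps)
    show ?thesis
      unfolding quad_def of_real_diff[symmetric] of_real_add[symmetric] norm_of_real
      using bd x[of a] x[of "a + k"] y[of a] y[of "a + h"] w'
      by (simp add: abs_minus_commute add.commute add.left_commute)
  qed
  have min: "min (norm k) r \<le> norm k powr g' * r powr (1 - g')"
    using g r by (intro min_le_powr) auto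
  have dx: "norm (Zd V b z - Zd V (b + h) z) \<le> norm z * ?x" for b
  proof -
    have "Zd V b z - Zd V (b + h) z = V (b + h + z) - V (b + h) - V (b + z) + V b"
      by (simp add: Zd_def)
    then have "norm (Zd V b z - Zd V (b + h) z) \<le> norm h * r powr g" using ad[of b h z] by (simp add: r_def)
    also have "\<dots> = r * (norm h * r powr (g - 1))" using r by (simp add: powr_diff)
    also have "\<dots> \<le> r * ?x" using g r by (intro mult_left_mono rp) auto
    finally show ?thesis by (simp add: r_def)
  qed
  have dy: "norm (Zd V b z - Zd V (b + k) z) \<le> norm z * ?y" for b
  proof -
    have e1: "Zd V b z - Zd V (b + k) z = (V b - V (b + k)) - (V (b + z) - V (b + k + z))"
      and e2: "Zd V b z - Zd V (b + k) z = (V b - V (b + z)) - (V (b + k) - V (b + k + z))"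
      by (simp_all add: Zd_def)
    have "norm (Zd V b z - Zd V (b + k) z) \<le> norm k"
      unfolding e1 using norm_triangle_ineq4[of "V b - V (b + k)" "V (b + z) - V (b + k + z)"]
        lip'[of b "b + k"] lip'[of "b + z" "b + k + z"] norm_ge_zero[of k] by (simp del: norm_ge_zero)
    moreover have "norm (Zd V b z - Zd V (b + k) z) \<le> r"
      unfolding e2 using norm_triangle_ineq4[of "V b - V (b + z)" "V (b + k) - V (b + k + z)"]
        lip'[of b "b + z"] lip'[of "b + k" "b + k + z"] norm_ge_zero[of z] by (simp add: r_def del: norm_ge_zero)
    ultimately have "norm (Zd V b z - Zd V (b + k) z) \<le> norm k powr g' * r powr (1 - g')" using min by linarith
    also have "\<dots> = r * (norm k powr g' * r powr (- g'))" using r by (simp add: powr_diff powr_minus field_simps)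
    also have "\<dots> \<le> r * ?y" using g r by (intro mult_left_mono rp) auto
    finally show ?thesis by (simp add: r_def)
  qed
  have dw: "norm (Zd V a z - Zd V (a + h) z - Zd V (a + k) z + Zd V (a + h + k) z) \<le> norm z * ?w" (is "norm ?D \<le> _")
  proof -
    \<comment> \<open>The same eight values grouped in two ways: second differences in h, k at a and
      a + z, or in h, z at a and a + k.\<close>
    have e1: "?D = (V (a + h + k) - V (a + h) - V (a + k) + V a)
       - (V (a + z + h + k) - V (a + z + h) - V (a + z + k) + V (a + z))"
      and e2: "?D = (V (a + h + z) - V (a + h) - V (a + z) + V a)
       - (V (a + k + h + z) - V (a + k + h) - V (a + k + z) + V (a + k))"
      by (simp_all add: Zd_def algebra_simps)
    have "norm ?D \<le> 2 * norm h * norm k powr g"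
      unfolding e1 using order_trans[OF norm_triangle_ineq4 add_mono[OF ad[of a h k] ad[of "a + z" h k]]] by linarith
    moreover have "norm ?D \<le> 2 * norm h * r powr g"
      unfolding e2 r_def using order_trans[OF norm_triangle_ineq4 add_mono[OF ad[of a h z] ad[of "a + k" h z]]] by linarith
    ultimately have "norm ?D \<le> 2 * norm h * min (norm k) r powr g" by (simp add: min_def)
    also have "min (norm k) r powr g \<le> norm k powr g' * r powr (g - g')"
    proof -
      have "min (norm k) r powr g = min (norm k) r powr g' * min (norm k) r powr (g - g')"
        by (simp flip: powr_add)
      also have "\<dots> \<le> norm k powr g' * r powr (g - g')"
        using r g by (intro mult_mono powr_mono2) auto
      finally show ?thesis .
    qed
    also have "2 * norm h * (norm k powr g' * r powr (g - g')) = r * (2 * norm h * norm k powr g' * r powr (g - g' - 1))"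
      using r by (simp add: powr_diff)
    also have "\<dots> \<le> r * ?w" using g r by (intro mult_left_mono rp) auto
    finally show ?thesis by (simp add: r_def mult_left_mono)
  qed
  have "quad (CK / (norm z)\<^sup>2) ?x ?y ?w (Kc (Zd V a z) $ i) (Kc (Zd V (a + h) z) $ i) (Kc (Zd V (a + k) z) $ i) (Kc (Zd V (a + h + k) z) $ i)"
    using dx[of a] dx[of "a + k"] dy[of a] dy[of "a + h"] dw
    by (intro quad_Kc[OF xyw z near near near near]) (auto simp: add.commute add.left_commute)
  then show ?thesis unfolding G_def by (intro quad_mult[OF xyw] qr)
qed

text \<open>The case k = 0, g' = g of \<open>quad_G\<close>: the gain |z|^g in the h-difference
  makes the integral converge, so a Lipschitz bound comes without loss of exponent.\<close>

lemma lag_force_d1: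
  assumes V: "adm g V" and g: "0 < g" "g \<le> 1"
  shows "norm (lag_force \<rho> V (a + h) - lag_force \<rho> V a) \<le> 3 * CI / g * norm h"
proof -
  have L: "lip_on UNIV V" using V by (simp add: adm_def)
  have "norm (lag_force \<rho> V (a + h) $ i - lag_force \<rho> V a $ i) \<le> CI * norm h / g" for i
  proof -
    let ?f = "\<lambda>z. G \<rho> V (a + h) i z - G \<rho> V a i z"
    have m: "?f \<in> borel_measurable lborel" using G_measurable[OF L] by simp
    have b: "norm (?f z) \<le> 4 * M * CK * norm h * wt g z" if z: "z \<noteq> 0" for z
    proof -
      have "norm (?f z) \<le> 4 * M * (CK / (norm z)\<^sup>2) * (norm h * min (norm z) 1 powr (g - 1))"
        using quadD(5)[OF quad_G[OF V g(1) order_refl g(2) z refl, of h 0 a i]] by (simp add: norm_minus_commute)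
      also have "\<dots> = 4 * M * CK * norm h * (min (norm z) 1 powr (g - 1) / (norm z)\<^sup>2)" by simp
      also have "\<dots> \<le> 4 * M * CK * norm h * wt g z"
        using wt_ge[OF z g(2) refl] M_nonneg by (intro mult_left_mono) (auto simp: CK_def)
      finally show ?thesis .
    qed
    have z: "?f z = 0" if "\<And>c. c \<in> {a, a + h} \<Longrightarrow> \<rho> (c + z) = 0" for z
      using that by (simp add: G_def)
    have 0: "?f 0 = 0" by (simp add: G_def)
    have "norm (LINT z|lborel. ?f z) \<le> CI * norm h / g"
      by (rule integral_wt_bound(2)[OF g norm_ge_zero m _ _ b 0 z, of "{a, a + h}"]) (auto simp: card_insert_if)
    then show ?thesis using G_integrable(1)[OF L] by (simp add: lag_force_def)
  qed
  then have "norm (lag_force \<rho> V (a + h) - lag_force \<rho> V a) \<le> 3 * (CI * norm h / g)"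
    by (intro norm_cspace_le) simp
  then show ?thesis by simp
qed

text \<open>Giving up g - g' in the exponent of |k| leaves the weight |z|^(g - g' - 3), whose
  integral is of order 1/(g - g').\<close>

lemma lag_force_d2:
  assumes V: "adm g V" and g: "0 < g'" "g' < g" "g \<le> 1"
  shows "norm (lag_force \<rho> V (a + h + k) - lag_force \<rho> V (a + h) - lag_force \<rho> V (a + k) + lag_force \<rho> V a)
    \<le> 6 * CI / (g - g') * (norm h * norm k powr g')"
proof -
  have L: "lip_on UNIV V" using V by (simp add: adm_def)
  let ?K = "2 * norm h * norm k powr g'"
  have "norm (lag_force \<rho> V (a + h + k) $ i - lag_force \<rho> V (a + h) $ i - lag_force \<rho> V (a + k) $ i + lag_force \<rho> V a $ i) \<le> CI * ?K / (g - g')" for i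
  proof -
    let ?f = "\<lambda>z. G \<rho> V (a + h + k) i z - G \<rho> V (a + h) i z - G \<rho> V (a + k) i z + G \<rho> V a i z"
    have m: "?f \<in> borel_measurable lborel" using G_measurable[OF L] by simp
    have e: "0 < g - g'" "g - g' \<le> 1" using g by auto
    have b: "norm (?f z) \<le> 4 * M * CK * ?K * wt (g - g') z" if z: "z \<noteq> 0" for z
    proof -
      have "?f z = G \<rho> V a i z - G \<rho> V (a + h) i z - G \<rho> V (a + k) i z + G \<rho> V (a + h + k) i z" by simp
      then have "norm (?f z) \<le> 4 * M * (CK / (norm z)\<^sup>2) * (?K * min (norm z) 1 powr (g - g' - 1))"
        using quadD(9)[OF quad_G[OF V g(1) less_imp_le[OF g(2)] g(3) z refl, of h k a i]] by (simp only:)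
      also have "\<dots> = 4 * M * CK * ?K * (min (norm z) 1 powr (g - g' - 1) / (norm z)\<^sup>2)" by simp
      also have "\<dots> \<le> 4 * M * CK * ?K * wt (g - g') z"
        using wt_ge[OF z e(2) refl] M_nonneg by (intro mult_left_mono) (auto simp: CK_def)
      finally show ?thesis .
    qed
    have z: "?f z = 0" if "\<And>c. c \<in> {a, a + h, a + k, a + h + k} \<Longrightarrow> \<rho> (c + z) = 0" for z
      using that by (simp add: G_def)
    have 0: "?f 0 = 0" by (simp add: G_def)
    have "norm (LINT z|lborel. ?f z) \<le> CI * ?K / (g - g')"
      by (rule integral_wt_bound(2)[OF e _ m _ _ b 0 z, of "{a, a + h, a + k, a + h + k}"]) (auto simp: card_insert_if)
    then show ?thesis using G_integrable(1)[OF L] by (simp add: lag_force_def)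
  qed
  then have "norm (lag_force \<rho> V (a + h + k) - lag_force \<rho> V (a + h) - lag_force \<rho> V (a + k) + lag_force \<rho> V a) \<le> 3 * (CI * ?K / (g - g'))"
    by (intro norm_cspace_le) simp
  then show ?thesis by (simp add: mult.assoc)
qed

end

section \<open>Picard iteration in complex time\<close>

text \<open>Domination of the integrand alone is enough: Cauchy's inequality on circles of radius r
  turns it into the dominating function \<open>w x / r\<close> for the difference quotients.\<close>

lemma holomorphic_on_integral:
  fixes f :: "'a \<Rightarrow> complex \<Rightarrow> complex"
  assumes holo: "\<And>x. x \<in> space M \<Longrightarrow> f x holomorphic_on ball 0 d"
    and meas: "\<And>t. t \<in> ball 0 d \<Longrightarrow> (\<lambda>x. f x t) \<in> borel_measurable M"
    and w: "integrable M w" and le: "\<And>x t. x \<in> space M \<Longrightarrow> t \<in> ball 0 d \<Longrightarrow> norm (f x t) \<le> w x"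
  shows "(\<lambda>t. LINT x|M. f x t) holomorphic_on ball 0 d"
proof -
  have int: "integrable M (\<lambda>x. f x t)" if "t \<in> ball 0 d" for t
    by (rule Bochner_Integration.integrable_bound[OF w meas[OF that]])
      (use le that in \<open>auto intro!: AE_I2 order_trans[OF le]\<close>)
  have "\<exists>D. ((\<lambda>t. LINT x|M. f x t) has_field_derivative D) (at t0)" if t0: "t0 \<in> ball 0 d" for t0
  proof -
    obtain e where e: "0 < e" "cball t0 e \<subseteq> ball 0 d" using t0 by (metis open_ball open_contains_cball)
    define r where "r = e / 2"
    have r: "0 < r" using e by (simp add: r_def)
    have sub: "cball t r \<subseteq> ball 0 d" if "t \<in> ball t0 r" for t
    proof -
      have "cball t r \<subseteq> cball t0 e"
        using that by (intro subsetI) (auto simp: r_def intro: order_trans[OF dist_triangle[of t0 _ t]])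
      then show ?thesis using e by blast
    qed
    have inb: "t \<in> ball 0 d" if "t \<in> ball t0 r" for t using sub[OF that] r by force
    have der: "(f x has_field_derivative deriv (f x) t) (at t)" if "x \<in> space M" "t \<in> ball t0 r" for x t
      using holomorphic_derivI[OF holo[OF that(1)] open_ball inb[OF that(2)]] .
    have dbd: "norm (deriv (f x) t) \<le> w x / r" if x: "x \<in> space M" and t: "t \<in> ball t0 r" for x t
    proof -
      have h: "f x holomorphic_on cball t r" using holo[OF x] sub[OF t] by (rule holomorphic_on_subset)
      have "norm ((deriv ^^ 1) (f x) t) \<le> fact 1 * w x / r ^ 1"
      proof (rule Cauchy_inequality)
        show "f x holomorphic_on ball t r" using h by (rule holomorphic_on_subset) auto
        show "continuous_on (cball t r) (f x)" using h by (rule holomorphic_on_imp_continuous_on)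
        show "norm (f x y) \<le> w x" if "norm (t - y) = r" for y
          using sub[OF t] that by (intro le[OF x]) (auto simp: dist_norm subset_eq)
      qed (rule r)
      then show ?thesis by simp
    qed
    define Q where "Q t x = (f x t - f x t0) / (t - t0)" for t x
    have Qbd: "norm (Q t x) \<le> w x / r" if x: "x \<in> space M" and t: "t \<in> ball t0 r - {t0}" for x t
    proof -
      have "norm (f x t - f x t0) \<le> w x / r * norm (t - t0)"
        by (rule field_differentiable_bound[of "ball t0 r" "f x" "deriv (f x)"])
          (use der[OF x] dbd[OF x] t r in \<open>auto intro: has_field_derivative_at_within\<close>)
      then show ?thesis using t by (simp add: Q_def norm_divide divide_le_eq)
    qed
    have Qlim: "(\<lambda>i. Q (X i) x) \<longlonglongrightarrow> deriv (f x) t0"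
      if "\<And>i. X i \<in> ball t0 r - {t0}" "X \<longlonglongrightarrow> t0" "x \<in> space M" for X x
    proof -
      have "((\<lambda>y. Q y x) \<longlongrightarrow> deriv (f x) t0) (at t0 within ball t0 r)"
        using has_field_derivative_at_within[OF der[OF that(3)], of t0 "ball t0 r"] r
        by (simp add: has_field_derivative_iff Q_def)
      then have "((\<lambda>y. Q y x) \<circ> X) \<longlonglongrightarrow> deriv (f x) t0"
        using that(1,2) unfolding tendsto_at_iff_sequentially by blast
      then show ?thesis by (simp add: o_def)
    qed
    have Qm: "(\<lambda>x. Q t x) \<in> borel_measurable M" if "t \<in> ball t0 r" for t
      unfolding Q_def using meas[OF inb[OF that]] meas[OF t0] by (intro borel_measurable_divide borel_measurable_diff borel_measurable_const)
    have Dm: "(\<lambda>x. deriv (f x) t0) \<in> borel_measurable M"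
    proof -
      \<comment> \<open>The derivative is measurable as a limit of difference quotients along this
        sequence; the index shift by two keeps every step strictly between 0 and r.\<close>
      define X where "X i = t0 + complex_of_real (r * inverse (real (Suc (Suc i))))" for i
      have "X \<longlonglongrightarrow> t0 + complex_of_real (r * 0)"
        unfolding X_def by (intro tendsto_intros LIMSEQ_Suc[OF LIMSEQ_inverse_real_of_nat])
      then have X: "X \<longlonglongrightarrow> t0" by simp
      have Xi: "X i \<in> ball t0 r - {t0}" for i
      proof -
        define c where "c = r * inverse (real (Suc (Suc i)))"
        have "0 < c" using r by (simp add: c_def)
        moreover have "c < r * 1"
          unfolding c_def using r by (intro mult_strict_left_mono) (auto simp: inverse_less_1_iff)
        moreover have "X i = t0 + complex_of_real c" by (simp only: X_def c_def)
        ultimately show ?thesis by (auto simp: dist_norm)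
      qed
      show ?thesis
        by (rule borel_measurable_LIMSEQ_metric[of "\<lambda>i. Q (X i)"]) (use Qm Xi Qlim[OF Xi X] in auto)
    qed
    have "((\<lambda>y. ((LINT x|M. f x y) - (LINT x|M. f x t0)) / (y - t0)) \<longlongrightarrow> (LINT x|M. deriv (f x) t0)) (at t0 within ball t0 r)"
      unfolding tendsto_at_iff_sequentially
    proof (intro allI impI)
      fix X assume X: "\<forall>i. X i \<in> ball t0 r - {t0}" "X \<longlonglongrightarrow> t0"
      have "(\<lambda>i. LINT x|M. Q (X i) x) \<longlonglongrightarrow> (LINT x|M. deriv (f x) t0)"
        by (rule integral_dominated_convergence[where w = "\<lambda>x. w x / r"])
          (use X Qm Dm Qlim[of X] Qbd w in \<open>auto intro!: AE_I2\<close>)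
      moreover have "(LINT x|M. Q (X i) x) = ((LINT x|M. f x (X i)) - (LINT x|M. f x t0)) / (X i - t0)" for i
        using int[OF inb] int[OF t0] X(1) unfolding Q_def by (subst integral_divide_zero) auto
      ultimately show "((\<lambda>y. ((LINT x|M. f x y) - (LINT x|M. f x t0)) / (y - t0)) \<circ> X) \<longlonglongrightarrow> (LINT x|M. deriv (f x) t0)"
        by (simp add: o_def)
    qed
    then have "((\<lambda>t. LINT x|M. f x t) has_field_derivative (LINT x|M. deriv (f x) t0)) (at t0 within ball t0 r)"
      by (simp add: has_field_derivative_iff)
    then show ?thesis using r by (auto simp: at_within_open[OF centre_in_ball[THEN iffD2]])
  qed
  then show ?thesis by (auto simp: holomorphic_on_open)
qed

context compact_density
begin

lemma lag_force_nth_le: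
  assumes V: "lip_on B V" "closed B" "cball 0 R \<subseteq> B" "a \<in> B"
  shows "norm (lag_force \<rho> V a $ i) \<le> 3 * CI"
  using Finite_Cartesian_Product.norm_nth_le[of "lag_force \<rho> V a" i] norm_lag_force_le[OF V] by linarith

text \<open>\<open>lag_force_diff_le\<close> is applied with \<open>e = 1 / n\<close>, since
  (x^n)^(1 - 1/n) = x^(n - 1). The price n is paid back by the integral of
  \<open>n * \<theta> ^ (n - 1)\<close>, which is 1, so that no factorial accumulates over the
  iteration; only one power of \<tau> is lost.\<close>

lemma integral_lag_force_diff:
  fixes VA VB :: "real \<Rightarrow> space \<Rightarrow> cspace"
  assumes lA: "\<And>\<theta>. \<theta> \<in> {0..1} \<Longrightarrow> lip_on B (VA \<theta>)" and lB: "\<And>\<theta>. \<theta> \<in> {0..1} \<Longrightarrow> lip_on B (VB \<theta>)"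
    and B: "closed B" "cball 0 R \<subseteq> B" "a \<in> B" and \<tau>: "0 \<le> \<tau>"
    and df: "\<And>\<theta> b. \<theta> \<in> {0..1} \<Longrightarrow> b \<in> B \<Longrightarrow> norm (VA \<theta> b - VB \<theta> b) \<le> (\<theta> * \<tau>) ^ n"
    and cA: "continuous_on {0..1} (\<lambda>\<theta>. lag_force \<rho> (VA \<theta>) a $ i)"
    and cB: "continuous_on {0..1} (\<lambda>\<theta>. lag_force \<rho> (VB \<theta>) a $ i)"
  shows "norm (integral {0..1} (\<lambda>\<theta>. complex_of_real (1 - \<theta>) * lag_force \<rho> (VA \<theta>) a $ i)
      - integral {0..1} (\<lambda>\<theta>. complex_of_real (1 - \<theta>) * lag_force \<rho> (VB \<theta>) a $ i)) \<le> 6 * CI * \<tau> ^ (n - 1)"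
proof -
  \<comment> \<open>For \<open>n = 0\<close> the choice is \<open>e = 1\<close>, with
    \<open>s powr 0 = 1\<close>; the truncated \<open>n - 1 = 0\<close> is then the right
    exponent.\<close>
  define b where "b \<theta> = 6 * CI * (if n = 0 then 1 else real n * \<theta> ^ (n - 1) * \<tau> ^ (n - 1))" for \<theta> :: real
  have b: "(b has_integral 6 * CI * \<tau> ^ (n - 1)) {0..1}"
  proof (cases "n = 0")
    case True
    then show ?thesis using has_integral_const_real[of "6 * CI" 0 1] by (simp add: b_def[abs_def])
  next
    case False
    have "((\<lambda>\<theta>. real n * \<theta> ^ (n - 1)) has_integral (1 ^ n - 0 ^ n)) {0..1::real}"
      by (rule fundamental_theorem_of_calculus)
        (auto intro!: derivative_eq_intros simp flip: has_real_derivative_iff_has_vector_derivative)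
    then have "((\<lambda>\<theta>. real n * \<theta> ^ (n - 1)) has_integral 1) {0..1::real}" using False by (simp add: power_0_left)
    from has_integral_mult_right[OF this, of "6 * CI * \<tau> ^ (n - 1)"] False
    show ?thesis by (simp add: b_def[abs_def] mult.assoc mult.commute mult.left_commute)
  qed
  have pt: "norm (lag_force \<rho> (VA \<theta>) a $ i - lag_force \<rho> (VB \<theta>) a $ i) \<le> b \<theta>" if \<theta>: "\<theta> \<in> {0..1}" for \<theta>
  proof -
    have "norm (lag_force \<rho> (VA \<theta>) a $ i - lag_force \<rho> (VB \<theta>) a $ i) \<le> norm (lag_force \<rho> (VA \<theta>) a - lag_force \<rho> (VB \<theta>) a)"
      using Finite_Cartesian_Product.norm_nth_le[of "lag_force \<rho> (VA \<theta>) a - lag_force \<rho> (VB \<theta>) a" i] by simp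
    also have "\<dots> \<le> b \<theta>"
    proof (cases "n = 0")
      case True
      then show ?thesis
        using lag_force_diff_le[OF lA[OF \<theta>] lB[OF \<theta>] B df[OF \<theta>], of 1] by (simp add: b_def)
    next
      case False
      define x where "x = \<theta> * \<tau>"
      have x: "0 \<le> x" using \<theta> \<tau> by (simp add: x_def)
      have e: "0 < 1 / real n" "1 / real n \<le> 1" using False by auto
      have "(x ^ n) powr (1 - 1 / real n) \<le> x ^ (n - 1)"
      proof (cases "x = 0")
        case True
        then show ?thesis using False by (simp add: zero_power)
      next
        case False2: False
        then have "(x ^ n) powr (1 - 1 / real n) = x powr (real n * (1 - 1 / real n))"
          using x by (simp add: powr_realpow[symmetric] powr_powr)
        also have "real n * (1 - 1 / real n) = real (n - 1)" using False by (simp add: field_simps of_nat_diff)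
        also have "x powr real (n - 1) = x ^ (n - 1)" using x False2 by (simp add: powr_realpow)
        finally show ?thesis by simp
      qed
      then have "6 * CI / (1 / real n) * (x ^ n) powr (1 - 1 / real n) \<le> 6 * CI / (1 / real n) * x ^ (n - 1)"
        using CI_nonneg by (intro mult_left_mono) auto
      also have "\<dots> = b \<theta>" using False by (simp add: b_def x_def power_mult_distrib)
      finally show ?thesis
        using lag_force_diff_le[OF lA[OF \<theta>] lB[OF \<theta>] B df[OF \<theta>] e] unfolding x_def by linarith
    qed
    finally show ?thesis .
  qed
  let ?h = "\<lambda>\<theta>. complex_of_real (1 - \<theta>) * (lag_force \<rho> (VA \<theta>) a $ i - lag_force \<rho> (VB \<theta>) a $ i)"
  have I: "(\<lambda>\<theta>. complex_of_real (1 - \<theta>) * lag_force \<rho> (VA \<theta>) a $ i) integrable_on {0..1}"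
    "(\<lambda>\<theta>. complex_of_real (1 - \<theta>) * lag_force \<rho> (VB \<theta>) a $ i) integrable_on {0..1}"
    by (intro integrable_continuous_interval continuous_intros cA cB)+
  have "integral {0..1} (\<lambda>\<theta>. complex_of_real (1 - \<theta>) * lag_force \<rho> (VA \<theta>) a $ i)
      - integral {0..1} (\<lambda>\<theta>. complex_of_real (1 - \<theta>) * lag_force \<rho> (VB \<theta>) a $ i) = integral {0..1} ?h"
    using Henstock_Kurzweil_Integration.integral_diff[OF I] by (simp add: algebra_simps)
  also have "norm \<dots> \<le> integral {0..1} b"
  proof (rule Henstock_Kurzweil_Integration.integral_norm_bound_integral)
    show "?h integrable_on {0..1}" by (intro integrable_continuous_interval continuous_intros cA cB)
    show "b integrable_on {0..1}" using b by blast
    fix \<theta> :: real assume \<theta>: "\<theta> \<in> {0..1}"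
    have "norm (?h \<theta>) \<le> 1 * norm (lag_force \<rho> (VA \<theta>) a $ i - lag_force \<rho> (VB \<theta>) a $ i)"
      unfolding norm_mult norm_of_real using \<theta> by (intro mult_right_mono) auto
    then show "norm (?h \<theta>) \<le> b \<theta>" using pt[OF \<theta>] by linarith
  qed
  also have "integral {0..1} b = 6 * CI * \<tau> ^ (n - 1)" using b by (rule integral_unique)
  finally show ?thesis .
qed

end

text \<open>\<open>small\<close> makes the bounds on an iterate and on its first and second
  differences reproduce themselves: the 3 comes from \<open>norm_cspace_le\<close>, the
  \<open>12 * CI\<close> from the second differences, the most expensive of the three.
  \<open>d \<le> 1\<close> lets |t|^2 be replaced by d, and \<open>u0_d2\<close> covers the
  exponents taken by \<open>gg\<close>.\<close>

locale picard = compact_density \<rho> R M for \<rho> R M +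
  fixes u0 :: "space \<Rightarrow> space" and q N d :: real
  assumes d: "0 < d" "d \<le> 1" and q: "\<bar>q\<bar> \<le> 1" and N: "0 \<le> N"
    and u0_bd: "\<And>a. norm (u0 a) \<le> N"
    and u0_d1: "\<And>a h. norm (u0 (a + h) - u0 a) \<le> N * norm h"
    and u0_d2: "\<And>a h k g. \<lbrakk>1/2 \<le> g; g \<le> 1\<rbrakk> \<Longrightarrow>
      norm (u0 (a + h + k) - u0 (a + h) - u0 (a + k) + u0 a) \<le> N * (norm h * norm k powr g)"
    and small: "3 * (d * N + 12 * d * CI) \<le> 1/8"
begin

text \<open>Taylor's formula with integral remainder for the second-order equation, with the time s
  = \<theta> t running along the segment from 0 to t. It needs no velocity iterate and makes sense
  for complex t.\<close>

primrec P :: "nat \<Rightarrow> complex \<Rightarrow> space \<Rightarrow> cspace" where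
  "P 0 t a = 0"
| "P (Suc n) t a = (\<chi> i. t * cvec (u0 a) $ i + of_real q * t\<^sup>2 *
     integral {0..1} (\<lambda>\<theta>. complex_of_real (1 - \<theta>) * lag_force \<rho> (P n (of_real \<theta> * t)) a $ i))"

text \<open>The Hoelder exponent of the displacement gradient shrinks linearly with \<open>|t|\<close>;
  the loss between \<open>\<theta> t\<close> and \<open>t\<close> is compensated by the weight \<open>1 - \<theta>\<close>.\<close>

definition gg :: "complex \<Rightarrow> real" where
  "gg t = 1 - norm t / (2 * d)"

section \<open>Uniform bounds and holomorphy of all iterates\<close>

lemma gg:
  assumes "t \<in> ball 0 d"
  shows "1/2 \<le> gg t" "gg t \<le> 1" "0 < gg t"
proof -
  have "norm t / (2 * d) \<le> 1/2" using assms d by (simp add: field_simps)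
  then show "1/2 \<le> gg t" "0 < gg t" by (simp_all add: gg_def)
qed (use d in \<open>simp add: gg_def\<close>)

lemma theta_ball: "\<theta> \<in> {0..1} \<Longrightarrow> t \<in> ball 0 e \<Longrightarrow> of_real \<theta> * t \<in> ball (0::complex) e"
  by (simp add: norm_mult) (meson abs_ge_zero le_less_trans mult_left_le_one_le norm_ge_zero abs_le_iff abs_of_nonneg)

definition inv :: "nat \<Rightarrow> bool" where
  "inv n \<longleftrightarrow> (\<forall>t\<in>ball 0 d. adm (gg t) (P n t)) \<and> (\<forall>a i. (\<lambda>t. P n t a $ i) holomorphic_on ball 0 d)"

context
  fixes n
  assumes inv: "inv n"
begin

lemma adm_P: "t \<in> ball 0 d \<Longrightarrow> adm (gg t) (P n t)"
  and holo_P: "(\<lambda>t. P n t a $ i) holomorphic_on ball 0 d"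
  using inv by (auto simp: inv_def)

lemma lip_P: "t \<in> ball 0 d \<Longrightarrow> lip_on UNIV (P n t)"
  using adm_P by (simp add: adm_def)

text \<open>For fixed z the integrand is holomorphic in t, because \<open>cdot\<close> of the
  argument stays in the right half plane where \<open>csqrt\<close> is holomorphic; the weight
  \<open>wt 1\<close> dominates it uniformly in t.\<close>

lemma holo_lag_force: "(\<lambda>t. lag_force \<rho> (P n t) a $ i) holomorphic_on ball 0 d"
proof -
  have 1: "(\<lambda>t. G \<rho> (P n t) a i z) holomorphic_on ball 0 d" for z
  proof (cases "z = 0")
    case True
    then show ?thesis by (simp add: G_def)
  next
    case False
    have hZ: "(\<lambda>t. Zd (P n t) a z $ j) holomorphic_on ball 0 d" for j
      unfolding Zd_def by (auto intro!: holomorphic_intros holo_P)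
    have hD: "(\<lambda>t. cdot (Zd (P n t) a z) (Zd (P n t) a z)) holomorphic_on ball 0 d"
      unfolding cdot_def by (intro holomorphic_intros hZ)
    have re: "0 < Re (cdot (Zd (P n t) a z) (Zd (P n t) a z))" if "t \<in> ball 0 d" for t
    proof -
      have "0 < (norm z)\<^sup>2 / 2" using False by simp
      also have "\<dots> \<le> Re (cdot (Zd (P n t) a z) (Zd (P n t) a z))"
        by (rule cdot_near(1)[OF Zd_near[OF lip_P[OF that] UNIV_I UNIV_I]])
      finally show ?thesis .
    qed
    have nz: "cdot (Zd (P n t) a z) (Zd (P n t) a z) \<noteq> 0" if "t \<in> ball 0 d" for t using re[OF that] by force
    have hS: "(\<lambda>t. csqrt (cdot (Zd (P n t) a z) (Zd (P n t) a z))) holomorphic_on ball 0 d"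
      using holomorphic_on_compose_gen[OF hD holomorphic_on_csqrt] re
      by (force simp: o_def complex_nonpos_Reals_iff)
    show ?thesis
      unfolding G_def Kc_def vec_lambda_beta
      by (intro holomorphic_intros hZ hS hD) (use nz in auto)
  qed
  let ?w = "\<lambda>z. 4 * M * CK * (indicator (cball (-a) R) z * wt 1 z)"
  have le: "norm (G \<rho> (P n t) a i z) \<le> ?w z" if "t \<in> ball 0 d" for t z
  proof (cases "z = 0 \<or> \<rho> (a + z) = 0")
    case True
    then show ?thesis using M_nonneg by (auto simp: G_def CK_def)
  next
    case False
    then have "z \<in> cball (-a) R" using supp[of "a + z"] by (simp add: dist_norm norm_minus_commute add.commute)
    then show ?thesis using norm_G_le_wt[OF lip_P[OF that] _ UNIV_I, of z a i] False by simp
  qed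
  have "(\<lambda>t. LINT z|lborel. G \<rho> (P n t) a i z) holomorphic_on ball 0 d"
  proof (rule holomorphic_on_integral[OF 1 _ _ le])
    show "integrable lborel ?w" using wt_integral_bound(1)[OF _ _ R, of 1] by (intro integrable_mult_right) auto
    show "(\<lambda>z. G \<rho> (P n t) a i z) \<in> borel_measurable lborel" if "t \<in> ball 0 d" for t
      using G_measurable[OF lip_P[OF that]] by simp
  qed
  then show ?thesis by (simp add: lag_force_def)
qed

lemma cont_lag_force: "t \<in> ball 0 d \<Longrightarrow> continuous_on {0..1} (\<lambda>\<theta>. lag_force \<rho> (P n (of_real \<theta> * t)) a $ i)"
  by (rule continuous_on_compose2[OF holomorphic_on_imp_continuous_on[OF holo_lag_force]])
    (use theta_ball in \<open>auto intro!: continuous_intros\<close>)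

definition J :: "complex \<Rightarrow> space \<Rightarrow> 3 \<Rightarrow> complex" where
  "J t a i = integral {0..1} (\<lambda>\<theta>. complex_of_real (1 - \<theta>) * lag_force \<rho> (P n (of_real \<theta> * t)) a $ i)"

lemma J_integrable: "t \<in> ball 0 d \<Longrightarrow> (\<lambda>\<theta>. complex_of_real (1 - \<theta>) * lag_force \<rho> (P n (of_real \<theta> * t)) a $ i) integrable_on {0..1}"
  by (intro integrable_continuous_interval continuous_intros cont_lag_force)

lemma holo_J: "(\<lambda>t. J t a i) holomorphic_on ball 0 d"
proof -
  let ?F = "\<lambda>t. lag_force \<rho> (P n t) a $ i"
  have "(\<lambda>t. integral (cbox 0 1) (\<lambda>\<theta>. complex_of_real (1 - \<theta>) * ?F (of_real \<theta> * t))) holomorphic_on ball 0 d"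
  proof (rule leibniz_rule_holomorphic[where fx = "\<lambda>t \<theta>. complex_of_real (1 - \<theta>) * (deriv ?F (of_real \<theta> * t) * of_real \<theta>)"])
    fix t \<theta> assume t: "t \<in> ball (0::complex) d" "\<theta> \<in> cbox 0 (1::real)"
    then have b: "of_real \<theta> * t \<in> ball 0 d" using theta_ball by auto
    have "((\<lambda>t. ?F (of_real \<theta> * t)) has_field_derivative deriv ?F (of_real \<theta> * t) * of_real \<theta>) (at t within ball 0 d)"
      by (rule DERIV_chain2[where f = ?F and g = "\<lambda>t. of_real \<theta> * t", OF holomorphic_derivI[OF holo_lag_force open_ball b]])
        (auto intro!: derivative_eq_intros)
    then show "((\<lambda>t. complex_of_real (1 - \<theta>) * ?F (of_real \<theta> * t)) has_field_derivative
        complex_of_real (1 - \<theta>) * (deriv ?F (of_real \<theta> * t) * of_real \<theta>)) (at t within ball 0 d)"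
      by (rule DERIV_cmult)
  next
    show "(\<lambda>\<theta>. complex_of_real (1 - \<theta>) * ?F (of_real \<theta> * t)) integrable_on cbox 0 1" if "t \<in> ball 0 d" for t
      using J_integrable[OF that] by simp
  next
    have "continuous_on (ball 0 d \<times> cbox 0 1) (\<lambda>p. deriv ?F (of_real (snd p) * fst p))"
      by (rule continuous_on_compose2[OF holomorphic_on_imp_continuous_on[OF holomorphic_deriv[OF holo_lag_force open_ball]]])
        (use theta_ball in \<open>auto intro!: continuous_intros\<close>)
    then show "continuous_on (ball 0 d \<times> cbox 0 1) (\<lambda>(t, \<theta>). complex_of_real (1 - \<theta>) * (deriv ?F (of_real \<theta> * t) * of_real \<theta>))"
      unfolding case_prod_beta by (intro continuous_intros)
  qed simp
  then show ?thesis by (simp add: J_def)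
qed

lemma P_Suc_nth: "P (Suc n) t a $ i = t * cvec (u0 a) $ i + of_real q * t\<^sup>2 * J t a i"
  by (simp add: J_def)

lemma integral_weight_le:
  fixes f :: "real \<Rightarrow> complex"
  assumes "continuous_on {0..1} f" "\<And>\<theta>. \<theta> \<in> {0..1} \<Longrightarrow> norm (complex_of_real (1 - \<theta>) * f \<theta>) \<le> K"
  shows "norm (integral {0..1} (\<lambda>\<theta>. complex_of_real (1 - \<theta>) * f \<theta>)) \<le> K"
proof -
  have "continuous_on {0..1} (\<lambda>\<theta>. complex_of_real (1 - \<theta>) * f \<theta>)"
    by (intro continuous_intros assms(1))
  from integral_bound[OF _ this, of K] show ?thesis using assms(2) by auto
qed

lemma J_diff:
  assumes t: "t \<in> ball 0 d"
  shows "J t a i - J t b i = integral {0..1} (\<lambda>\<theta>. complex_of_real (1 - \<theta>) *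
      (lag_force \<rho> (P n (of_real \<theta> * t)) a $ i - lag_force \<rho> (P n (of_real \<theta> * t)) b $ i))"
  unfolding J_def right_diff_distrib
  by (rule Henstock_Kurzweil_Integration.integral_diff[OF J_integrable[OF t] J_integrable[OF t], symmetric])

lemma P_Suc_comb:
  fixes t W :: complex and U :: cspace
  assumes t: "t \<in> ball 0 d" and "norm U \<le> A" "norm W \<le> B'" "0 \<le> A" "0 \<le> B'"
  shows "norm (t * U $ i + of_real q * t\<^sup>2 * W) \<le> d * A + d * B'"
proof -
  have "norm (t * U $ i) \<le> d * A"
    unfolding norm_mult using t assms d Finite_Cartesian_Product.norm_nth_le[of U i] by (intro mult_mono) auto
  moreover have "norm (of_real q * t\<^sup>2 * W) \<le> (1 * (d * 1)) * B'"
    unfolding norm_mult norm_power power2_eq_square norm_of_real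
    using t assms q d by (intro mult_mono) auto
  ultimately show ?thesis using norm_triangle_ineq[of "t * U $ i" "of_real q * t\<^sup>2 * W"] by simp
qed

text \<open>Starts the geometric estimate: the distance of \<open>P 1\<close> from
  \<open>P 0 = 0\<close> must be at most \<open>(Dd * norm t) ^ 0\<close>.\<close>

lemma P_Suc_bd:
  assumes t: "t \<in> ball 0 d"
  shows "norm (P (Suc n) t a) \<le> 1"
proof -
  have "norm (J t a i) \<le> 3 * CI" for i
    unfolding J_def
  proof (rule integral_weight_le[OF cont_lag_force[OF t]])
    fix \<theta> :: real assume \<theta>: "\<theta> \<in> {0..1}"
    have "norm (complex_of_real (1 - \<theta>) * lag_force \<rho> (P n (of_real \<theta> * t)) a $ i) \<le> 1 * (3 * CI)"
      unfolding norm_mult norm_of_real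
      using \<theta> lag_force_nth_le[OF lip_P[OF theta_ball[OF \<theta> t]]] by (intro mult_mono) auto
    then show "norm (complex_of_real (1 - \<theta>) * lag_force \<rho> (P n (of_real \<theta> * t)) a $ i) \<le> 3 * CI" by simp
  qed
  then have "norm (P (Suc n) t a $ i) \<le> d * N + d * (3 * CI)" for i
    unfolding P_Suc_nth using u0_bd[of a] CI_nonneg N by (intro P_Suc_comb[OF t]) auto
  then have "norm (P (Suc n) t a) \<le> 3 * (d * N + d * (3 * CI))" by (rule norm_cspace_le)
  also have "\<dots> \<le> 3 * (d * N + 12 * d * CI)" using d CI_nonneg by simp
  finally show ?thesis using small by simp
qed

text \<open>The exponent never drops below 1/2, so \<open>lag_force_d1\<close> costs at most
  \<open>6 * CI\<close>, independently of the iterate.\<close>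

lemma lip_P_Suc:
  assumes t: "t \<in> ball 0 d"
  shows "lip_on UNIV (P (Suc n) t)"
proof -
  have "norm (P (Suc n) t (b + h) - P (Suc n) t b) \<le> norm h / 8" for b h
  proof -
    have "norm (J t (b + h) i - J t b i) \<le> 6 * CI * norm h" for i
      unfolding J_diff[OF t]
    proof (rule integral_weight_le)
      show "continuous_on {0..1} (\<lambda>\<theta>. lag_force \<rho> (P n (of_real \<theta> * t)) (b + h) $ i - lag_force \<rho> (P n (of_real \<theta> * t)) b $ i)"
        by (intro continuous_intros cont_lag_force t)
      fix \<theta> :: real assume \<theta>: "\<theta> \<in> {0..1}"
      note tb = theta_ball[OF \<theta> t]
      have "norm (lag_force \<rho> (P n (of_real \<theta> * t)) (b + h) $ i - lag_force \<rho> (P n (of_real \<theta> * t)) b $ i)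
          \<le> norm (lag_force \<rho> (P n (of_real \<theta> * t)) (b + h) - lag_force \<rho> (P n (of_real \<theta> * t)) b)"
        using Finite_Cartesian_Product.norm_nth_le[of "lag_force \<rho> (P n (of_real \<theta> * t)) (b + h) - lag_force \<rho> (P n (of_real \<theta> * t)) b" i] by simp
      also have "\<dots> \<le> 3 * CI / gg (of_real \<theta> * t) * norm h"
        by (rule lag_force_d1[OF adm_P[OF tb] gg(3,2)[OF tb]])
      also have "\<dots> \<le> 3 * CI / (1/2) * norm h"
        using gg[OF tb] CI_nonneg by (intro mult_right_mono divide_left_mono) auto
      finally have "norm (complex_of_real (1 - \<theta>) * (lag_force \<rho> (P n (of_real \<theta> * t)) (b + h) $ i - lag_force \<rho> (P n (of_real \<theta> * t)) b $ i))
          \<le> 1 * (3 * CI / (1/2) * norm h)"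
        unfolding norm_mult norm_of_real using \<theta> by (intro mult_mono) auto
      then show "norm (complex_of_real (1 - \<theta>) * (lag_force \<rho> (P n (of_real \<theta> * t)) (b + h) $ i - lag_force \<rho> (P n (of_real \<theta> * t)) b $ i)) \<le> 6 * CI * norm h"
        by simp
    qed
    then have "norm (t * cvec (u0 (b + h) - u0 b) $ i + of_real q * t\<^sup>2 * (J t (b + h) i - J t b i)) \<le> d * (N * norm h) + d * (6 * CI * norm h)" for i
      using u0_d1[of b h] CI_nonneg N by (intro P_Suc_comb[OF t]) auto
    moreover have "(P (Suc n) t (b + h) - P (Suc n) t b) $ i = t * cvec (u0 (b + h) - u0 b) $ i + of_real q * t\<^sup>2 * (J t (b + h) i - J t b i)" for i
      by (simp add: P_Suc_nth cvec_diff algebra_simps del: P.simps)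
    ultimately have "norm ((P (Suc n) t (b + h) - P (Suc n) t b) $ i) \<le> d * (N * norm h) + d * (6 * CI * norm h)" for i
      by (simp only:)
    then have "norm (P (Suc n) t (b + h) - P (Suc n) t b) \<le> 3 * (d * (N * norm h) + d * (6 * CI * norm h))"
      by (rule norm_cspace_le)
    also have "\<dots> = 3 * (d * N + 6 * d * CI) * norm h" by (simp add: algebra_simps)
    also have "\<dots> \<le> 3 * (d * N + 12 * d * CI) * norm h" using d CI_nonneg by (intro mult_right_mono) auto
    also have "\<dots> \<le> 1/8 * norm h" using small by (rule mult_right_mono) simp
    finally show ?thesis by simp
  qed
  from this[of "b" "a - b" for a b] show ?thesis by (simp add: lip_on_def)
qed

text \<open>The exponents at \<open>\<theta> * t\<close> and \<open>t\<close> differ by (1 -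
  \<theta>) |t|/(2 d). After the weight has cancelled 1 - \<theta>, the loss is
  \<open>12 * CI * d / norm t\<close>, and the prefactor t^2 absorbs the division by |t|.\<close>

lemma P_Suc_d2:
  assumes t: "t \<in> ball 0 d"
  shows "norm (P (Suc n) t (a + h + k) - P (Suc n) t (a + h) - P (Suc n) t (a + k) + P (Suc n) t a)
    \<le> norm h * norm k powr gg t"
proof (cases "t = 0")
  case True
  then have "P (Suc n) t b = 0" for b by (simp add: vec_eq_iff)
  then show ?thesis by (simp del: P.simps)
next
  case False
  define H where "H = norm h * norm k powr gg t"
  have H: "0 \<le> H" by (simp add: H_def)
  let ?c = "12 * CI * d / norm t * H"
  have c0: "0 \<le> ?c" using CI_nonneg H d by auto
  let ?F = "\<lambda>\<theta> b. lag_force \<rho> (P n (of_real \<theta> * t)) b"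
  have J4: "norm ((J t (a + h + k) i - J t (a + h) i) - (J t (a + k) i - J t a i)) \<le> ?c" for i
  proof -
    let ?f = "\<lambda>\<theta>. ?F \<theta> (a + h + k) $ i - ?F \<theta> (a + h) $ i - (?F \<theta> (a + k) $ i - ?F \<theta> a $ i)"
    have "(J t (a + h + k) i - J t (a + h) i) - (J t (a + k) i - J t a i) = integral {0..1} (\<lambda>\<theta>. complex_of_real (1 - \<theta>) * ?f \<theta>)"
      unfolding J_diff[OF t] right_diff_distrib[of "complex_of_real (1 - _)" "?F _ (a + h + k) $ i - ?F _ (a + h) $ i"]
      by (rule Henstock_Kurzweil_Integration.integral_diff[symmetric])
        (intro integrable_continuous_interval continuous_intros cont_lag_force t)+
    also have "norm \<dots> \<le> ?c"
    proof (rule integral_weight_le)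
      show "continuous_on {0..1} ?f" by (intro continuous_intros cont_lag_force t)
      fix \<theta> :: real assume \<theta>: "\<theta> \<in> {0..1}"
      show "norm (complex_of_real (1 - \<theta>) * ?f \<theta>) \<le> ?c"
      proof (cases "\<theta> = 1")
        case True
        then show ?thesis using c0 by simp
      next
        case \<theta>1: False
        note tb = theta_ball[OF \<theta> t]
        have gd: "gg (of_real \<theta> * t) - gg t = (1 - \<theta>) * norm t / (2 * d)"
          using \<theta> d by (simp add: gg_def norm_mult field_simps)
        then have "0 < gg (of_real \<theta> * t) - gg t" using \<theta> \<theta>1 False d by simp
        then have lt: "gg t < gg (of_real \<theta> * t)" by simp
        have "?f \<theta> = (?F \<theta> (a + h + k) - ?F \<theta> (a + h) - ?F \<theta> (a + k) + ?F \<theta> a) $ i" by simp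
        then have "norm (?f \<theta>) \<le> norm (?F \<theta> (a + h + k) - ?F \<theta> (a + h) - ?F \<theta> (a + k) + ?F \<theta> a)"
          using Finite_Cartesian_Product.norm_nth_le by (simp only:)
        also have "\<dots> \<le> 6 * CI / (gg (of_real \<theta> * t) - gg t) * H"
          unfolding H_def by (rule lag_force_d2[OF adm_P[OF tb] gg(3)[OF t] lt gg(2)[OF tb]])
        finally have "norm (complex_of_real (1 - \<theta>) * ?f \<theta>) \<le> (1 - \<theta>) * (6 * CI / (gg (of_real \<theta> * t) - gg t) * H)"
          unfolding norm_mult norm_of_real using \<theta> by (intro mult_mono) auto
        also have "\<dots> = ?c" unfolding gd using \<theta> \<theta>1 d False by (simp add: field_simps)
        finally show ?thesis .
      qed
    qed
    finally show ?thesis .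
  qed
  let ?U = "cvec (u0 (a + h + k) - u0 (a + h) - u0 (a + k) + u0 a)"
  let ?W = "\<lambda>i. (J t (a + h + k) i - J t (a + h) i) - (J t (a + k) i - J t a i)"
  let ?X = "P (Suc n) t (a + h + k) - P (Suc n) t (a + h) - P (Suc n) t (a + k) + P (Suc n) t a"
  have eq: "?X $ i = t * ?U $ i + of_real q * t\<^sup>2 * ?W i" for i
    by (simp add: P_Suc_nth cvec_diff cvec_add algebra_simps del: P.simps)
  have "norm (?X $ i) \<le> d * (N * H) + d * (12 * CI * H)" for i
  proof -
    have "norm (t * ?U $ i) \<le> d * (N * H)"
      unfolding norm_mult H_def
      using t d Finite_Cartesian_Product.norm_nth_le[of ?U i] u0_d2[OF gg(1,2)[OF t], of a h k]
      by (intro mult_mono) auto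
    moreover have "norm (of_real q * t\<^sup>2 * ?W i) \<le> (1 * (norm t)\<^sup>2) * ?c"
      unfolding norm_mult norm_power norm_of_real using q J4 c0 by (intro mult_mono) auto
    moreover have "(1 * (norm t)\<^sup>2) * ?c = norm t * (12 * CI * d * H)" using False by (simp add: power2_eq_square)
    moreover have "norm t * (12 * CI * d * H) \<le> 1 * (12 * CI * d * H)"
      using t d CI_nonneg H by (intro mult_right_mono) auto
    ultimately show ?thesis unfolding eq using norm_triangle_ineq[of "t * ?U $ i" "of_real q * t\<^sup>2 * ?W i"]
      by (simp add: algebra_simps)
  qed
  then have "norm ?X \<le> 3 * (d * (N * H) + d * (12 * CI * H))" by (rule norm_cspace_le)
  also have "\<dots> = 3 * (d * N + 12 * d * CI) * H" by (simp add: algebra_simps)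
  also have "\<dots> \<le> 1/8 * H" using small H by (rule mult_right_mono)
  finally have "norm ?X \<le> H" using H by linarith
  then show ?thesis unfolding H_def .
qed

lemma inv_Suc: "inv (Suc n)"
  unfolding inv_def adm_def
  using lip_P_Suc P_Suc_d2 P_Suc_nth by (auto intro!: holomorphic_intros holo_J simp del: P.simps)

end

lemma inv_all: "inv n"
proof (induction n)
  case 0
  then show ?case by (auto simp: inv_def adm_def lip_on_def)
next
  case (Suc n)
  then show ?case by (rule inv_Suc)
qed

section \<open>Convergence of the iterates to the given solution\<close>

definition Dd :: real where "Dd = 1 + 18 * CI"

text \<open>t^2 supplies two powers of \<tau> against the one lost in
  \<open>integral_lag_force_diff\<close>, a net gain of one; 18 is 3 for the coordinates times 6.
  For \<open>n = 0\<close> nothing was lost, and the surplus \<tau> is dropped by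
  \<open>\<tau> \<le> 1\<close>.\<close>

lemma power_step:
  assumes "0 \<le> \<tau>" "\<tau> \<le> d"
  shows "3 * (\<tau>\<^sup>2 * (6 * CI * (Dd * \<tau>) ^ (n - 1))) \<le> (Dd * \<tau>) ^ Suc n"
proof -
  have D: "1 \<le> Dd" "18 * CI \<le> Dd" using CI_nonneg by (auto simp: Dd_def)
  have c: "18 * CI \<le> Dd ^ Suc k" for k
  proof -
    have "Dd * 1 \<le> Dd * Dd ^ k" using D by (intro mult_left_mono one_le_power) auto
    then show ?thesis using D(2) by (simp only: power_Suc mult_1_right)
  qed
  show ?thesis
  proof (cases n)
    case 0
    have "\<tau> * \<tau> * (18 * CI) \<le> \<tau> * 1 * Dd"
      using assms d D by (intro mult_mono) (auto intro: CI_nonneg)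
    then show ?thesis using 0 by (simp add: power2_eq_square algebra_simps)
  next
    case (Suc m)
    have "3 * (\<tau>\<^sup>2 * (6 * CI * (Dd * \<tau>) ^ m)) = 18 * CI * (\<tau>\<^sup>2 * (Dd * \<tau>) ^ m)" by simp
    also have "\<dots> \<le> Dd ^ Suc 1 * (\<tau>\<^sup>2 * (Dd * \<tau>) ^ m)"
      using assms D by (intro mult_right_mono c) auto
    also have "\<dots> = (Dd * \<tau>) ^ Suc n" using Suc by (simp add: power2_eq_square algebra_simps)
    finally show ?thesis using Suc by simp
  qed
qed

lemma diff_step:
  fixes t :: complex and A B c :: cspace
  assumes t: "t \<in> ball 0 d" and J: "\<And>i. norm (JA i - JB i) \<le> 6 * CI * (Dd * norm t) ^ (n - 1)"
    and A: "\<And>i. A $ i = t * c $ i + of_real q * t\<^sup>2 * JA i" and B: "\<And>i. B $ i = t * c $ i + of_real q * t\<^sup>2 * JB i"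
  shows "norm (A - B :: cspace) \<le> (Dd * norm t) ^ Suc n"
proof -
  have "norm ((A - B) $ i) \<le> 1 * (norm t)\<^sup>2 * (6 * CI * (Dd * norm t) ^ (n - 1))" for i
  proof -
    have "(A - B) $ i = of_real q * t\<^sup>2 * (JA i - JB i)" by (simp add: A B algebra_simps)
    then show ?thesis
      unfolding norm_mult norm_power norm_of_real using q J by (simp only: norm_mult norm_power norm_of_real, intro mult_mono) auto
  qed
  then have "norm (A - B) \<le> 3 * (1 * (norm t)\<^sup>2 * (6 * CI * (Dd * norm t) ^ (n - 1)))" by (rule norm_cspace_le)
  also have "\<dots> \<le> (Dd * norm t) ^ Suc n" using power_step[of "norm t" n] t by (simp add: mult.assoc)
  finally show ?thesis .
qed

lemma P_cauchy:
  assumes t: "t \<in> ball 0 d"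
  shows "norm (P (Suc n) t a - P n t a) \<le> (Dd * norm t) ^ n"
  using t
proof (induction n arbitrary: t a)
  case 0
  then show ?case using P_Suc_bd[OF inv_all, of t 0 a] by (simp del: P.simps(2))
next
  case (Suc n)
  note t = Suc.prems
  have DD: "0 \<le> Dd" using CI_nonneg by (simp add: Dd_def)
  show ?case
  proof (rule diff_step[OF t _ P_Suc_nth[OF inv_all] P_Suc_nth[OF inv_all]])
    fix i
    show "norm (J (Suc n) t a i - J n t a i) \<le> 6 * CI * (Dd * norm t) ^ (n - 1)"
      unfolding J_def[OF inv_all]
    proof (rule integral_lag_force_diff[of UNIV])
      fix \<theta> :: real and b assume \<theta>: "\<theta> \<in> {0..1}"
      \<comment> \<open>The hypothesis at time \<open>\<theta> * t\<close> brings the factor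
        \<theta>^n whose integration cancels the n in the log-Lipschitz bound.\<close>
      show "norm (P (Suc n) (of_real \<theta> * t) b - P n (of_real \<theta> * t) b) \<le> (\<theta> * (Dd * norm t)) ^ n"
        using Suc.IH[OF theta_ball[OF \<theta> t], of b] \<theta> by (simp add: norm_mult algebra_simps del: P.simps)
    qed (use lip_P[OF inv_all theta_ball[OF _ t]] cont_lag_force[OF inv_all t] DD in \<open>auto simp del: P.simps\<close>)
  qed
qed

text \<open>\<open>P (Suc n)\<close> arises from \<open>P n\<close> by the integral operator that
  fixes \<open>V\<close>, so the estimate behind \<open>P_cauchy\<close>, run at real times over
  \<open>B\<close> and started by \<open>norm (V t b) \<le> 1\<close>, gives convergence to
  \<open>V\<close>. At complex times \<open>P_cauchy\<close> gives a holomorphic limit, whose Taylor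
  series represents \<open>V\<close> on the real axis.\<close>

lemma analytic_limit:
  fixes V :: "real \<Rightarrow> space \<Rightarrow> space"
  assumes B: "closed B" "cball 0 R \<subseteq> B" "a \<in> B" and d': "0 < d'" "d' \<le> d"
    and lV: "\<And>t. \<bar>t\<bar> < d' \<Longrightarrow> lip_on B (\<lambda>b. cvec (V t b))"
    and bV: "\<And>t b. \<lbrakk>\<bar>t\<bar> < d'; b \<in> B\<rbrakk> \<Longrightarrow> norm (V t b) \<le> 1"
    and cV: "\<And>t b i. \<lbrakk>\<bar>t\<bar> < d'; b \<in> B\<rbrakk> \<Longrightarrow> continuous_on {0..1} (\<lambda>\<theta>. lag_force \<rho> (\<lambda>b. cvec (V (\<theta> * t) b)) b $ i)"
    and eV: "\<And>t b i. \<lbrakk>\<bar>t\<bar> < d'; b \<in> B\<rbrakk> \<Longrightarrow> cvec (V t b) $ i = of_real t * cvec (u0 b) $ i + of_real q * (of_real t)\<^sup>2 *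
       integral {0..1} (\<lambda>\<theta>. complex_of_real (1 - \<theta>) * lag_force \<rho> (\<lambda>b. cvec (V (\<theta> * t) b)) b $ i)"
  shows "real_analytic_at (\<lambda>t. V t a) 0"
proof -
  have DD: "0 \<le> Dd" "1 \<le> Dd" using CI_nonneg by (auto simp: Dd_def)
  have conv: "norm (P n (of_real t) b - cvec (V t b)) \<le> (Dd * norm (complex_of_real t)) ^ n" if "\<bar>t\<bar> < d'" "b \<in> B" for n t b
    using that
  proof (induction n arbitrary: t b)
    case 0
    then show ?case using bV by simp
  next
    case (Suc n)
    have t: "complex_of_real t \<in> ball 0 d" using Suc.prems d' by simp
    have th: "\<bar>\<theta> * t\<bar> < d'" if "\<theta> \<in> {0..1}" for \<theta>
      using theta_ball[OF that, of "complex_of_real t" d'] Suc.prems by (simp flip: of_real_mult add: norm_of_real del: of_real_mult)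
    show ?case
    proof (rule diff_step[OF t _ P_Suc_nth[OF inv_all] eV[OF Suc.prems]])
      fix i
      show "norm (J n (of_real t) b i - integral {0..1} (\<lambda>\<theta>. complex_of_real (1 - \<theta>) * lag_force \<rho> (\<lambda>b. cvec (V (\<theta> * t) b)) b $ i))
          \<le> 6 * CI * (Dd * norm (complex_of_real t)) ^ (n - 1)"
        unfolding J_def[OF inv_all]
      proof (rule integral_lag_force_diff[of B])
        fix \<theta> :: real and b assume \<theta>: "\<theta> \<in> {0..1}" and b: "b \<in> B"
        show "norm (P n (of_real \<theta> * of_real t) b - cvec (V (\<theta> * t) b)) \<le> (\<theta> * (Dd * norm (complex_of_real t))) ^ n"
          using Suc.IH[OF th[OF \<theta>] b] \<theta> by (simp add: norm_mult abs_mult algebra_simps)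
      next
        show "lip_on B (P n (of_real \<theta> * of_real t))" if "\<theta> \<in> {0..1}" for \<theta>
          using lip_P[OF inv_all theta_ball[OF that t]] by (auto simp: lip_on_def)
      qed (use lV[OF th] cV[OF Suc.prems] cont_lag_force[OF inv_all t] B Suc.prems DD in auto)
    qed
  qed
  \<comment> \<open>On this disc the ratio \<open>Dd * norm t\<close> is at most 1/2, so the
    telescoping series converges uniformly.\<close>
  define r where "r = min d' (1 / (2 * Dd))"
  have r: "0 < r" "r \<le> d'" "r \<le> 1 / (2 * Dd)" using d' DD by (auto simp: r_def)
  have half: "Dd * norm t \<le> 1/2" if "t \<in> ball 0 r" for t :: complex
  proof -
    have "Dd * norm t \<le> Dd * (1 / (2 * Dd))" using that r DD by (intro mult_left_mono) auto
    then show ?thesis using DD by simp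
  qed
  have inb: "t \<in> ball 0 d" if "t \<in> ball 0 r" for t :: complex using that r d' by simp
  have "\<exists>c. \<forall>t. \<bar>t\<bar> < r \<longrightarrow> (\<lambda>n. t ^ n * c n) sums (V t a $ i)" for i
  proof -
    define L where "L t = (\<Sum>n. P (Suc n) t a $ i - P n t a $ i)" for t
    have "uniform_limit (ball 0 r) (\<lambda>n t. \<Sum>k<n. P (Suc k) t a $ i - P k t a $ i) L sequentially"
      unfolding L_def
    proof (rule Weierstrass_m_test)
      fix n and t :: complex assume t: "t \<in> ball 0 r"
      have "norm (P (Suc n) t a $ i - P n t a $ i) \<le> norm (P (Suc n) t a - P n t a)"
        using Finite_Cartesian_Product.norm_nth_le[of "P (Suc n) t a - P n t a" i] by (simp del: P.simps)
      also have "\<dots> \<le> (Dd * norm t) ^ n" by (rule P_cauchy[OF inb[OF t]])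
      also have "\<dots> \<le> (1/2) ^ n" using half[OF t] DD by (intro power_mono) auto
      finally show "norm (P (Suc n) t a $ i - P n t a $ i) \<le> (1/2) ^ n" .
    qed (auto intro: summable_geometric)
    moreover have "(\<Sum>k<n. P (Suc k) t a $ i - P k t a $ i) = P n t a $ i" for n t
      using sum_lessThan_telescope[of "\<lambda>k. P k t a $ i" n] by (simp del: P.simps(2))
    ultimately have ul: "uniform_limit (ball 0 r) (\<lambda>n t. P n t a $ i) L sequentially" by simp
    have hL: "L holomorphic_on ball 0 r"
    proof (rule holomorphic_uniform_sequence[OF open_ball])
      show "(\<lambda>t. P n t a $ i) holomorphic_on ball 0 r" for n
        using holo_P[OF inv_all] by (rule holomorphic_on_subset) (use inb in blast)
      show "\<exists>e>0. cball t e \<subseteq> ball 0 r \<and> uniform_limit (cball t e) (\<lambda>n t. P n t a $ i) L sequentially" if t: "t \<in> ball 0 r" for t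
      proof -
        obtain e where "0 < e" "cball t e \<subseteq> ball 0 r" using t by (metis open_ball open_contains_cball)
        then show ?thesis using uniform_limit_on_subset[OF ul] by blast
      qed
    qed
    have LV: "L (of_real t) = of_real (V t a $ i)" if "\<bar>t\<bar> < r" for t
    proof -
      have t: "complex_of_real t \<in> ball 0 r" using that by simp
      have "(\<lambda>n. P n (of_real t) a $ i) \<longlonglongrightarrow> L (of_real t)"
        by (rule tendsto_uniform_limitI[OF ul t])
      moreover have "(\<lambda>n. P n (of_real t) a $ i) \<longlonglongrightarrow> of_real (V t a $ i)"
      proof (rule LIM_zero_cancel, rule Lim_null_comparison)
        show "\<forall>\<^sub>F n in sequentially. norm (P n (of_real t) a $ i - of_real (V t a $ i)) \<le> (Dd * norm (complex_of_real t)) ^ n"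
        proof (rule always_eventually, rule allI)
          fix n
          have "norm (P n (of_real t) a $ i - of_real (V t a $ i)) \<le> norm (P n (of_real t) a - cvec (V t a))"
            using Finite_Cartesian_Product.norm_nth_le[of "P n (of_real t) a - cvec (V t a)" i] by (simp add: cvec_def)
          also have "\<dots> \<le> (Dd * norm (complex_of_real t)) ^ n" using that r by (intro conv B) auto
          finally show "norm (P n (of_real t) a $ i - of_real (V t a $ i)) \<le> (Dd * norm (complex_of_real t)) ^ n" .
        qed
        show "(\<lambda>n. (Dd * norm (complex_of_real t)) ^ n) \<longlonglongrightarrow> 0"
          using half[OF t] DD by (intro LIMSEQ_power_zero) (auto simp: abs_mult)
      qed
      ultimately show ?thesis by (rule LIMSEQ_unique)
    qed
    \<comment> \<open>\<open>L\<close> is real at real times, so the real parts of its Taylor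
      coefficients already give the series.\<close>
    have "(\<lambda>n. t ^ n * Re ((deriv ^^ n) L 0 / fact n)) sums (V t a $ i)" if "\<bar>t\<bar> < r" for t
    proof -
      have tb: "complex_of_real t \<in> ball 0 r" using that by simp
      have "(\<lambda>n. (deriv ^^ n) L 0 / fact n * (complex_of_real t - 0) ^ n) sums L (complex_of_real t)"
        by (fact holomorphic_power_series[OF hL tb])
      then have "(\<lambda>n. Re ((deriv ^^ n) L 0 / fact n * (of_real t - 0) ^ n)) sums Re (L (of_real t))"
        by (rule sums_Re)
      moreover have "Re (z * (of_real t - 0) ^ n) = t ^ n * Re z" for z n
        by (simp only: diff_zero of_real_power[symmetric]) (simp del: of_real_power)
      ultimately have "(\<lambda>n. t ^ n * Re ((deriv ^^ n) L 0 / fact n)) sums Re (L (of_real t))"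
        by (simp only:)
      then show ?thesis using LV[OF that] by simp
    qed
    then show ?thesis by (intro exI allI impI)
  qed
  then have "\<exists>c. \<forall>i t. \<bar>t\<bar> < r \<longrightarrow> (\<lambda>n. t ^ n * c i n) sums (V t a $ i)"
    by (intro choice allI)
  then obtain c where c: "\<And>i t. \<bar>t\<bar> < r \<Longrightarrow> (\<lambda>n. t ^ n * c i n) sums (V t a $ i)" by blast
  have "(\<lambda>n. (t - 0) ^ n *\<^sub>R (\<chi> i. c i n)) sums V t a" if "\<bar>t - 0\<bar> < r" for t
    unfolding sums_def
  proof (rule vec_tendstoI)
    fix i
    show "(\<lambda>m. (\<Sum>n<m. (t - 0) ^ n *\<^sub>R (\<chi> i. c i n)) $ i) \<longlonglongrightarrow> V t a $ i"
      using c[OF that[unfolded diff_0_right], of i] unfolding sums_def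
      by (simp add: sum_component)
  qed
  then show ?thesis
    unfolding real_analytic_at_def by (intro exI[of _ "\<lambda>n. \<chi> i. c i n"] exI[of _ r] conjI allI impI r(1))
qed

end

section \<open>Smooth test functions\<close>

definition tower :: "(nat \<Rightarrow> real \<Rightarrow> real) \<Rightarrow> bool" where
  "tower F \<longleftrightarrow> (\<forall>n x. (F n has_real_derivative F (Suc n) x) (at x))"

text \<open>\<open>J 0\<close> is the distribution function of a smooth probability density on \<open>[c - L, c + L]\<close>,
  and \<open>J (Suc n)\<close> are the derivatives of that density.\<close>

definition ctower :: "real \<Rightarrow> real \<Rightarrow> (nat \<Rightarrow> real \<Rightarrow> real) \<Rightarrow> bool" where
  "ctower c L J \<longleftrightarrow> tower J \<and> (\<forall>x. 0 \<le> J 0 x \<and> J 0 x \<le> 1) \<and>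
     (\<forall>x<c - L. J 0 x = 0) \<and> (\<forall>x>c + L. J 0 x = 1) \<and>
     (\<forall>n x. x < c - L \<or> c + L < x \<longrightarrow> J (Suc n) x = 0)"

lemma ctower_mono: "ctower c L J \<Longrightarrow> L \<le> L' \<Longrightarrow> ctower c L' J"
  unfolding ctower_def by force

lemma power_le_fact_exp:
  fixes x :: real
  assumes "0 \<le> x"
  shows "x ^ n \<le> fact n * exp x"
proof -
  have "(\<Sum>k\<in>{n}. x ^ k /\<^sub>R fact k) \<le> (\<Sum>k. x ^ k /\<^sub>R fact k)"
    using assms by (intro sum_le_suminf summable_exp_generic) auto
  then have "x ^ n / fact n \<le> exp x" by (simp add: exp_def divide_inverse mult.commute)
  then show ?thesis by (simp add: divide_le_eq mult.commute)
qed

text \<open>The \<open>n\<close>th derivative of \<open>exp (-1 / (1 - x\<^sup>2))\<close> is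
  \<open>p\<^sub>n(x) (1 - x\<^sup>2) ^ (-2n) exp (-1 / (1 - x\<^sup>2))\<close> with polynomials \<open>p\<^sub>n\<close>.\<close>

primrec bump_poly :: "nat \<Rightarrow> real poly" where
  "bump_poly 0 = 1"
| "bump_poly (Suc n) = pderiv (bump_poly n) * [:1, 0, -1:] ^ 2
     + [:0, 4 * real n:] * [:1, 0, -1:] * bump_poly n - [:0, 2:] * bump_poly n"

definition bump :: "nat \<Rightarrow> real \<Rightarrow> real" where
  "bump n x = (if \<bar>x\<bar> < 1 then poly (bump_poly n) x / (1 - x\<^sup>2) ^ (2 * n) * exp (- (1 / (1 - x\<^sup>2))) else 0)"

lemma bump_outside: "1 \<le> \<bar>x\<bar> \<Longrightarrow> bump n x = 0"
  by (simp add: bump_def)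

lemma bump_0_pos: "\<bar>x\<bar> < 1 \<Longrightarrow> 0 < bump 0 x"
  by (simp add: bump_def)

lemma bump_0_nonneg: "0 \<le> bump 0 x"
  by (simp add: bump_def)

text \<open>With u = 1 - x^2, the exponential is at most (2n + 2)! u^(2n + 2). This cancels the
  denominator u^(2n) and leaves two zeros at the end points, enough for a vanishing derivative
  there.\<close>

lemma bump_quadratic_bound: "\<exists>K. \<forall>x. \<bar>bump n x\<bar> \<le> K * (1 - x\<^sup>2)\<^sup>2"
proof -
  have "bounded (poly (bump_poly n) ` {-1..1})"
    by (intro compact_imp_bounded compact_continuous_image continuous_intros) auto
  then obtain K where "\<forall>y\<in>poly (bump_poly n) ` {-1..1}. norm y \<le> K" unfolding bounded_iff by (rule exE)
  then have K: "\<bar>poly (bump_poly n) x\<bar> \<le> K" if "x \<in> {-1..1}" for x using that by simp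
  have K0: "0 \<le> K" using K[of 0] by simp
  have "\<bar>bump n x\<bar> \<le> (K * fact (2 * n + 2)) * (1 - x\<^sup>2)\<^sup>2" for x
  proof (cases "\<bar>x\<bar> < 1")
    case False
    then show ?thesis using K0 by (simp add: bump_def)
  next
    case True
    define u where "u = 1 - x\<^sup>2"
    have u: "0 < u" using True by (simp add: u_def abs_square_less_1)
    have "(1 / u) ^ (2 * n + 2) \<le> fact (2 * n + 2) * exp (1 / u)"
      by (rule power_le_fact_exp) (use u in simp)
    then have "(1 / u) ^ (2 * n + 2) * exp (- (1 / u)) * u\<^sup>2 \<le> fact (2 * n + 2) * exp (1 / u) * exp (- (1 / u)) * u\<^sup>2"
      by (intro mult_right_mono) auto
    moreover have "exp (1 / u) * exp (- (1 / u)) = 1" by (simp flip: exp_add)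
    moreover have "(1 / u) ^ (2 * n + 2) * u\<^sup>2 = 1 / u ^ (2 * n)" using u by (simp add: power_add power_divide power2_eq_square)
    moreover have "fact (2 * n + 2) * exp (1 / u) * exp (- (1 / u)) * u\<^sup>2 = fact (2 * n + 2) * (exp (1 / u) * exp (- (1 / u))) * u\<^sup>2"
      "(1 / u) ^ (2 * n + 2) * exp (- (1 / u)) * u\<^sup>2 = (1 / u) ^ (2 * n + 2) * u\<^sup>2 * exp (- (1 / u))"
      by (simp_all only: ac_simps)
    ultimately have le: "1 / u ^ (2 * n) * exp (- (1 / u)) \<le> fact (2 * n + 2) * u\<^sup>2"
      by (simp only: mult_1_right)
    have "\<bar>bump n x\<bar> = \<bar>poly (bump_poly n) x\<bar> * (1 / u ^ (2 * n) * exp (- (1 / u)))"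
      using True u by (simp add: bump_def u_def[symmetric] abs_mult)
    also have "\<dots> \<le> K * (fact (2 * n + 2) * u\<^sup>2)"
      using True u K0 by (intro mult_mono le K) auto
    finally show ?thesis by (simp add: u_def)
  qed
  then show ?thesis by blast
qed

lemma tower_bump: "tower bump"
  unfolding tower_def
proof (intro allI)
  fix n :: nat and x :: real
  consider "\<bar>x\<bar> < 1" | "1 < \<bar>x\<bar>" | "\<bar>x\<bar> = 1" by linarith
  then show "(bump n has_real_derivative bump (Suc n) x) (at x)"
  proof cases
    case 1
    have u: "1 - x\<^sup>2 \<noteq> 0" using 1 abs_square_less_1[of x] by auto
    define v where "v = 1 - x\<^sup>2"
    have v: "v \<noteq> 0" using u by (simp add: v_def)
    let ?p = "bump_poly n"
    have d: "((\<lambda>x. poly ?p x / (1 - x\<^sup>2) ^ (2 * n) * exp (- (1 / (1 - x\<^sup>2)))) has_real_derivative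
        (poly (pderiv ?p) x * v ^ (2 * n) - poly ?p x * (real (2 * n) * v ^ (2 * n - 1) * (- 2 * x))) / (v ^ (2 * n) * v ^ (2 * n)) * exp (- (1 / v))
        + poly ?p x / v ^ (2 * n) * (exp (- (1 / v)) * (- (2 * x / v\<^sup>2)))) (at x)"
    proof -
      have d0: "((\<lambda>x. (1 - x\<^sup>2) ^ (2 * n)) has_real_derivative real (2 * n) * v ^ (2 * n - 1) * (- 2 * x)) (at x)"
        unfolding v_def by (auto intro!: derivative_eq_intros)
      have d1: "((\<lambda>x. exp (- (1 / (1 - x\<^sup>2)))) has_real_derivative exp (- (1 / v)) * (- (2 * x / v\<^sup>2))) (at x)"
        using u unfolding v_def by (auto intro!: derivative_eq_intros simp: power2_eq_square)
      have vn: "(1 - x\<^sup>2) ^ (2 * n) \<noteq> 0" using u by simp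
      from DERIV_mult[OF DERIV_divide[OF poly_DERIV d0 vn] d1] show ?thesis
        by (simp add: v_def[symmetric] mult.commute)
    qed
    have "(poly (pderiv ?p) x * v ^ (2 * n) - poly ?p x * (real (2 * n) * v ^ (2 * n - 1) * (- 2 * x))) / (v ^ (2 * n) * v ^ (2 * n))
       = (poly (pderiv ?p) x + 4 * n * x * poly ?p x / v) / v ^ (2 * n)"
    \<comment> \<open>For \<open>n = 0\<close> the exponent \<open>2 * n - 1\<close> is truncated,
      but its factor \<open>real (2 * n)\<close> vanishes.\<close>
    proof (cases n)
      case (Suc m)
      then show ?thesis using v by (simp add: field_simps)
    qed (use v in simp)
    moreover have "poly (bump_poly (Suc n)) x = poly (pderiv ?p) x * v\<^sup>2 + 4 * n * x * v * poly ?p x - 2 * x * poly ?p x"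
      by (simp add: v_def power2_eq_square algebra_simps)
    moreover have "v ^ (2 * Suc n) = v\<^sup>2 * v ^ (2 * n)" by (simp add: power2_eq_square)
    ultimately have "(poly (pderiv ?p) x * v ^ (2 * n) - poly ?p x * (real (2 * n) * v ^ (2 * n - 1) * (- 2 * x))) / (v ^ (2 * n) * v ^ (2 * n)) * exp (- (1 / v))
        + poly ?p x / v ^ (2 * n) * (exp (- (1 / v)) * (- (2 * x / v\<^sup>2))) = poly (bump_poly (Suc n)) x / v ^ (2 * Suc n) * exp (- (1 / v))"
      using v by (simp only:) (simp add: field_simps power2_eq_square)
    with d have d': "((\<lambda>x. poly ?p x / (1 - x\<^sup>2) ^ (2 * n) * exp (- (1 / (1 - x\<^sup>2)))) has_real_derivative bump (Suc n) x) (at x)"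
      using 1 by (simp add: bump_def v_def)
    show ?thesis
    proof (rule has_field_derivative_transform_within_open[OF d'])
      show "open {-1<..<1::real}" "x \<in> {-1<..<1}" using 1 by auto
    qed (auto simp: bump_def)
  next
    case 2
    have "((\<lambda>_. 0) has_real_derivative 0) (at x)" by simp
    then have "(bump n has_real_derivative 0) (at x)"
    proof (rule has_field_derivative_transform_within_open)
      show "open {y::real. 1 < \<bar>y\<bar>}" by (intro open_Collect_less continuous_intros)
    qed (use 2 in \<open>auto simp: bump_def\<close>)
    then show ?thesis using 2 by (simp add: bump_outside)
  next
    case 3
    obtain K where K: "\<And>y. \<bar>bump n y\<bar> \<le> K * (1 - y\<^sup>2)\<^sup>2" using bump_quadratic_bound by blast
    have K0: "0 \<le> K" using K[of 0] by simp
    \<comment> \<open>Near a zero x of 1 - y^2 this polynomial is at most 4 |y - x|, so the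
      quadratic bound makes the difference quotient itself of order |y - x|.\<close>
    have q: "norm ((bump n y - bump n x) / (y - x)) \<le> 16 * K * \<bar>y - x\<bar>" if y: "y \<noteq> x" "dist y x < 1" for y
    proof -
      have "1 - y\<^sup>2 = (x - y) * (x + y)" using 3 by (simp add: algebra_simps power2_eq_square abs_if split: if_splits)
      then have "\<bar>1 - y\<^sup>2\<bar> = \<bar>x - y\<bar> * \<bar>x + y\<bar>" by (simp add: abs_mult)
      also have "\<dots> \<le> \<bar>y - x\<bar> * 4" using 3 y by (intro mult_mono) (auto simp: dist_real_def)
      finally have "\<bar>1 - y\<^sup>2\<bar> ^ 2 \<le> (\<bar>y - x\<bar> * 4) ^ 2" by (intro power_mono) auto
      then have "(1 - y\<^sup>2)\<^sup>2 \<le> 16 * \<bar>y - x\<bar>\<^sup>2" by (simp add: power_mult_distrib)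
      then have "K * (1 - y\<^sup>2)\<^sup>2 \<le> K * (16 * \<bar>y - x\<bar>\<^sup>2)" using K0 by (rule mult_left_mono)
      with K[of y] have "\<bar>bump n y\<bar> \<le> 16 * K * \<bar>y - x\<bar> * \<bar>y - x\<bar>" by (simp add: power2_eq_square)
      then show ?thesis using 3 y by (simp add: bump_outside divide_le_eq)
    qed
    have "((\<lambda>y. (bump n y - bump n x) / (y - x)) \<longlongrightarrow> 0) (at x)"
    proof (rule Lim_null_comparison)
      show "\<forall>\<^sub>F y in at x. norm ((bump n y - bump n x) / (y - x)) \<le> 16 * K * \<bar>y - x\<bar>"
        unfolding eventually_at using q by (intro exI[of _ 1]) auto
      show "((\<lambda>y. 16 * K * \<bar>y - x\<bar>) \<longlongrightarrow> 0) (at x)"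
        by (auto intro!: tendsto_eq_intros)
    qed
    then show ?thesis using 3 by (simp add: has_field_derivative_iff bump_outside)
  qed
qed

lemma tower_D: "tower F \<Longrightarrow> (F n has_real_derivative F (Suc n) x) (at x)"
  by (simp add: tower_def)

lemma tower_cont: "tower F \<Longrightarrow> continuous_on S (F n)"
  by (meson DERIV_continuous_on has_field_derivative_at_within tower_D)

lemma real_antiderivative:
  fixes f :: "real \<Rightarrow> real"
  assumes "continuous_on UNIV f"
  obtains Q where "\<And>x. (Q has_real_derivative f x) (at x)"
proof -
  have "\<exists>F. \<forall>x. - \<infinity> < ereal x \<longrightarrow> ereal x < \<infinity> \<longrightarrow> (F has_vector_derivative f x) (at x)"
    by (rule einterval_antiderivative) (use assms in \<open>auto simp: continuous_on_eq_continuous_at\<close>)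
  then show ?thesis using that by (auto simp: has_real_derivative_iff_has_vector_derivative)
qed

text \<open>The normalised antiderivative of the bump, followed by the derivatives of the bump. The
  density \<open>J 1\<close> is positive on the open interval, which later gives the rescaled bumps
  positive mass.\<close>

lemma ctower_exists:
  obtains J where "ctower 0 1 J" "\<And>x. \<bar>x\<bar> < 1 \<Longrightarrow> 0 < J 1 x"
proof -
  obtain Q where Q: "\<And>x. (Q has_real_derivative bump 0 x) (at x)"
    using real_antiderivative[OF tower_cont[OF tower_bump]] by blast
  have mono: "Q x \<le> Q y" if "x \<le> y" for x y
    using that by (rule DERIV_nonneg_imp_nondecreasing) (use Q bump_0_nonneg in blast)
  define m where "m = Q 1 - Q (-1)"
  obtain z where z: "-1 < z" "z < 1" "Q 1 - Q (-1) = (1 - (-1)) * bump 0 z"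
    using MVT2[of "-1" 1 Q "bump 0"] Q by auto
  have m: "0 < m" using z bump_0_pos[of z] by (simp add: m_def)
  have left: "Q x = Q (-1)" if "x < -1" for x
  proof -
    obtain z where "x < z" "z < -1" "Q (-1) - Q x = (-1 - x) * bump 0 z"
      using MVT2[of x "-1" Q "bump 0"] Q \<open>x < -1\<close> by auto
    then show ?thesis using bump_outside[of z] by simp
  qed
  have right: "Q x = Q 1" if "1 < x" for x
  proof -
    obtain z where "1 < z" "z < x" "Q x - Q 1 = (x - 1) * bump 0 z"
      using MVT2[of 1 x Q "bump 0"] Q \<open>1 < x\<close> by auto
    then show ?thesis using bump_outside[of z] by simp
  qed
  define J where "J n x = (case n of 0 \<Rightarrow> (Q x - Q (-1)) / m | Suc k \<Rightarrow> bump k x / m)" for n x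
  have "tower J"
    unfolding tower_def
  proof (intro allI)
    fix n x
    show "(J n has_real_derivative J (Suc n) x) (at x)"
      unfolding J_def[abs_def]
      using m by (cases n) (auto intro!: derivative_eq_intros Q tower_D[OF tower_bump])
  qed
  moreover have "0 \<le> J 0 x \<and> J 0 x \<le> 1" for x
  proof -
    have "Q (-1) \<le> Q x" using mono[of "-1" x] left[of x] by linarith
    moreover have "Q x \<le> Q 1" using mono[of x 1] right[of x] by linarith
    ultimately have "Q (-1) \<le> Q x" "Q x \<le> Q 1" .
    then show ?thesis using m by (simp add: J_def m_def)
  qed
  ultimately have "ctower 0 1 J"
    using left right m by (auto simp: ctower_def J_def m_def bump_outside)
  moreover have "0 < J 1 x" if "\<bar>x\<bar> < 1" for x using bump_0_pos[OF that] m by (simp add: J_def)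
  ultimately show ?thesis by (rule that)
qed

lemma ctower_affine:
  assumes "ctower 0 1 J" "0 < e"
  shows "ctower c e (\<lambda>n x. J n ((x - c) / e) / e ^ n)"
proof -
  have "tower (\<lambda>n x. J n ((x - c) / e) / e ^ n)"
    unfolding tower_def
  proof (intro allI)
    fix n x
    have "((\<lambda>x. J n ((x - c) / e)) has_real_derivative J (Suc n) ((x - c) / e) * (1 / e)) (at x)"
      by (rule DERIV_chain2[where f = "J n"]) (use assms in \<open>auto simp: ctower_def intro!: tower_D derivative_eq_intros\<close>)
    from DERIV_cdivide[OF this, of "e ^ n"]
    show "((\<lambda>x. J n ((x - c) / e) / e ^ n) has_real_derivative J (Suc n) ((x - c) / e) / e ^ Suc n) (at x)"
      by (simp add: mult.commute)
  qed
  moreover have "(x - c) / e < -1" if "x < c - e" for x using that assms by (simp add: field_simps)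
  moreover have "1 < (x - c) / e" if "c + e < x" for x using that assms by (simp add: field_simps)
  ultimately show ?thesis using assms(1) by (auto simp: ctower_def)
qed

text \<open>Averaging a density over \<open>[x - s, x]\<close> turns its derivative into a difference quotient.\<close>

lemma ctower_average:
  assumes J: "ctower c L J" and s: "s \<noteq> 0"
  obtains K where "ctower c (L + \<bar>s\<bar>) K" "\<And>n x. K (Suc n) x = (J n x - J n (x - s)) / s"
proof -
  have tJ: "tower J" using J by (simp add: ctower_def)
  obtain Q where Q: "\<And>x. (Q has_real_derivative J 0 x) (at x)"
    using real_antiderivative[OF tower_cont[OF tJ]] by blast
  define K where "K n x = (case n of 0 \<Rightarrow> (Q x - Q (x - s)) / s | Suc k \<Rightarrow> (J k x - J k (x - s)) / s)" for n x
  have sh: "((\<lambda>x. f (x - s)) has_real_derivative f' (x - s)) (at x)"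
    if "\<And>x. (f has_real_derivative f' x) (at x)" for f f' :: "real \<Rightarrow> real" and x
  proof -
    have "((\<lambda>x. x - s) has_real_derivative 1) (at x)" by (auto intro!: derivative_eq_intros)
    from DERIV_chain2[where f = f and g = "\<lambda>x. x - s", OF that this] show ?thesis by simp
  qed
  have tK: "tower K"
    unfolding tower_def
  proof (intro allI)
    fix n x
    show "(K n has_real_derivative K (Suc n) x) (at x)"
      unfolding K_def[abs_def]
      by (cases n) (auto intro!: DERIV_cdivide DERIV_diff Q sh[OF Q] tower_D[OF tJ] sh[OF tower_D[OF tJ]])
  qed
  \<comment> \<open>The average is a value of \<open>J 0\<close> between x - s and x, so it inherits
    the range and, away from a collar of width |s|, the plateaus 0 and 1.\<close>
  have mv: "\<exists>z. min x (x - s) \<le> z \<and> z \<le> max x (x - s) \<and> K 0 x = J 0 z" for x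
  proof (cases "0 < s")
    case True
    then obtain z where "x - s < z" "z < x" "Q x - Q (x - s) = (x - (x - s)) * J 0 z"
      using MVT2[of "x - s" x Q "J 0"] Q by auto
    then show ?thesis using True by (intro exI[of _ z]) (simp add: K_def)
  next
    case False
    then obtain z where "x < z" "z < x - s" "Q (x - s) - Q x = (x - s - x) * J 0 z"
      using MVT2[of x "x - s" Q "J 0"] Q s by auto
    then show ?thesis using False s by (intro exI[of _ z]) (simp add: K_def field_simps)
  qed
  have "ctower c (L + \<bar>s\<bar>) K"
    unfolding ctower_def
  proof (intro conjI allI impI tK)
    fix x
    obtain z where z: "min x (x - s) \<le> z" "z \<le> max x (x - s)" "K 0 x = J 0 z" using mv by blast
    show "0 \<le> K 0 x" "K 0 x \<le> 1" using z J by (auto simp: ctower_def)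
    show "K 0 x = 0" if "x < c - (L + \<bar>s\<bar>)"
    proof -
      have "z < c - L" using that z by (auto simp: min_def max_def split: if_splits)
      then show ?thesis using J z by (simp add: ctower_def)
    qed
    show "K 0 x = 1" if "c + (L + \<bar>s\<bar>) < x"
    proof -
      have "c + L < z" using that z by (auto simp: min_def max_def split: if_splits)
      then show ?thesis using J z by (simp add: ctower_def)
    qed
  next
    fix n x
    assume x: "x < c - (L + \<bar>s\<bar>) \<or> c + (L + \<bar>s\<bar>) < x"
    have "J n x = J n (x - s)"
    proof (cases n)
      case 0
      have "x < c - L \<and> x - s < c - L \<or> c + L < x \<and> c + L < x - s" using x by linarith
      then show ?thesis using J 0 by (auto simp: ctower_def)
    next
      case (Suc m)
      have "(x < c - L \<or> c + L < x) \<and> (x - s < c - L \<or> c + L < x - s)" using x by linarith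
      then have "J (Suc m) x = 0" "J (Suc m) (x - s) = 0" using J unfolding ctower_def by blast+
      then show ?thesis using Suc by simp
    qed
    then show "K (Suc n) x = 0" by (simp add: K_def)
  qed
  then show ?thesis using that by (simp add: K_def)
qed

section \<open>Second differences of Sobolev functions\<close>

text \<open>Product test functions, indexed by the order in each coordinate: a partial derivative
  only raises an index, so the family is closed under differentiation.\<close>

definition prodf :: "(3 \<Rightarrow> nat \<Rightarrow> real \<Rightarrow> real) \<Rightarrow> (3 \<Rightarrow> nat) \<Rightarrow> space \<Rightarrow> real" where
  "prodf F n x = (\<Prod>i\<in>UNIV. F i (n i) (x $ i))"

lemma prodf_has_derivative:
  assumes "\<And>i. tower (F i)"
  shows "(prodf F n has_derivative (\<lambda>v. \<Sum>i\<in>UNIV. v $ i * prodf F (n(i := Suc (n i))) x)) (at x)"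
proof -
  have c: "((\<lambda>x. F i (n i) (x $ i)) has_derivative (\<lambda>v. F i (Suc (n i)) (x $ i) * v $ i)) (at x)" for i
    by (rule has_derivative_compose[of "\<lambda>x. x $ i" "\<lambda>v. v $ i", OF bounded_linear_imp_has_derivative[OF bounded_linear_vec_nth]])
      (use tower_D[OF assms] in \<open>simp add: has_field_derivative_def\<close>)
  have "((\<lambda>x. \<Prod>i\<in>UNIV. F i (n i) (x $ i)) has_derivative
      (\<lambda>v. \<Sum>i\<in>UNIV. F i (Suc (n i)) (x $ i) * v $ i * (\<Prod>j\<in>UNIV - {i}. F j (n j) (x $ j)))) (at x)"
    by (rule has_derivative_prod) (rule c)
  moreover have "prodf F (n(i := Suc (n i))) x = F i (Suc (n i)) (x $ i) * (\<Prod>j\<in>UNIV - {i}. F j (n j) (x $ j))" for i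
    unfolding prodf_def by (subst prod.remove[of _ i]) (auto intro!: prod.cong)
  ultimately show ?thesis by (simp add: prodf_def[abs_def] mult.commute mult.left_commute mult.assoc)
qed

lemma frechet_prodf:
  assumes "\<And>i. tower (F i)"
  shows "frechet_derivative (prodf F n) (at x) v = (\<Sum>i\<in>UNIV. v $ i * prodf F (n(i := Suc (n i))) x)"
  by (rule fun_cong[OF frechet_derivative_at[OF prodf_has_derivative[OF assms], symmetric]])

lemma Ck_on_add:
  assumes "Ck_on k UNIV f" "Ck_on k UNIV g"
  shows "Ck_on k UNIV (\<lambda>x. f x + g x)"
  using assms
proof (induction k arbitrary: f g)
  case 0
  then show ?case by (simp add: continuous_on_add)
next
  case (Suc k)
  have D: "((\<lambda>x. f x + g x) has_derivative (\<lambda>v. frechet_derivative f (at x) v + frechet_derivative g (at x) v)) (at x)" for x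
    using Suc.prems by (intro has_derivative_add) (auto simp flip: frechet_derivative_works)
  have "frechet_derivative (\<lambda>x. f x + g x) (at x) v = frechet_derivative f (at x) v + frechet_derivative g (at x) v" for x v
    by (rule fun_cong[OF frechet_derivative_at[OF D, symmetric]])
  then show ?case using Suc by (auto intro!: differentiableI[OF D])
qed

lemma Ck_on_cmult:
  fixes f :: "'a::euclidean_space \<Rightarrow> real"
  assumes "Ck_on k UNIV f"
  shows "Ck_on k UNIV (\<lambda>x. c * f x)"
  using assms
proof (induction k arbitrary: f)
  case 0
  then show ?case by (auto intro!: continuous_intros)
next
  case (Suc k)
  have D: "((\<lambda>x. c * f x) has_derivative (\<lambda>v. c * frechet_derivative f (at x) v)) (at x)" for x
    using Suc.prems by (intro has_derivative_mult_right) (auto simp flip: frechet_derivative_works)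
  have "frechet_derivative (\<lambda>x. c * f x) (at x) v = c * frechet_derivative f (at x) v" for x v
    by (rule fun_cong[OF frechet_derivative_at[OF D, symmetric]])
  then show ?case using Suc by (auto intro!: differentiableI[OF D])
qed

lemma Ck_on_prodf:
  assumes "\<And>i. tower (F i)"
  shows "Ck_on k UNIV (prodf F n)"
proof (induction k arbitrary: n)
  case 0
  show ?case
    unfolding Ck_on.simps
    by (intro continuous_at_imp_continuous_on ballI has_derivative_continuous[OF prodf_has_derivative[OF assms]])
next
  case (Suc k)
  show ?case
    unfolding Ck_on.simps frechet_prodf[OF assms] sum_3
    by (intro conjI ballI allI Ck_on_add Ck_on_cmult Suc differentiableI[OF prodf_has_derivative[OF assms]])
qed

lemma continuous_on_prodf: "(\<And>i. tower (F i)) \<Longrightarrow> continuous_on S (prodf F n)"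
  using Ck_on_prodf[of F 0 n] by (auto intro: continuous_on_subset)

lemma prodf_support:
  assumes "\<And>i n x. \<bar>x - c $ i\<bar> > L \<Longrightarrow> F i n x = 0" "prodf F n x \<noteq> 0"
  shows "x \<in> cball c (3 * L)"
proof -
  have "\<bar>x $ i - c $ i\<bar> \<le> L" for i
  proof (rule ccontr)
    assume "\<not> \<bar>x $ i - c $ i\<bar> \<le> L"
    then have "F i (n i) (x $ i) = 0" by (intro assms(1)) simp
    then show False using assms(2) by (auto simp: prodf_def)
  qed
  then have "(\<Sum>i\<in>UNIV. \<bar>(x - c) $ i\<bar>) \<le> (\<Sum>i\<in>(UNIV::3 set). L)" by (intro sum_mono) simp
  then have "norm (x - c) \<le> 3 * L" using norm_le_l1_cart[of "x - c"] by simp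
  then show ?thesis by (simp add: dist_norm norm_minus_commute)
qed

lemma test_function_prodf:
  assumes "\<And>i. tower (F i)" "\<And>i n x. \<bar>x - c $ i\<bar> > L \<Longrightarrow> F i n x = 0"
  shows "test_function (prodf F n)"
proof -
  have "{x. prodf F n x \<noteq> 0} \<subseteq> cball c (3 * L)"    using prodf_support[of L c F n, OF assms(2)] by (intro subsetI) simp
  then have "closure {x. prodf F n x \<noteq> 0} \<subseteq> cball c (3 * L)" by (intro closure_minimal) auto
  then have "compact (closure {x. prodf F n x \<noteq> 0})"
    by (meson closed_closure bounded_cball bounded_subset compact_eq_bounded_closed)
  then show ?thesis using Ck_on_prodf[OF assms(1)] by (simp add: test_function_def Ck_c_def compactly_supported_def)
qed

text \<open>Only the multiplicities of the directions matter; this translates the lists used for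
  weak derivatives into orders.\<close>

lemma iter_deriv_prodf:
  assumes "\<And>i. tower (F i)"
  shows "iter_deriv (map (\<lambda>i. axis i 1) js) (prodf F (\<lambda>_. 0)) = prodf F (count_list js)"
proof (induction js)
  case Nil
  then show ?case by (simp add: fun_eq_iff prodf_def)
next
  case (Cons j js)
  have "frechet_derivative (prodf F (count_list js)) (at x) (axis j 1) = prodf F (count_list (j # js)) x" for x
  proof -
    have "(count_list js)(j := Suc (count_list js j)) = count_list (j # js)" by (auto simp: fun_eq_iff)
    moreover have "(\<Sum>i\<in>UNIV. axis j 1 $ i * prodf F ((count_list js)(i := Suc (count_list js i))) x)
        = (\<Sum>i\<in>UNIV. if i = j then prodf F ((count_list js)(i := Suc (count_list js i))) x else 0)"
      by (intro sum.cong) (auto simp: axis_def)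
    ultimately show ?thesis unfolding frechet_prodf[OF assms] by simp
  qed
  then show ?case unfolding list.map iter_deriv.simps Cons by (rule ext)
qed

section \<open>Testing a Sobolev function against products of bumps\<close>

definition bump_integral :: "(3 \<Rightarrow> nat \<Rightarrow> real \<Rightarrow> real) \<Rightarrow> (3 \<Rightarrow> nat) \<Rightarrow> (space \<Rightarrow> space) \<Rightarrow> space" where
  "bump_integral J n u = (LINT y|lborel. prodf J n y *\<^sub>R u y)"

lemma integrable_compact_support:
  fixes f :: "space \<Rightarrow> space"
  assumes "continuous_on UNIV f" "\<And>x. f x \<noteq> 0 \<Longrightarrow> x \<in> cball c L"
  shows "integrable lborel f"
proof -
  have "integrable lborel (\<lambda>x. indicator (cball c L) x *\<^sub>R f x)"
    using assms(1) by (intro borel_integrable_compact) (auto intro: continuous_on_subset)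
  moreover have "(\<lambda>x. indicator (cball c L) x *\<^sub>R f x) = f"
    using assms(2) by (auto simp: fun_eq_iff indicator_def)
  ultimately show ?thesis by simp
qed

definition ctowers :: "space \<Rightarrow> real \<Rightarrow> (3 \<Rightarrow> nat \<Rightarrow> real \<Rightarrow> real) \<Rightarrow> bool" where
  "ctowers c L J \<longleftrightarrow> (\<forall>i. ctower (c $ i) L (J i))"

lemma ctowers_tower: "ctowers c L J \<Longrightarrow> tower (J i)"
  by (simp add: ctowers_def ctower_def)

text \<open>The orders must be positive because \<open>J i 0\<close> is a distribution function,
  equal to 1 far to the right; from order 1 on the tower consists of bumps.\<close>

lemma prodf_ctowers_support:
  assumes "ctowers c L J" "\<And>i. 0 < n i" "prodf J n x \<noteq> 0"
  shows "x \<in> cball c (3 * L)"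
proof -
  have "prodf J n x = prodf (\<lambda>i k. J i (Suc k)) (\<lambda>i. n i - 1) x"
    unfolding prodf_def using assms(2) by (intro prod.cong) auto
  then show ?thesis
    using prodf_support[of L c "\<lambda>i k. J i (Suc k)" "\<lambda>i. n i - 1" x] assms(1,3)
    by (fastforce simp: ctowers_def ctower_def abs_if split: if_splits)
qed

lemma bump_integral_integrable:
  fixes u :: "space \<Rightarrow> space"
  assumes J: "ctowers c L J" and n: "\<And>i. 0 < n i" and u: "continuous_on UNIV u"
  shows "integrable lborel (\<lambda>y. prodf J n y *\<^sub>R u y)"
  by (rule integrable_compact_support[of _ c "3 * L"])
    (use prodf_ctowers_support[OF J n] continuous_on_prodf[OF ctowers_tower[OF J]] u in \<open>auto intro!: continuous_intros\<close>)

lemma lborel_integral_translate: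
  fixes f :: "'a::euclidean_space \<Rightarrow> 'b::{banach, second_countable_topology}"
  shows "f \<in> borel_measurable borel \<Longrightarrow> (LINT y|lborel. f (y + h)) = (LINT y|lborel. f y)"
  by (subst lborel_distr_plus[of h, symmetric], subst integral_distr) (auto simp: add.commute)

lemma lborel_integral_scale:
  fixes f :: "space \<Rightarrow> 'b::{banach, second_countable_topology}"
  assumes f: "f \<in> borel_measurable borel" and r: "0 < r"
  shows "(LINT y|lborel. f y) = r ^ 3 *\<^sub>R (LINT z|lborel. f (x + r *\<^sub>R z))"
proof -
  let ?T = "\<lambda>z. x + r *\<^sub>R z"
  have "(LINT y|lborel. f y) = (LINT y|density (distr lborel borel ?T) (\<lambda>_. ennreal (\<bar>r\<bar> ^ DIM(space))). f y)"
    by (rule arg_cong[where f = "\<lambda>M. integral\<^sup>L M f", OF lborel_affine]) (use r in simp)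
  also have "\<dots> = (LINT y|distr lborel borel ?T. \<bar>r\<bar> ^ DIM(space) *\<^sub>R f y)"
    by (rule integral_density) (use f in simp_all)
  also have "\<dots> = (LINT z|lborel. \<bar>r\<bar> ^ DIM(space) *\<^sub>R f (?T z))"
    by (rule integral_distr) (use f in simp_all)
  also have "\<dots> = r ^ 3 *\<^sub>R (LINT z|lborel. f (?T z))"
    using r by simp
  finally show ?thesis .
qed

lemma prodf_shift:
  assumes K: "\<And>n x. K (Suc n) x = (J j n x - J j n (x - s)) / s" and s: "s \<noteq> 0"
  shows "prodf J n (y - axis j s) - prodf J n y = - s * prodf (J(j := K)) (n(j := Suc (n j))) y"
proof -
  have a: "prodf J n (y - axis j s) = J j (n j) (y $ j - s) * (\<Prod>i\<in>UNIV - {j}. J i (n i) (y $ i))"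
    unfolding prodf_def by (subst prod.remove[of _ j]) (auto simp: axis_def intro!: prod.cong)
  have b: "prodf J n y = J j (n j) (y $ j) * (\<Prod>i\<in>UNIV - {j}. J i (n i) (y $ i))"
    unfolding prodf_def by (subst prod.remove[of _ j]) auto
  have c: "prodf (J(j := K)) (n(j := Suc (n j))) y = K (Suc (n j)) (y $ j) * (\<Prod>i\<in>UNIV - {j}. J i (n i) (y $ i))"
    unfolding prodf_def by (subst prod.remove[of _ j]) (auto intro!: prod.cong)
  show ?thesis unfolding a b c K using s by (simp add: algebra_simps diff_divide_distrib)
qed

text \<open>A difference of \<open>u\<close> is moved to the test function by translation, where
  \<open>ctower_average\<close> turns it into a derivative at the price of a slightly wider support.
  \<open>J'\<close> does not depend on \<open>u\<close>, so the step can be repeated for a second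
  difference.\<close>

lemma bump_integral_shift:
  assumes J: "ctowers c L J" and n: "\<And>i. 0 < n i" and s: "s \<noteq> 0" "\<bar>s\<bar> \<le> 1"
  shows "\<exists>J'. ctowers c (L + 1) J' \<and> (\<forall>u. continuous_on UNIV u \<longrightarrow>
    bump_integral J n (\<lambda>y. u (y + axis j s)) - bump_integral J n u = - s *\<^sub>R bump_integral J' (n(j := Suc (n j))) u)"
proof -
  have "ctower (c $ j) L (J j)" using J by (simp add: ctowers_def)
  from ctower_average[OF this s(1)] obtain K where
    K: "ctower (c $ j) (L + \<bar>s\<bar>) K" "\<And>n x. K (Suc n) x = (J j n x - J j n (x - s)) / s" by blast
  define J' where "J' = J(j := K)"
  have J': "ctowers c (L + 1) J'"
    unfolding ctowers_def
  proof
    fix i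
    have "ctower (c $ i) (L + \<bar>s\<bar>) (J' i)"
    proof (cases "i = j")
      case True
      then show ?thesis using K(1) by (simp add: J'_def)
    next
      case False
      then show ?thesis
        using J ctower_mono[of "c $ i" L "J i" "L + \<bar>s\<bar>"] by (simp add: J'_def ctowers_def)
    qed
    then show "ctower (c $ i) (L + 1) (J' i)" by (rule ctower_mono) (use s in simp)
  qed
  have n': "0 < (n(j := Suc (n j))) i" for i using n by simp
  have "bump_integral J n (\<lambda>y. u (y + axis j s)) - bump_integral J n u = - s *\<^sub>R bump_integral J' (n(j := Suc (n j))) u" if u: "continuous_on UNIV u" for u
  proof -
    have cp: "continuous_on UNIV (prodf J n)" by (rule continuous_on_prodf[OF ctowers_tower[OF J]])
    have "bump_integral J n (\<lambda>y. u (y + axis j s)) = (LINT y|lborel. prodf J n ((y + axis j s) - axis j s) *\<^sub>R u (y + axis j s))"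
      by (simp add: bump_integral_def)
    also have "\<dots> = (LINT y|lborel. prodf J n (y - axis j s) *\<^sub>R u y)"
      by (rule lborel_integral_translate[of "\<lambda>y. prodf J n (y - axis j s) *\<^sub>R u y"])
        (intro borel_measurable_continuous_onI continuous_intros u continuous_on_compose2[OF cp], auto)
    also have "\<dots> = (LINT y|lborel. prodf J n y *\<^sub>R u y - s *\<^sub>R (prodf J' (n(j := Suc (n j))) y *\<^sub>R u y))"
    proof (rule Bochner_Integration.integral_cong[OF refl])
      fix y
      have "prodf J n (y - axis j s) = prodf J n y - s * prodf J' (n(j := Suc (n j))) y"
        using prodf_shift[of K J j s, OF K(2) s(1), of n y] by (simp add: J'_def)
      then show "prodf J n (y - axis j s) *\<^sub>R u y = prodf J n y *\<^sub>R u y - s *\<^sub>R (prodf J' (n(j := Suc (n j))) y *\<^sub>R u y)"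
        by (simp add: scaleR_diff_left)
    qed
    also have "\<dots> = bump_integral J n u - s *\<^sub>R bump_integral J' (n(j := Suc (n j))) u"
      unfolding bump_integral_def
      by (subst Bochner_Integration.integral_diff[OF bump_integral_integrable[OF J n u] integrable_scaleR_right[OF bump_integral_integrable[OF J' n' u]]])
        (simp only: integral_scaleR_right)
    finally show ?thesis by simp
  qed
  then show ?thesis using J' by (intro exI[of _ J'] conjI allI impI)
qed

lemma finite_distinct_count:
  fixes S :: "3 set"
  obtains xs where "length xs \<le> 3" "\<And>i. count_list xs i = (if i \<in> S then 1 else 0)"
proof -
  obtain xs where xs: "set xs = S" "distinct xs" using finite_distinct_list[of S] by auto
  have "count_list ys i = (if i \<in> set ys then 1 else 0)" if "distinct ys" for ys and i :: 3
    using that by (induction ys) auto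
  moreover have "length xs \<le> 3"
    using xs distinct_card[of xs] card_mono[of "UNIV :: 3 set" S] by simp
  ultimately show ?thesis using that xs by simp
qed

text \<open>The anti-derivative trick: each factor of the test function is the derivative of the bounded,
  compactly supported function \<open>J i 0 - B 0\<close> plus a fixed bump, so that three integrations by
  parts leave only \<open>L\<^sup>2\<close> norms of weak derivatives.\<close>

lemma bump_integral_bound:
  assumes sob: "sobolev_H s u" and len: "length js + 3 \<le> s" and u: "continuous_on UNIV u"
  shows "\<exists>C. \<forall>c J. ctowers c 3 J \<longrightarrow> norm (bump_integral J (\<lambda>i. Suc (count_list js i)) u) \<le> C"
proof -
  obtain B0 where B0: "ctower 0 1 B0" using ctower_exists by metis
  have "bounded (B0 1 ` {-1..1})"
    using tower_cont[of B0] B0 by (intro compact_imp_bounded compact_continuous_image) (auto simp: ctower_def)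
  then obtain b' where "\<forall>y\<in>B0 1 ` {-1..1}. norm y \<le> b'" unfolding bounded_iff by (rule exE)
  then have b': "\<bar>B0 1 x\<bar> \<le> b'" if "x \<in> {-1..1}" for x using that by simp
  define b where "b = max 1 b'"
  have b: "1 \<le> b" "\<bar>B0 1 x\<bar> \<le> b" for x
  proof -
    show "\<bar>B0 1 x\<bar> \<le> b"
    proof (cases "x \<in> {-1..1}")
      case True
      then show ?thesis using b'[OF True] by (simp add: b_def)
    next
      case False
      then have "B0 (Suc 0) x = 0" using B0 by (auto simp: ctower_def)
      then show ?thesis by (simp add: b_def)
    qed
  qed (simp add: b_def)
  have "\<exists>w. L2 w \<and> weak_derivative (map (\<lambda>i. axis i 1) js') u w" if "length js' \<le> s" for js' :: "3 list"
  proof -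
    have "set (map (\<lambda>i. axis i 1 :: space) js') \<subseteq> Basis" by (auto simp: axis_in_Basis_iff)
    then show ?thesis using sob that unfolding sobolev_H_def by (metis length_map)
  qed
  then obtain w where w: "\<And>js' :: 3 list. length js' \<le> s \<Longrightarrow> L2 (w js') \<and> weak_derivative (map (\<lambda>i. axis i 1) js') u (w js')"
    by metis
  have "\<exists>xs. length xs \<le> 3 \<and> (\<forall>i. count_list xs i = (if i \<in> S then 1 else 0))" for S :: "3 set"
    using finite_distinct_count[of S] by metis
  then obtain xs where xs: "\<And>S :: 3 set. length (xs S) \<le> 3" "\<And>(S :: 3 set) i. count_list (xs S) i = (if i \<in> S then 1 else 0)"
    by metis
  define E where "E S = w (js @ xs S)" for S
  have E: "L2 (E S)" "weak_derivative (map (\<lambda>i. axis i 1) (js @ xs S)) u (E S)" for S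
    using w[of "js @ xs S"] len xs(1)[of S] unfolding E_def by simp_all
  \<comment> \<open>The constant involves neither \<open>c\<close> nor \<open>J\<close>: these enter
    only through the sup norm \<open>b\<close> and the volume of a ball of radius 9 = 3 * 3, which
    is independent of its centre.\<close>
  define C where "C = (\<Sum>S\<in>UNIV. b ^ 3 * (measure lebesgue (cball (0::space) 9) + (LINT y|lebesgue. (norm (E S y))\<^sup>2)))"
  have "norm (bump_integral J (\<lambda>i. Suc (count_list js i)) u) \<le> C" if J: "ctowers c 3 J" for c J
  proof -
    define B where "B i n x = B0 n ((x - c $ i) / 1) / 1 ^ n" for i :: 3 and n x
    have B: "ctower (c $ i) 1 (B i)" for i
      using ctower_affine[OF B0, of 1 "c $ i"] by (simp add: B_def[abs_def])
    have B3: "ctower (c $ i) 3 (B i)" for i using ctower_mono[OF B] by simp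
    have Ji: "ctower (c $ i) 3 (J i)" for i using J by (simp add: ctowers_def)
    \<comment> \<open>Both \<open>J i 0\<close> and \<open>B i 0\<close> climb from 0 to 1, so their
      difference has compact support and is an admissible factor before any differentiation.\<close>
    define A where "A i n x = J i n x - B i n x" for i n x
    have tA: "tower (A i)" for i
      using Ji[of i] B[of i] unfolding ctower_def tower_def A_def by (auto intro!: DERIV_diff)
    have A0: "\<bar>A i 0 x\<bar> \<le> 1" for i x
      using Ji[of i] B[of i] unfolding ctower_def A_def by (smt (verit))
    have As: "A i n x = 0" if "\<bar>x - c $ i\<bar> > 3" for i n x
    proof -
      have x: "x < c $ i - 3 \<or> c $ i + 3 < x" using that by linarith
      then show ?thesis
        using Ji[of i] B3[of i] unfolding ctower_def A_def by (cases n) auto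
    qed
    define H where "H S i n = (if i \<in> S then A i n else B i (Suc n))" for S i n
    have tH: "tower (H S i)" for S i
      using tA[of i] B[of i] unfolding H_def ctower_def tower_def by auto
    have Hs: "H S i n x = 0" if "\<bar>x - c $ i\<bar> > 3" for S i n x
    proof -
      have "x < c $ i - 3 \<or> c $ i + 3 < x" using that by linarith
      then have "B i (Suc n) x = 0" using B3[of i] unfolding ctower_def by blast
      then show ?thesis using As[OF that] by (simp add: H_def)
    qed
    have H0: "\<bar>H S i 0 x\<bar> \<le> b" for S i x
      using A0[of i x] b(1) b(2)[of "x - c $ i"] by (simp add: H_def B_def)
    \<comment> \<open>Coordinates in \<open>S\<close> carry \<open>A\<close>, with one extra
      derivative recorded in \<open>xs S\<close>; the others carry the fixed bump. Hence at most
      three derivatives beyond \<open>js\<close> fall on \<open>u\<close>.\<close>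
    have expand: "prodf J (\<lambda>i. Suc (count_list js i)) y = (\<Sum>S\<in>UNIV. prodf (H S) (count_list (js @ xs S)) y)" for y
    proof -
      have "prodf J (\<lambda>i. Suc (count_list js i)) y
          = (\<Prod>i\<in>UNIV. A i (Suc (count_list js i)) (y $ i) + B i (Suc (count_list js i)) (y $ i))"
        by (simp add: prodf_def A_def)
      also have "\<dots> = (\<Sum>S\<in>Pow UNIV. (\<Prod>i\<in>S. A i (Suc (count_list js i)) (y $ i)) * (\<Prod>i\<in>UNIV - S. B i (Suc (count_list js i)) (y $ i)))"
        by (rule prod_add) simp
      also have "\<dots> = (\<Sum>S\<in>UNIV. prodf (H S) (count_list (js @ xs S)) y)"
      proof (rule sum.cong)
        fix S :: "3 set"
        have "prodf (H S) (count_list (js @ xs S)) y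
            = (\<Prod>i\<in>S. H S i (count_list (js @ xs S) i) (y $ i)) * (\<Prod>i\<in>UNIV - S. H S i (count_list (js @ xs S) i) (y $ i))"
          unfolding prodf_def by (subst prod.subset_diff[of S UNIV]) (auto simp: mult.commute)
        then show "(\<Prod>i\<in>S. A i (Suc (count_list js i)) (y $ i)) * (\<Prod>i\<in>UNIV - S. B i (Suc (count_list js i)) (y $ i))
            = prodf (H S) (count_list (js @ xs S)) y"
          by (simp add: H_def xs(2))
      qed simp
      finally show ?thesis .
    qed
    have contH: "continuous_on UNIV (prodf (H S) n)" for S n by (rule continuous_on_prodf[OF tH])
    have supH: "prodf (H S) n y \<noteq> 0 \<Longrightarrow> y \<in> cball c 9" for S n y
      using prodf_support[of 3 c "H S" n y] Hs by simp
    have int: "integrable lborel (\<lambda>y. prodf (H S) n y *\<^sub>R u y)" for S n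
      by (rule integrable_compact_support[of _ c 9]) (use supH contH u in \<open>auto intro!: continuous_intros\<close>)
    have bound: "norm (LINT y|lborel. prodf (H S) (count_list (js @ xs S)) y *\<^sub>R u y)
        \<le> b ^ 3 * (measure lebesgue (cball (0::space) 9) + (LINT y|lebesgue. (norm (E S y))\<^sup>2))" for S
    proof -
      let ?\<phi> = "prodf (H S) (\<lambda>_. 0)"
      have "(LINT y|lborel. prodf (H S) (count_list (js @ xs S)) y *\<^sub>R u y)
          = (LINT y|lebesgue. iter_deriv (map (\<lambda>i. axis i 1) (js @ xs S)) ?\<phi> y *\<^sub>R u y)"
        unfolding iter_deriv_prodf[OF tH]
        by (rule integral_completion[symmetric]) (use borel_measurable_integrable[OF int] in simp)
      also have "\<dots> = (-1) ^ length (map (\<lambda>i. axis i 1 :: space) (js @ xs S)) *\<^sub>R (LINT y|lebesgue. ?\<phi> y *\<^sub>R E S y)"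
      proof -
        have "test_function ?\<phi>" by (rule test_function_prodf[OF tH Hs])
        then show ?thesis using E(2)[of S] unfolding weak_derivative_def by blast
      qed
      finally have "norm (LINT y|lborel. prodf (H S) (count_list (js @ xs S)) y *\<^sub>R u y) = norm (LINT y|lebesgue. ?\<phi> y *\<^sub>R E S y)"
        by (simp add: power_abs)
      also have "\<dots> \<le> (LINT y|lebesgue. norm (?\<phi> y *\<^sub>R E S y))" by (rule integral_norm_bound)
      also have "\<dots> \<le> (LINT y|lebesgue. b ^ 3 * (indicator (cball c 9) y + (norm (E S y))\<^sup>2))"
      proof (rule integral_mono')
        have iE: "integrable lebesgue (\<lambda>y. (norm (E S y))\<^sup>2)" using E(1)[of S] by (simp add: L2_def)
        have "integrable lebesgue (indicat_real (cball c 9))"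
          using lmeasurable_cball[of c 9] by (simp add: fmeasurable_def integrable_indicator_iff)
        then show "integrable lebesgue (\<lambda>y. b ^ 3 * (indicat_real (cball c 9) y + (norm (E S y))\<^sup>2))"
          using iE by (intro integrable_mult_right Bochner_Integration.integrable_add)
        fix y
        show "0 \<le> b ^ 3 * (indicat_real (cball c 9) y + (norm (E S y))\<^sup>2)" using b by auto
        show "norm (?\<phi> y *\<^sub>R E S y) \<le> b ^ 3 * (indicat_real (cball c 9) y + (norm (E S y))\<^sup>2)"
        proof (cases "?\<phi> y = 0")
          case True
          then show ?thesis using b by auto
        next
          case False
          have "\<bar>?\<phi> y\<bar> \<le> (\<Prod>i\<in>(UNIV::3 set). b)"
            unfolding prodf_def abs_prod by (intro prod_mono) (use H0 in auto)
          then have "\<bar>?\<phi> y\<bar> \<le> b ^ 3" by simp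
          \<comment> \<open>On the bounded support this passes from the square integral to the
            integral, in place of the Cauchy-Schwarz inequality.\<close>
          moreover have "norm (E S y) \<le> 1 + (norm (E S y))\<^sup>2"
            using zero_le_power2[of "norm (E S y) - 1/2"] by (simp add: power2_eq_square algebra_simps)
          ultimately have "\<bar>?\<phi> y\<bar> * norm (E S y) \<le> b ^ 3 * (1 + (norm (E S y))\<^sup>2)"
            using b by (intro mult_mono) auto
          then show ?thesis using supH[OF False] by simp
        qed
      qed
      also have "\<dots> = b ^ 3 * (measure lebesgue (cball c 9) + (LINT y|lebesgue. (norm (E S y))\<^sup>2))"
      proof -
        have iE: "integrable lebesgue (\<lambda>y. (norm (E S y))\<^sup>2)" using E(1)[of S] by (simp add: L2_def)
        have "integrable lebesgue (indicat_real (cball c 9))"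
          using lmeasurable_cball[of c 9] by (simp add: fmeasurable_def integrable_indicator_iff)
        then show ?thesis using iE by (simp add: Bochner_Integration.integral_add)
      qed
      also have "measure lebesgue (cball c 9) = measure lebesgue (cball (0::space) 9)"
        using content_cball[of 9 c] content_cball[of 9 "0::space"] by simp
      finally show ?thesis .
    qed
    have "bump_integral J (\<lambda>i. Suc (count_list js i)) u = (LINT y|lborel. (\<Sum>S\<in>UNIV. prodf (H S) (count_list (js @ xs S)) y *\<^sub>R u y))"
      unfolding bump_integral_def expand by (simp add: scaleR_sum_left)
    also have "\<dots> = (\<Sum>S\<in>UNIV. (LINT y|lborel. prodf (H S) (count_list (js @ xs S)) y *\<^sub>R u y))"
      by (rule Bochner_Integration.integral_sum) (rule int)
    also have "norm \<dots> \<le> C" unfolding C_def by (intro order_trans[OF norm_sum] sum_mono bound)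
    finally show ?thesis .
  qed
  then show ?thesis by blast
qed

text \<open>Rescaled bumps recover point values, up to the fixed mass \<open>m\<close>.\<close>

lemma point_value_bound:
  obtains m where "0 < m"
    "\<And>f x C. \<lbrakk>continuous_on UNIV f; \<And>J. ctowers x 1 J \<Longrightarrow> norm (bump_integral J (\<lambda>_. 1) f) \<le> C\<rbrakk> \<Longrightarrow> m * norm (f x) \<le> C"
proof -
  obtain B where B: "ctower 0 1 B" "\<And>x. \<bar>x\<bar> < 1 \<Longrightarrow> 0 < B 1 x" using ctower_exists by metis
  have tB: "tower B" using B by (simp add: ctower_def)
  define \<psi> where "\<psi> = prodf (\<lambda>_. B) (\<lambda>_. 1)"
  \<comment> \<open>\<open>B 1\<close> is positive inside and zero outside the interval; at the end
    points continuity decides.\<close>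
  have B1: "0 \<le> B 1 x" for x
  proof (cases "\<bar>x\<bar> < 1")
    case True
    then show ?thesis using B(2) by (simp add: less_imp_le)
  next
    case False
    show ?thesis
    proof (rule ccontr)
      assume neg: "\<not> 0 \<le> B 1 x"
      have "isCont (B 1) x" using DERIV_isCont[OF tower_D[OF tB]] .
      then have "\<forall>\<^sub>F y in at x. B 1 y < 0"
        using neg order_tendstoD(2)[of "B 1" "B 1 x" "at x" 0] by (simp add: isCont_def)
      then obtain d where d: "0 < d" "\<And>y. y \<noteq> x \<Longrightarrow> dist y x < d \<Longrightarrow> B 1 y < 0" by (auto simp: eventually_at)
      have "\<bar>x\<bar> = 1" using False neg B(1) by (auto simp: ctower_def abs_if split: if_splits) (smt (verit) One_nat_def)+
      define y where "y = x - sgn x * min (d/2) 1"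
      have "\<bar>y\<bar> < 1" "y \<noteq> x" "dist y x < d"
        using \<open>\<bar>x\<bar> = 1\<close> d(1) by (auto simp: y_def dist_real_def sgn_if abs_if min_def split: if_splits)
      then show False using d(2) B(2) by force
    qed
  qed
  have \<psi>0: "0 \<le> \<psi> z" for z unfolding \<psi>_def prodf_def by (intro prod_nonneg) (use B1 in auto)
  have \<psi>c: "continuous_on UNIV \<psi>" unfolding \<psi>_def by (rule continuous_on_prodf[OF tB])
  have cB: "ctowers 0 1 (\<lambda>_. B)" using B by (simp add: ctowers_def)
  have \<psi>s: "\<psi> z \<noteq> 0 \<Longrightarrow> z \<in> cball 0 3" for z
    using prodf_ctowers_support[OF cB, of "\<lambda>_. 1" z] by (simp add: \<psi>_def)
  have \<psi>i: "integrable lborel \<psi>"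
  proof -
    have "integrable lborel (\<lambda>x. indicator (cball 0 3) x *\<^sub>R \<psi> x)"
      using \<psi>c by (intro borel_integrable_compact) (auto intro: continuous_on_subset)
    moreover have "(\<lambda>x. indicator (cball 0 3) x *\<^sub>R \<psi> x) = \<psi>"
      using \<psi>s by (auto simp: fun_eq_iff indicator_def)
    ultimately show ?thesis by simp
  qed
  define m where "m = (LINT z|lborel. \<psi> z)"
  have m: "0 < m"
  proof (rule ccontr)
    assume "\<not> 0 < m"
    moreover have "0 \<le> m" unfolding m_def by (intro integral_nonneg_AE AE_I2 \<psi>0)
    ultimately have "(LINT z|lborel. \<psi> z) = 0" by (simp add: m_def)
    then have "AE z in lborel. \<psi> z = 0" using integral_nonneg_eq_0_iff_AE[OF \<psi>i] \<psi>0 by auto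
    then have ae: "AE z in lborel. z \<notin> ball (0::space) 1"
    proof eventually_elim
      case (elim z)
      show ?case
      proof
        assume "z \<in> ball 0 1"
        then have "\<bar>z $ i\<bar> < 1" for i using component_le_norm_cart[of z i] by simp
        then have "0 < \<psi> z" unfolding \<psi>_def prodf_def by (intro prod_pos) (use B(2) in auto)
        then show False using elim by simp
      qed
    qed
    have "ball (0::space) 1 \<in> null_sets lborel"
      using ae by (subst AE_iff_null_sets) auto
    then have "emeasure lborel (ball (0::space) 1) = 0" by (simp add: null_sets_def)
    then show False using emeasure_ball[of 1 "0::space"] unit_ball_vol_pos[of 3] by simp
  qed
  have "m * norm (f x) \<le> C"
    if f: "continuous_on UNIV f" and C: "\<And>J. ctowers x 1 J \<Longrightarrow> norm (bump_integral J (\<lambda>_. 1) f) \<le> C" for f x C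
  proof (rule field_le_epsilon)
    fix e :: real assume e: "0 < e"
    have "isCont f x" using f by (simp add: continuous_on_eq_continuous_at)
    then obtain d where d: "0 < d" "\<And>y. dist y x < d \<Longrightarrow> dist (f y) (f x) < e / m"
      unfolding continuous_at_eps_delta using e m by (meson divide_pos_pos)
    \<comment> \<open>The rescaled bump is supported within 3 r of \<open>x\<close>, which has to
      stay below the continuity radius \<open>d\<close>; \<open>r \<le> 1\<close> makes the bump
      admissible for the hypothesis on \<open>ctowers x 1\<close>.\<close>
    define r where "r = min 1 (d / 6)"
    have r: "0 < r" "r \<le> 1" "3 * r < d" using d by (auto simp: r_def)
    define J where "J i n t = B n ((t - x $ i) / r) / r ^ n" for i :: 3 and n t
    have J: "ctowers x 1 J"
      unfolding ctowers_def J_def[abs_def] using ctower_mono[OF ctower_affine[OF B(1) r(1)] r(2)] by simp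
    have Jy: "prodf J (\<lambda>_. 1) (x + r *\<^sub>R z) = \<psi> z / r ^ 3" for z
      unfolding prodf_def \<psi>_def J_def using r by (simp add: prod_dividef)
    have cJ: "continuous_on UNIV (prodf J (\<lambda>_. 1))" by (rule continuous_on_prodf[OF ctowers_tower[OF J]])
    have "bump_integral J (\<lambda>_. 1) f = r ^ 3 *\<^sub>R (LINT z|lborel. prodf J (\<lambda>_. 1) (x + r *\<^sub>R z) *\<^sub>R f (x + r *\<^sub>R z))"
    proof -
      have meas: "(\<lambda>y. prodf J (\<lambda>_. 1) y *\<^sub>R f y) \<in> borel_measurable borel"
        by (intro borel_measurable_continuous_onI continuous_intros cJ f)
      show ?thesis
        unfolding bump_integral_def by (rule lborel_integral_scale[OF meas r(1)])
    qed
    also have "\<dots> = (LINT z|lborel. \<psi> z *\<^sub>R f (x + r *\<^sub>R z))"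
      unfolding Jy using r by (simp flip: integral_scaleR_right)
    finally have eq: "bump_integral J (\<lambda>_. 1) f = (LINT z|lborel. \<psi> z *\<^sub>R f (x + r *\<^sub>R z))" .
    have i1: "integrable lborel (\<lambda>z. \<psi> z *\<^sub>R f (x + r *\<^sub>R z))"
      by (rule integrable_compact_support[of _ 0 3])
        (use \<psi>s \<psi>c in \<open>auto intro!: continuous_intros continuous_on_compose2[OF f]\<close>)
    have i2: "integrable lborel (\<lambda>z. \<psi> z *\<^sub>R f x)" using \<psi>i by auto
    have "norm ((LINT z|lborel. \<psi> z *\<^sub>R f (x + r *\<^sub>R z)) - (LINT z|lborel. \<psi> z *\<^sub>R f x))
        = norm (LINT z|lborel. \<psi> z *\<^sub>R f (x + r *\<^sub>R z) - \<psi> z *\<^sub>R f x)"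
      using i1 i2 by (simp add: Bochner_Integration.integral_diff)
    also have "\<dots> \<le> (LINT z|lborel. norm (\<psi> z *\<^sub>R f (x + r *\<^sub>R z) - \<psi> z *\<^sub>R f x))" by (rule integral_norm_bound)
    also have "\<dots> \<le> (LINT z|lborel. \<psi> z * (e / m))"
    proof (rule integral_mono')
      show "integrable lborel (\<lambda>z. \<psi> z * (e / m))" using \<psi>i by auto
      fix z
      show "0 \<le> \<psi> z * (e / m)" using \<psi>0 e m by auto
      show "norm (\<psi> z *\<^sub>R f (x + r *\<^sub>R z) - \<psi> z *\<^sub>R f x) \<le> \<psi> z * (e / m)"
      proof (cases "\<psi> z = 0")
        case False
        have "r * norm z \<le> r * 3" using \<psi>s[OF False] r by (intro mult_left_mono) auto
        then have "r * norm z < d" using r(3) by linarith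
        then have "dist (x + r *\<^sub>R z) x < d" using r(1) by (simp add: dist_norm)
        then have "norm (f (x + r *\<^sub>R z) - f x) \<le> e / m" using d(2) by (simp add: dist_norm less_imp_le)
        then have "\<psi> z * norm (f (x + r *\<^sub>R z) - f x) \<le> \<psi> z * (e / m)" using \<psi>0[of z] by (rule mult_left_mono)
        then show ?thesis using \<psi>0[of z] by (simp flip: scaleR_diff_right)
      qed simp
    qed
    also have "\<dots> = e" using m by (simp add: m_def)
    finally have "norm (bump_integral J (\<lambda>_. 1) f - (LINT z|lborel. \<psi> z *\<^sub>R f x)) \<le> e" unfolding eq .
    moreover have "(LINT z|lborel. \<psi> z *\<^sub>R f x) = m *\<^sub>R f x"
      unfolding m_def by (rule integral_scaleR_left) (rule \<psi>i)
    ultimately have "norm (bump_integral J (\<lambda>_. 1) f - m *\<^sub>R f x) \<le> e" by simp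
    then have "norm (m *\<^sub>R f x) \<le> norm (bump_integral J (\<lambda>_. 1) f) + e"
      using norm_triangle_ineq2[of "m *\<^sub>R f x" "bump_integral J (\<lambda>_. 1) f"] by (simp add: norm_minus_commute)
    then show "m * norm (f x) \<le> C + e" using C[OF J] m by simp
  qed
  then show ?thesis using that m by blast
qed

section \<open>From averaged to pointwise bounds on differences\<close>

lemma bump_integral_diff:
  fixes f g :: "space \<Rightarrow> space"
  assumes "ctowers c L J" "\<And>i. 0 < n i" "continuous_on UNIV f" "continuous_on UNIV g"
  shows "bump_integral J n (\<lambda>y. f y - g y) = bump_integral J n f - bump_integral J n g"
  unfolding bump_integral_def scaleR_diff_right
  by (rule Bochner_Integration.integral_diff[OF bump_integral_integrable[OF assms(1-3)] bump_integral_integrable[OF assms(1,2,4)]])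

lemma lipschitz_from_axes:
  fixes f :: "space \<Rightarrow> 'b::real_normed_vector"
  assumes ax: "\<And>a i s. \<bar>s\<bar> \<le> 1 \<Longrightarrow> norm (f (a + axis i s) - f a) \<le> K * \<bar>s\<bar>"
    and h: "norm h \<le> 1" and K: "0 \<le> K"
  shows "norm (f (a + h) - f a) \<le> 3 * K * norm h"
proof -
  have hi: "\<bar>h $ i\<bar> \<le> norm h" for i by (rule component_le_norm_cart)
  then have h1: "\<bar>h $ i\<bar> \<le> 1" for i using h order_trans by blast
  have b: "norm (f (b + axis i (h $ i)) - f b) \<le> K * norm h" for b i
    using ax[OF h1, of b i i] mult_left_mono[OF hi K, of i] by linarith
  have "h = axis 1 (h $ 1) + axis 2 (h $ 2) + axis 3 (h $ 3)"
    by (simp add: vec_eq_iff forall_3 axis_def)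
  then have "a + h = a + axis 1 (h $ 1) + axis 2 (h $ 2) + axis 3 (h $ 3)" by (simp add: add.assoc)
  then have "f (a + h) - f a = (f (a + axis 1 (h $ 1) + axis 2 (h $ 2) + axis 3 (h $ 3)) - f (a + axis 1 (h $ 1) + axis 2 (h $ 2)))
     + (f (a + axis 1 (h $ 1) + axis 2 (h $ 2)) - f (a + axis 1 (h $ 1))) + (f (a + axis 1 (h $ 1)) - f a)"
    by (simp only:) simp
  also have "norm \<dots> \<le> K * norm h + K * norm h + K * norm h"
    by (intro norm_triangle_le add_mono b)
  finally show ?thesis by simp
qed

text \<open>Each difference along an axis adds one derivative and 1 to the width of the bump. Two
  differences thus call for \<open>bump_integral_bound\<close> with \<open>length js = 2\<close> and
  width 3, the origin of \<open>5 \<le> s\<close>. General directions follow by telescoping along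
  the axes.\<close>

theorem sobolev_C11_bounds:
  fixes u :: "space \<Rightarrow> space"
  assumes sob: "sobolev_H s u" and s: "5 \<le> s" and u: "continuous_on UNIV u"
  obtains N where "0 \<le> N" "\<And>a. norm (u a) \<le> N" "\<And>a h. norm (u (a + h) - u a) \<le> N * norm h"
    "\<And>a h k g. \<lbrakk>0 \<le> g; g \<le> 1\<rbrakk> \<Longrightarrow> norm (u (a + h + k) - u (a + h) - u (a + k) + u a) \<le> N * (norm h * norm k powr g)"
proof -
  have "\<exists>C. \<forall>c J. ctowers c 3 J \<longrightarrow> norm (bump_integral J (\<lambda>i. Suc (count_list js i)) u) \<le> C" if "length js \<le> 2" for js
    using that s by (intro bump_integral_bound[OF sob _ u]) simp
  then obtain C where C: "\<And>js c J. \<lbrakk>length js \<le> 2; ctowers c 3 J\<rbrakk> \<Longrightarrow> norm (bump_integral J (\<lambda>i. Suc (count_list js i)) u) \<le> C js"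
    by metis
  define D where "D = (\<Sum>js\<in>{js :: 3 list. set js \<subseteq> UNIV \<and> length js \<le> 2}. \<bar>C js\<bar>)"
  have D0: "0 \<le> D" unfolding D_def by (intro sum_nonneg) simp
  have D: "norm (bump_integral J (\<lambda>i. Suc (count_list js i)) u) \<le> D" if "length js \<le> 2" "ctowers c L J" "L \<le> 3" for js c L J
  proof -
    have "ctowers c 3 J" using that(2,3) ctower_mono unfolding ctowers_def by blast
    then have "norm (bump_integral J (\<lambda>i. Suc (count_list js i)) u) \<le> \<bar>C js\<bar>" using C[OF that(1)] abs_ge_self order_trans by blast
    also have "\<bar>C js\<bar> \<le> D" unfolding D_def
      by (rule member_le_sum) (use that finite_lists_length_le[of "UNIV :: 3 set" 2] in auto)
    finally show ?thesis .
  qed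
  have sh: "continuous_on UNIV (\<lambda>y. f (y + h))" if "continuous_on UNIV f" for f :: "space \<Rightarrow> space" and h
    by (rule continuous_on_compose2[OF that]) (auto intro!: continuous_intros)
  obtain m where m: "0 < m"
    "\<And>(f :: space \<Rightarrow> space) x C. \<lbrakk>continuous_on UNIV f; \<And>J. ctowers x 1 J \<Longrightarrow> norm (bump_integral J (\<lambda>_. 1) f) \<le> C\<rbrakk> \<Longrightarrow> m * norm (f x) \<le> C"
    using point_value_bound by blast
  define N where "N = D / m"
  have N0: "0 \<le> N" using D0 m by (simp add: N_def)
  have mN: "norm v \<le> N * t" if "m * norm v \<le> D * t" for v :: space and t
    using that m by (simp add: N_def field_simps)
  have c0: "(\<lambda>_. 1) = (\<lambda>i. Suc (count_list [] i))" for i :: 3 by simp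
  have b0: "norm (u x) \<le> N" for x
  proof -
    have "m * norm (u x) \<le> D"
      by (rule m(2)[OF u]) (use D[of "[]" x 1] in simp)
    then show ?thesis using mN[of "u x" 1] by simp
  qed
  have b1: "norm (u (x + axis i t) - u x) \<le> N * \<bar>t\<bar>" if t: "\<bar>t\<bar> \<le> 1" for x i t
  proof (cases "t = 0")
    case True
    then show ?thesis by (simp add: axis_def zero_vec_def[symmetric])
  next
    case False
    have "m * norm (u (x + axis i t) - u x) \<le> D * \<bar>t\<bar>"
    proof (rule m(2)[of "\<lambda>y. u (y + axis i t) - u y"])
      show "continuous_on UNIV (\<lambda>y. u (y + axis i t) - u y)" by (intro continuous_intros sh u)
      fix J assume J: "ctowers x 1 J"
      have n1: "0 < (\<lambda>_. 1 :: nat) k" for k :: 3 by simp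
      have "\<exists>J'. ctowers x (1 + 1) J' \<and> (\<forall>u. continuous_on UNIV u \<longrightarrow> bump_integral J (\<lambda>_. 1) (\<lambda>y. u (y + axis i t)) - bump_integral J (\<lambda>_. 1) u = - t *\<^sub>R bump_integral J' ((\<lambda>_. 1)(i := Suc 1)) u)"
        by (rule bump_integral_shift[where j = i, OF J n1 False t])
      then obtain J' where J'0: "ctowers x (1 + 1) J' \<and> (\<forall>u. continuous_on UNIV u \<longrightarrow> bump_integral J (\<lambda>_. 1) (\<lambda>y. u (y + axis i t)) - bump_integral J (\<lambda>_. 1) u = - t *\<^sub>R bump_integral J' ((\<lambda>_. 1)(i := Suc 1)) u)" ..
      note J' = conjunct1[OF J'0] J'0[THEN conjunct2, rule_format]
      have n: "(\<lambda>_. 1)(i := Suc 1) = (\<lambda>k. Suc (count_list [i] k))" by (auto simp: fun_eq_iff)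
      have "bump_integral J (\<lambda>_. 1) (\<lambda>y. u (y + axis i t) - u y) = - t *\<^sub>R bump_integral J' (\<lambda>k. Suc (count_list [i] k)) u"
        unfolding n[symmetric] J'(2)[OF u, symmetric] by (rule bump_integral_diff[OF J]) (auto intro: sh u)
      then have "norm (bump_integral J (\<lambda>_. 1) (\<lambda>y. u (y + axis i t) - u y)) = \<bar>t\<bar> * norm (bump_integral J' (\<lambda>k. Suc (count_list [i] k)) u)"
        by (simp del: count_list.simps)
      also have "\<dots> \<le> \<bar>t\<bar> * D"
        using D[of "[i]" x 2 J'] J'(1) by (intro mult_left_mono) auto
      finally show "norm (bump_integral J (\<lambda>_. 1) (\<lambda>y. u (y + axis i t) - u y)) \<le> D * \<bar>t\<bar>"
        by (simp only: mult.commute)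
    qed
    then show ?thesis by (rule mN)
  qed
  have b2: "norm ((u (x + axis i t + axis j r) - u (x + axis i t)) - (u (x + axis j r) - u x)) \<le> N * \<bar>r\<bar> * \<bar>t\<bar>"
    if t: "\<bar>t\<bar> \<le> 1" "\<bar>r\<bar> \<le> 1" for x i t j r
  proof (cases "t = 0 \<or> r = 0")
    case True
    then show ?thesis by (auto simp: axis_def zero_vec_def[symmetric])
  next
    case False
    then have tr: "t \<noteq> 0" "r \<noteq> 0" by auto
    define v where "v y = u (y + axis j r) - u y" for y
    have v: "continuous_on UNIV v" unfolding v_def by (intro continuous_intros sh u)
    have "m * norm (v (x + axis i t) - v x) \<le> D * (\<bar>r\<bar> * \<bar>t\<bar>)"
    proof (rule m(2)[of "\<lambda>y. v (y + axis i t) - v y"])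
      show "continuous_on UNIV (\<lambda>y. v (y + axis i t) - v y)" by (intro continuous_intros sh v)
      fix J assume J: "ctowers x 1 J"
      have n1: "0 < (\<lambda>_. 1 :: nat) k" for k :: 3 by simp
      have "\<exists>J'. ctowers x (1 + 1) J' \<and> (\<forall>u. continuous_on UNIV u \<longrightarrow> bump_integral J (\<lambda>_. 1) (\<lambda>y. u (y + axis i t)) - bump_integral J (\<lambda>_. 1) u = - t *\<^sub>R bump_integral J' ((\<lambda>_. 1)(i := Suc 1)) u)"
        by (rule bump_integral_shift[where j = i, OF J n1 tr(1) t(1)])
      then obtain J' where J'0: "ctowers x (1 + 1) J' \<and> (\<forall>u. continuous_on UNIV u \<longrightarrow> bump_integral J (\<lambda>_. 1) (\<lambda>y. u (y + axis i t)) - bump_integral J (\<lambda>_. 1) u = - t *\<^sub>R bump_integral J' ((\<lambda>_. 1)(i := Suc 1)) u)" ..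
      note J' = conjunct1[OF J'0] J'0[THEN conjunct2, rule_format]
      define n where "n = (\<lambda>_::3. 1::nat)(i := Suc 1)"
      have n0: "0 < n k" for k by (simp add: n_def)
      have "\<exists>J''. ctowers x (1 + 1 + 1) J'' \<and> (\<forall>u. continuous_on UNIV u \<longrightarrow> bump_integral J' n (\<lambda>y. u (y + axis j r)) - bump_integral J' n u = - r *\<^sub>R bump_integral J'' (n(j := Suc (n j))) u)"
        by (rule bump_integral_shift[where j = j, OF J'(1) n0 tr(2) t(2)])
      then obtain J'' where J''0: "ctowers x (1 + 1 + 1) J'' \<and> (\<forall>u. continuous_on UNIV u \<longrightarrow> bump_integral J' n (\<lambda>y. u (y + axis j r)) - bump_integral J' n u = - r *\<^sub>R bump_integral J'' (n(j := Suc (n j))) u)" ..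
      note J'' = conjunct1[OF J''0] J''0[THEN conjunct2, rule_format]
      have n: "n(j := Suc (n j)) = (\<lambda>k. Suc (count_list [i, j] k))" by (auto simp: fun_eq_iff n_def)
      have "bump_integral J (\<lambda>_. 1) (\<lambda>y. v (y + axis i t) - v y) = - t *\<^sub>R bump_integral J' n v"
        unfolding n_def J'(2)[OF v, symmetric] by (rule bump_integral_diff[OF J]) (auto intro: sh v)
      also have "bump_integral J' n v = - r *\<^sub>R bump_integral J'' (\<lambda>k. Suc (count_list [i, j] k)) u"
        unfolding n[symmetric] J''(2)[OF u, symmetric] v_def by (rule bump_integral_diff[OF J'(1) n0]) (auto intro: sh u)
      finally have "norm (bump_integral J (\<lambda>_. 1) (\<lambda>y. v (y + axis i t) - v y)) = \<bar>t\<bar> * \<bar>r\<bar> * norm (bump_integral J'' (\<lambda>k. Suc (count_list [i, j] k)) u)"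
        by (simp add: abs_mult del: count_list.simps)
      also have "\<dots> \<le> \<bar>t\<bar> * \<bar>r\<bar> * D"
        using D[of "[i, j]" x 3 J''] J''(1) by (intro mult_left_mono) auto
      finally show "norm (bump_integral J (\<lambda>_. 1) (\<lambda>y. v (y + axis i t) - v y)) \<le> D * (\<bar>r\<bar> * \<bar>t\<bar>)"
        by (simp only: ac_simps)
    qed
    then have "norm (v (x + axis i t) - v x) \<le> N * (\<bar>r\<bar> * \<bar>t\<bar>)" by (rule mN)
    then show ?thesis by (simp only: v_def mult.assoc)
  qed
  have c1: "norm (u (a + h) - u a) \<le> 3 * N * norm h" for a h
  proof (cases "norm h \<le> 1")
    case True
    show ?thesis by (rule lipschitz_from_axes[OF b1 True N0])
  next
    case False
    have "norm (u (a + h) - u a) \<le> 2 * N * 1"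
      using norm_triangle_ineq4[of "u (a + h)" "u a"] b0[of "a + h"] b0[of a] by linarith
    also have "\<dots> \<le> 3 * N * norm h" using False N0 by (intro mult_mono) auto
    finally show ?thesis .
  qed
  have c2: "norm ((u (a + k + h) - u (a + k)) - (u (a + h) - u a)) \<le> 9 * N * norm h * norm k"
    if h: "norm h \<le> 1" and k: "norm k \<le> 1" for a h k
  proof -
    have "norm ((u (a + axis j r + h) - u (a + axis j r)) - (u (a + h) - u a)) \<le> (3 * N * norm h) * \<bar>r\<bar>" if r: "\<bar>r\<bar> \<le> 1" for a j r
    proof -
      have "norm ((u (a + h + axis j r) - u (a + h)) - (u (a + axis j r) - u a)) \<le> 3 * (N * \<bar>r\<bar>) * norm h"
        by (rule lipschitz_from_axes[of "\<lambda>a. u (a + axis j r) - u a", OF b2 h]) (use r N0 in auto)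
      moreover have "(u (a + h + axis j r) - u (a + h)) - (u (a + axis j r) - u a) = (u (a + axis j r + h) - u (a + axis j r)) - (u (a + h) - u a)"
        by (simp add: algebra_simps)
      ultimately show ?thesis by (simp only: ac_simps)
    qed
    from lipschitz_from_axes[of "\<lambda>a. u (a + h) - u a", OF this k] N0
    have "norm ((u (a + k + h) - u (a + k)) - (u (a + h) - u a)) \<le> 3 * (3 * N * norm h) * norm k" by simp
    then show ?thesis by simp
  qed
  \<comment> \<open>For |k| > 1 the Lipschitz bound in h suffices; for |k| at most 1 one has |k|
    \<le> |k|^g, combined with the second-difference bound if h is short and with the Lipschitz
    bound in k if h is long.\<close>
  have c3: "norm (u (a + h + k) - u (a + h) - u (a + k) + u a) \<le> 18 * N * (norm h * norm k powr g)"
    if g: "0 \<le> g" "g \<le> 1" for a h k g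
  proof -
    let ?d = "u (a + h + k) - u (a + h) - u (a + k) + u a"
    have e: "?d = (u (a + k + h) - u (a + k)) - (u (a + h) - u a)" "?d = (u (a + h + k) - u (a + h)) - (u (a + k) - u a)"
      by (simp_all add: algebra_simps)
    have dh: "norm ?d \<le> 6 * N * norm h"
      unfolding e(1) using norm_triangle_ineq4[of "u (a + k + h) - u (a + k)" "u (a + h) - u a"] c1[of "a + k" h] c1[of a h] by linarith
    have dk: "norm ?d \<le> 6 * N * norm k"
      unfolding e(2) using norm_triangle_ineq4[of "u (a + h + k) - u (a + h)" "u (a + k) - u a"] c1[of "a + h" k] c1[of a k] by linarith
    have N6: "6 * N * x \<le> 18 * N * x" "9 * N * x \<le> 18 * N * x" if "0 \<le> x" for x
      using N0 that by (intro mult_right_mono; simp)+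
    show ?thesis
    proof (cases "norm k \<le> 1")
      case False
      then have "1 \<le> norm k powr g" using g by (simp add: ge_one_powr_ge_zero)
      then have "6 * N * (norm h * 1) \<le> 6 * N * (norm h * norm k powr g)"
        using N0 by (intro mult_left_mono) auto
      with dh N6(1)[of "norm h * norm k powr g"] show ?thesis by simp
    next
      case k: True
      have kg: "norm k \<le> norm k powr g"
      proof (cases "k = 0")
        case False
        then show ?thesis using k g powr_mono'[of g 1 "norm k"] by simp
      qed simp
      show ?thesis
      proof (cases "norm h \<le> 1")
        case True
        have "9 * N * (norm h * norm k) \<le> 9 * N * (norm h * norm k powr g)"
          using N0 kg by (intro mult_left_mono) auto
        with c2[OF True k, of a, folded e(1)] N6(2)[of "norm h * norm k powr g"] show ?thesis by simp
      next
        case False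
        have "6 * N * (1 * norm k) \<le> 6 * N * (norm h * norm k powr g)"
          using N0 kg False by (intro mult_left_mono mult_mono) auto
        with dk N6(1)[of "norm h * norm k powr g"] show ?thesis by simp
      qed
    qed
  qed
  show ?thesis
  proof (rule that[of "18 * N"])
    show "norm (u a) \<le> 18 * N" for a using b0[of a] N0 by linarith
    show "norm (u (a + h) - u a) \<le> 18 * N * norm h" for a h
    proof -
      have "3 * N * norm h \<le> 18 * N * norm h" using N0 by (intro mult_right_mono) auto
      with c1[of a h] show ?thesis by linarith
    qed
  qed (use N0 c3 in auto)
qed

section \<open>Linear differential equations and Gronwall estimates\<close>

lemma vector_derivative_bound_0:
  fixes w :: "real \<Rightarrow> 'a::real_normed_vector"
  assumes w: "\<And>t. \<bar>t\<bar> \<le> d \<Longrightarrow> (w has_vector_derivative w' t) (at t)"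
    and b: "\<And>t. \<bar>t\<bar> \<le> d \<Longrightarrow> norm (w' t) \<le> B" and t: "\<bar>t\<bar> \<le> d"
  shows "norm (w t - w 0) \<le> B * \<bar>t\<bar>"
proof -
  have "norm (w t - w 0) \<le> B * norm (t - 0)"
  proof (rule differentiable_bound[of "{-d..d}" w "\<lambda>t h. h *\<^sub>R w' t"])
    show "(w has_derivative (\<lambda>h. h *\<^sub>R w' t)) (at t within {-d..d})" if "t \<in> {-d..d}" for t
      using w[of t] that by (auto simp: has_vector_derivative_def intro: has_derivative_at_withinI)
    show "onorm (\<lambda>h. h *\<^sub>R w' t) \<le> B" if "t \<in> {-d..d}" for t
    proof (rule onorm_le)
      fix h :: real
      have "\<bar>h\<bar> * norm (w' t) \<le> \<bar>h\<bar> * B" using b[of t] that by (intro mult_left_mono) (auto simp: abs_le_iff)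
      then show "norm (h *\<^sub>R w' t) \<le> B * norm h" by (simp add: mult.commute)
    qed
  qed (use t in auto)
  then show ?thesis by simp
qed

text \<open>At a maximum point of the norm, \<open>L * d \<le> 1/2\<close> lets the linear term be
  absorbed into the left-hand side. The second bound shows that the deviation from the initial value
  is small with d.\<close>

lemma short_time_gronwall:
  fixes w :: "real \<Rightarrow> 'a::real_normed_vector"
  assumes w: "\<And>t. \<bar>t\<bar> \<le> d \<Longrightarrow> (w has_vector_derivative w' t) (at t)"
    and b: "\<And>t. \<bar>t\<bar> \<le> d \<Longrightarrow> norm (w' t) \<le> L * norm (w t) + e"
    and L: "0 \<le> L" "L * d \<le> 1/2" and e: "0 \<le> e" and t: "\<bar>t\<bar> \<le> d"
  shows "norm (w t) \<le> 2 * (norm (w 0) + d * e)"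
    and "norm (w t - w 0) \<le> d * (2 * L * (norm (w 0) + d * e) + e)"
proof -
  have d: "0 \<le> d" using t by simp
  have "continuous_on {-d..d} (\<lambda>t. norm (w t))"
    by (intro continuous_on_norm continuous_at_imp_continuous_on ballI has_vector_derivative_continuous[OF w])
      (auto simp: abs_le_iff)
  then obtain m where m: "m \<in> {-d..d}" "\<And>s. s \<in> {-d..d} \<Longrightarrow> norm (w s) \<le> norm (w m)"
    using continuous_attains_sup[of "{-d..d}" "\<lambda>t. norm (w t)"] d by auto
  have dif: "norm (w s - w 0) \<le> (L * norm (w m) + e) * \<bar>s\<bar>" if s: "\<bar>s\<bar> \<le> d" for s
  proof (rule vector_derivative_bound_0[OF w _ s])
    fix r assume r: "\<bar>r\<bar> \<le> d"
    then have "r \<in> {-d..d}" by (auto simp: abs_le_iff)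
    then have "L * norm (w r) \<le> L * norm (w m)" using L by (intro mult_left_mono m(2))
    with b[OF r] show "norm (w' r) \<le> L * norm (w m) + e" by linarith
  qed
  have P: "0 \<le> L * norm (w m) + e" using L e by simp
  have "norm (w m) \<le> norm (w 0) + norm (w m - w 0)" using norm_triangle_ineq[of "w 0" "w m - w 0"] by simp
  also have "norm (w m - w 0) \<le> (L * norm (w m) + e) * d"
  proof -
    have "\<bar>m\<bar> \<le> d" using m(1) by (simp add: abs_le_iff)
    from dif[OF this] mult_left_mono[OF this P] show ?thesis by linarith
  qed
  also have "(L * norm (w m) + e) * d = (L * d) * norm (w m) + d * e" by (simp add: algebra_simps)
  also have "(L * d) * norm (w m) \<le> 1/2 * norm (w m)" using L by (intro mult_right_mono) auto
  finally have S: "norm (w m) \<le> 2 * (norm (w 0) + d * e)" by simp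
  show "norm (w t) \<le> 2 * (norm (w 0) + d * e)" using m(2)[of t] t S by (auto simp: abs_le_iff)
  have "norm (w t - w 0) \<le> (L * norm (w m) + e) * d"
    using dif[OF t] mult_left_mono[OF t P] by linarith
  also have "\<dots> \<le> (L * (2 * (norm (w 0) + d * e)) + e) * d"
    using S L d by (intro mult_right_mono add_mono mult_left_mono) auto
  finally show "norm (w t - w 0) \<le> d * (2 * L * (norm (w 0) + d * e) + e)"
    by (simp only: mult.assoc mult.commute mult.left_commute)
qed

text \<open>The function |w|^2 exp(-2 L t) is nonincreasing; squaring avoids differentiating the
  norm at zeros of w.\<close>

lemma gronwall_forward:
  fixes w :: "real \<Rightarrow> 'a::real_inner"
  assumes w: "\<And>s. 0 \<le> s \<Longrightarrow> s \<le> t \<Longrightarrow> (w has_vector_derivative w' s) (at s)"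
    and b: "\<And>s. 0 \<le> s \<Longrightarrow> s \<le> t \<Longrightarrow> norm (w' s) \<le> L * norm (w s)" and t: "0 \<le> t"
  shows "norm (w t) \<le> exp (L * t) * norm (w 0)"
proof -
  define f where "f s = (w s \<bullet> w s) * exp (- 2 * L * s)" for s
  have "f t \<le> f 0"
  proof (rule DERIV_nonpos_imp_nonincreasing[OF t])
    fix s assume s: "0 \<le> s" "s \<le> t"
    have "((\<lambda>s. w s \<bullet> w s) has_vector_derivative (w s \<bullet> w' s + w' s \<bullet> w s)) (at s)"
      using bounded_bilinear.has_vector_derivative[OF bounded_bilinear_inner w[OF s] w[OF s]] .
    then have "((\<lambda>s. w s \<bullet> w s) has_real_derivative 2 * (w s \<bullet> w' s)) (at s)"
      by (simp add: has_real_derivative_iff_has_vector_derivative inner_commute)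
    moreover have "((\<lambda>s. exp (- 2 * L * s)) has_real_derivative exp (- 2 * L * s) * (- 2 * L)) (at s)"
      by (auto intro!: derivative_eq_intros)
    ultimately have "(f has_real_derivative (2 * (w s \<bullet> w' s)) * exp (- 2 * L * s) + (exp (- 2 * L * s) * (- 2 * L)) * (w s \<bullet> w s)) (at s)"
      unfolding f_def[abs_def] by (rule DERIV_mult)
    moreover have "(2 * (w s \<bullet> w' s)) * exp (- 2 * L * s) + (exp (- 2 * L * s) * (- 2 * L)) * (w s \<bullet> w s) \<le> 0"
    proof -
      have "w s \<bullet> w' s \<le> norm (w s) * norm (w' s)" by (rule norm_cauchy_schwarz)
      also have "\<dots> \<le> norm (w s) * (L * norm (w s))" using b[OF s] by (intro mult_left_mono) auto
      also have "\<dots> = L * (w s \<bullet> w s)" by (simp add: dot_square_norm power2_eq_square)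
      finally have "(w s \<bullet> w' s - L * (w s \<bullet> w s)) * (2 * exp (- 2 * L * s)) \<le> 0"
        by (intro mult_nonpos_nonneg) auto
      then show ?thesis by (simp add: algebra_simps)
    qed
    ultimately show "\<exists>y. (f has_real_derivative y) (at s) \<and> y \<le> 0" by blast
  qed
  then have "(norm (w t))\<^sup>2 * exp (- 2 * L * t) \<le> (norm (w 0))\<^sup>2" by (simp add: f_def dot_square_norm)
  then have "(norm (w t))\<^sup>2 * exp (- 2 * L * t) * (exp (L * t))\<^sup>2 \<le> (norm (w 0))\<^sup>2 * (exp (L * t))\<^sup>2"
    by (rule mult_right_mono) simp
  moreover have "exp (- 2 * L * t) * (exp (L * t))\<^sup>2 = 1"
    by (simp add: power2_eq_square flip: exp_add)
  ultimately have "(norm (w t))\<^sup>2 \<le> (norm (w 0))\<^sup>2 * (exp (L * t))\<^sup>2"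
    by (simp only: mult.assoc mult_1_right)
  then have "(norm (w t))\<^sup>2 \<le> (exp (L * t) * norm (w 0))\<^sup>2"
    by (simp only: power_mult_distrib mult.commute)
  then show ?thesis by (rule power2_le_imp_le) simp
qed

lemma gronwall:
  fixes w :: "real \<Rightarrow> 'a::real_inner"
  assumes w: "\<And>s. \<bar>s\<bar> \<le> \<bar>t\<bar> \<Longrightarrow> (w has_vector_derivative w' s) (at s)"
    and b: "\<And>s. \<bar>s\<bar> \<le> \<bar>t\<bar> \<Longrightarrow> norm (w' s) \<le> L * norm (w s)"
  shows "norm (w t) \<le> exp (L * \<bar>t\<bar>) * norm (w 0)"
proof (cases "0 \<le> t")
  case True
  then show ?thesis using gronwall_forward[of t w w' L] w b by auto
next
  case False
  have "norm ((w \<circ> uminus) (- t)) \<le> exp (L * - t) * norm ((w \<circ> uminus) 0)"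
  proof (rule gronwall_forward)
    fix s assume s: "0 \<le> s" "s \<le> - t"
    have "(uminus has_vector_derivative (-1 :: real)) (at s)"
      by (auto intro!: derivative_eq_intros simp: has_vector_derivative_def)
    from vector_diff_chain_at[OF this w[of "- s"]] s False
    show "(w \<circ> uminus has_vector_derivative - w' (- s)) (at s)" by simp
    show "norm (- w' (- s)) \<le> L * norm ((w \<circ> uminus) s)" using b[of "- s"] s False by simp
  qed (use False in simp)
  then show ?thesis using False by simp
qed

text \<open>Banach's fixed point theorem for the integral equation. Times are clamped to [-d, d] by
  \<open>c\<close>, so that the operator acts on bounded continuous functions of all real times; the
  integrals from -d to t and to 0 each have length at most 2 d, whence the contraction constant 4 L
  d \<le> 1/2.\<close>

lemma linear_ode_exists:
  fixes M :: "real \<Rightarrow> 'a::euclidean_space \<Rightarrow> 'a"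
  assumes lin: "\<And>s. linear (M s)" and cont: "\<And>v. continuous_on {-d..d} (\<lambda>s. M s v)"
    and bd: "\<And>s v. \<bar>s\<bar> \<le> d \<Longrightarrow> norm (M s v) \<le> L * norm v" and d: "0 < d" and L: "0 \<le> L" "L * d \<le> 1/8"
  shows "\<exists>a. a 0 = v \<and> (\<forall>t. \<bar>t\<bar> < d \<longrightarrow> (a has_vector_derivative M t (a t)) (at t))"
proof -
  define c where "c t = max (-d) (min d t)" for t
  have c: "c t \<in> {-d..d}" "0 \<in> {-d..d}" for t using d by (auto simp: c_def)
  have cM: "continuous_on {-d..d} (\<lambda>s. M s (f s))" if f: "continuous_on UNIV f" for f
  proof -
    \<comment> \<open>Continuity of \<open>M\<close> in time is given for fixed vectors only;
      expansion over a basis extends it to moving ones.\<close>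
    have "M s x = (\<Sum>b\<in>Basis. (x \<bullet> b) *\<^sub>R M s b)" for s x
    proof -
      have "M s x = M s (\<Sum>b\<in>Basis. (x \<bullet> b) *\<^sub>R b)" by (simp only: euclidean_representation)
      also have "\<dots> = (\<Sum>b\<in>Basis. M s ((x \<bullet> b) *\<^sub>R b))" by (rule linear_sum[OF lin])
      also have "\<dots> = (\<Sum>b\<in>Basis. (x \<bullet> b) *\<^sub>R M s b)" by (intro sum.cong refl linear_scale[OF lin])
      finally show ?thesis .
    qed
    then have "(\<lambda>s. M s (f s)) = (\<lambda>s. \<Sum>b\<in>Basis. (f s \<bullet> b) *\<^sub>R M s b)" by (rule ext)
    then show ?thesis
      by (simp only:) (intro continuous_intros cont continuous_on_subset[OF f], simp)
  qed
  define I where "I f t = integral {-d..t} (\<lambda>s. M s (f s))" for f t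
  have I: "(I f has_vector_derivative M t (f t)) (at t within {-d..d})" if "continuous_on UNIV f" "t \<in> {-d..d}" for f t
    unfolding I_def by (rule integral_has_vector_derivative[OF cM[OF that(1)] that(2)])
  have cI: "continuous_on {-d..d} (I f)" if "continuous_on UNIV f" for f
    unfolding continuous_on_eq_continuous_within
    by (intro ballI has_vector_derivative_continuous[OF I[OF that]])
  define Tf where "Tf f t = v + (I f (c t) - I f 0)" for f t
  have cT: "continuous_on UNIV (Tf f)" if "continuous_on UNIV f" for f
    unfolding Tf_def c_def
    by (intro continuous_intros continuous_on_compose2[OF cI[OF that]]) (use d in auto)
  have bT: "Tf f \<in> bcontfun" if f: "continuous_on UNIV f" for f
  proof -
    have "bounded (I f ` {-d..d})" by (intro compact_imp_bounded compact_continuous_image cI f) auto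
    then obtain K where "\<forall>y\<in>I f ` {-d..d}. norm y \<le> K" unfolding bounded_iff by (rule exE)
    then have K: "norm (I f t) \<le> K" if "t \<in> {-d..d}" for t using that by blast
    have "norm (Tf f t) \<le> norm v + (K + K)" for t
      unfolding Tf_def using K[OF c(1), of t] K[OF c(2)]
      by (intro order_trans[OF norm_triangle_ineq] add_left_mono order_trans[OF norm_triangle_ineq4] add_mono)
    then show ?thesis by (rule bcontfun_normI[OF cT[OF f]])
  qed
  define T where "T f = Bcontfun (Tf (apply_bcontfun f))" for f :: "real \<Rightarrow>\<^sub>C 'a"
  have T: "apply_bcontfun (T f) = Tf (apply_bcontfun f)" for f
    unfolding T_def by (rule Bcontfun_inverse) (rule bT, simp)
  have lip: "dist (T f) (T g) \<le> 1/2 * dist f g" for f g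
  proof (rule dist_bound)
    fix t
    have fg: "norm (apply_bcontfun f s - apply_bcontfun g s) \<le> dist f g" for s
      using dist_bounded[of f s g] by (simp add: dist_norm)
    have D: "norm (I (apply_bcontfun f) r - I (apply_bcontfun g) r) \<le> L * dist f g * (2 * d)" if r: "r \<in> {-d..d}" for r
    proof -
      have i: "(\<lambda>s. M s (apply_bcontfun h s)) integrable_on {-d..r}" for h
        using cM[of "apply_bcontfun h"] r by (intro integrable_continuous_interval) (auto intro: continuous_on_subset)
      have "I (apply_bcontfun f) r - I (apply_bcontfun g) r = integral {-d..r} (\<lambda>s. M s (apply_bcontfun f s) - M s (apply_bcontfun g s))"
        unfolding I_def by (rule Henstock_Kurzweil_Integration.integral_diff[OF i i, symmetric])
      also have "norm \<dots> \<le> L * dist f g * (r - - d)"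
      proof (rule integral_bound)
        show "continuous_on {-d..r} (\<lambda>s. M s (apply_bcontfun f s) - M s (apply_bcontfun g s))"
          using r cM[of "apply_bcontfun f"] cM[of "apply_bcontfun g"]
          by (intro continuous_on_diff) (auto intro: continuous_on_subset)
        fix s assume s: "s \<in> {-d..r}"
        have "norm (M s (apply_bcontfun f s) - M s (apply_bcontfun g s)) = norm (M s (apply_bcontfun f s - apply_bcontfun g s))"
          by (simp add: linear_diff[OF lin])
        also have "\<dots> \<le> L * norm (apply_bcontfun f s - apply_bcontfun g s)" using s r by (intro bd) auto
        also have "\<dots> \<le> L * dist f g" using fg L by (intro mult_left_mono) auto
        finally show "norm (M s (apply_bcontfun f s) - M s (apply_bcontfun g s)) \<le> L * dist f g" .
      qed (use r in auto)
      also have "\<dots> \<le> L * dist f g * (2 * d)" using r L by (intro mult_left_mono) auto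
      finally show ?thesis .
    qed
    have "dist (apply_bcontfun (T f) t) (apply_bcontfun (T g) t)
        = norm ((I (apply_bcontfun f) (c t) - I (apply_bcontfun g) (c t)) - (I (apply_bcontfun f) 0 - I (apply_bcontfun g) 0))"
      by (simp add: T Tf_def dist_norm algebra_simps)
    also have "\<dots> \<le> L * dist f g * (2 * d) + L * dist f g * (2 * d)"
      by (rule order_trans[OF norm_triangle_ineq4 add_mono[OF D[OF c(1)] D[OF c(2)]]])
    also have "\<dots> = 4 * (L * d) * dist f g" by (simp add: algebra_simps)
    also have "\<dots> \<le> 1/2 * dist f g" using L by (intro mult_right_mono) auto
    finally show "dist (apply_bcontfun (T f) t) (apply_bcontfun (T g) t) \<le> 1/2 * dist f g" .
  qed
  have "\<exists>!f. T f = f" by (rule banach_fix_type[of "1/2"]) (simp_all only: lip, simp_all)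
  then obtain f where f: "T f = f" by (rule ex1E)
  define a where "a = apply_bcontfun f"
  have a: "a t = v + (I a (c t) - I a 0)" for t
  proof -
    have "a = Tf a" by (simp only: a_def f flip: T)
    then have "a t = Tf a t" by (rule fun_cong)
    then show ?thesis by (simp only: Tf_def)
  qed
  have ca: "continuous_on UNIV a" by (simp add: a_def)
  have "(a has_vector_derivative M t (a t)) (at t)" if t: "\<bar>t\<bar> < d" for t
  proof -
    have td: "t \<in> {-d<..<d}" using t by auto
    have t': "t \<in> {-d..d}" using td by simp
    have sub: "{-d<..<d} \<subseteq> {-d..d}" by (rule greaterThanLessThan_subseteq_atLeastAtMost_iff[THEN iffD2]) simp
    have "(I a has_vector_derivative M t (a t)) (at t within {-d<..<d})"
      by (rule has_vector_derivative_within_subset[OF I[OF ca t'] sub])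
    moreover have "at t within {-d<..<d} = at t" by (rule at_within_open[OF td open_greaterThanLessThan])
    ultimately have "(I a has_vector_derivative M t (a t)) (at t)" by (simp only:)
    then have "((\<lambda>t. I a t + (v - I a 0)) has_vector_derivative M t (a t)) (at t)"
      by (rule has_vector_derivative_add_const[THEN iffD2])
    then show ?thesis
    proof (rule has_vector_derivative_transform_within_open[of _ _ _ "{-d<..<d}"])
      show "I a s + (v - I a 0) = a s" if "s \<in> {-d<..<d}" for s
      proof -
        have "c s = s" using that by (simp add: c_def)
        have "I a s + (v - I a 0) = v + (I a s - I a 0)" by (rule add.left_commute[of "I a s" v "- I a 0", unfolded add_uminus_conv_diff])
        also have "\<dots> = a s" by (rule a[of s, unfolded \<open>c s = s\<close>, symmetric])
        finally show ?thesis .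
      qed
    qed (use td in auto)
  qed
  moreover have "a 0 = v"
  proof -
    have "c 0 = 0" using d by (simp add: c_def)
    show ?thesis by (rule a[of 0, unfolded \<open>c 0 = 0\<close>, unfolded diff_self add_0_right])
  qed
  ultimately show ?thesis by (intro exI[of _ a] conjI allI impI)
qed

section \<open>Fields of class C^1 in space and time\<close>

locale C1_field =
  fixes T :: real and f :: "space \<Rightarrow> real \<Rightarrow> 'b::real_normed_vector"
  assumes C1: "Ck_on 1 (UNIV \<times> {-T<..<T}) (\<lambda>(x, t). f x t)"
begin

definition D :: "space \<Rightarrow> real \<Rightarrow> space \<times> real \<Rightarrow> 'b" where
  "D x t = frechet_derivative (\<lambda>(x, t). f x t) (at (x, t))"

lemma D_has_derivative: "\<bar>t\<bar> < T \<Longrightarrow> ((\<lambda>(x, t). f x t) has_derivative D x t) (at (x, t))"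
  using C1 unfolding D_def by (auto simp: abs_less_iff simp flip: frechet_derivative_works)

lemma D_linear: "\<bar>t\<bar> < T \<Longrightarrow> linear (D x t)"
  using D_has_derivative has_derivative_linear by blast

lemma D_continuous: "continuous_on (UNIV \<times> {-T<..<T}) (\<lambda>p. D (fst p) (snd p) v)"
  using C1 by (cases v) (simp add: D_def)

lemma D_split:
  assumes "\<bar>t\<bar> < T"
  shows "D x t (v, s) = D x t (v, 0) + s *\<^sub>R D x t (0, 1)"
  using linear_add[OF D_linear[where x = x, OF assms], of "(v, 0)" "s *\<^sub>R (0, 1)"]
    linear_scale[OF D_linear[where x = x, OF assms], of s "(0, 1)"]
  by simp

lemma D_path:
  assumes t: "\<bar>t\<bar> < T" and \<gamma>: "(\<gamma> has_vector_derivative \<gamma>') (at t)"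
  shows "((\<lambda>t. f (\<gamma> t) t) has_vector_derivative D (\<gamma> t) t (\<gamma>', 1)) (at t)"
proof -
  have "((\<lambda>s. (\<gamma> s, s)) has_derivative (\<lambda>h. (h *\<^sub>R \<gamma>', h))) (at t)"
    using \<gamma> by (auto simp: has_vector_derivative_def intro!: derivative_eq_intros)
  from has_derivative_compose[OF this D_has_derivative[OF t, of "\<gamma> t"]]
  have "((\<lambda>t. f (\<gamma> t) t) has_derivative (\<lambda>h. D (\<gamma> t) t (h *\<^sub>R \<gamma>', h))) (at t)" by simp
  moreover have "D (\<gamma> t) t (h *\<^sub>R \<gamma>', h) = h *\<^sub>R D (\<gamma> t) t (\<gamma>', 1)" for h
    using linear_scale[OF D_linear[where x = "\<gamma> t", OF t], of h "(\<gamma>', 1)"] by simp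
  ultimately show ?thesis by (simp add: has_vector_derivative_def)
qed

lemma D_space:
  assumes t: "\<bar>t\<bar> < T"
  shows "((\<lambda>y. f y t) has_derivative (\<lambda>v. D x t (v, 0))) (at x)"
proof -
  have "((\<lambda>y. (y, t)) has_derivative (\<lambda>v. (v, 0))) (at x)" by (auto intro!: derivative_eq_intros)
  from has_derivative_compose[OF this D_has_derivative[OF t, of x]] show ?thesis by simp
qed

lemma frechet_space: "\<bar>t\<bar> < T \<Longrightarrow> frechet_derivative (\<lambda>y. f y t) (at x) v = D x t (v, 0)"
  by (rule fun_cong[OF frechet_derivative_at[OF D_space, symmetric]])

lemma D_time: "\<bar>t\<bar> < T \<Longrightarrow> vector_derivative (\<lambda>\<tau>. f x \<tau>) (at t) = D x t (0, 1)"
  using D_path[of t "\<lambda>_. x" 0] by (intro vector_derivative_at) simp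

lemma D_basis:
  assumes "\<bar>t\<bar> < T"
  shows "D x t (v, 0) = (\<Sum>i\<in>UNIV. v $ i *\<^sub>R D x t (axis i 1, 0))"
proof -
  have lin: "linear (\<lambda>v. D x t (v, 0))" using has_derivative_linear[OF D_space[OF assms]] .
  have "v = (\<Sum>i\<in>UNIV. v $ i *\<^sub>R axis i 1)"
    by (simp add: vec_eq_iff axis_def if_distrib[of "\<lambda>x. _ * x"] cong: if_cong)
  then have "D x t (v, 0) = D x t (\<Sum>i\<in>UNIV. v $ i *\<^sub>R axis i 1, 0)" by simp
  also have "\<dots> = (\<Sum>i\<in>UNIV. D x t (v $ i *\<^sub>R axis i 1, 0))" using linear_sum[OF lin] by simp
  also have "\<dots> = (\<Sum>i\<in>UNIV. v $ i *\<^sub>R D x t (axis i 1, 0))" using linear_scale[OF lin] by simp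
  finally show ?thesis .
qed

text \<open>The spatial partial derivatives gathered into one continuous map, so that compactness
  bounds the derivative uniformly in position, time and direction.\<close>

definition \<Phi> :: "space \<times> real \<Rightarrow> 'b ^ 3" where
  "\<Phi> p = (\<chi> i. D (fst p) (snd p) (axis i 1, 0))"

lemma \<Phi>_continuous: "S < T \<Longrightarrow> continuous_on (cball 0 r \<times> {-S..S}) \<Phi>"
  unfolding \<Phi>_def by (intro continuous_on_vec_lambda continuous_on_subset[OF D_continuous]) auto

lemma D_diff_le:
  assumes "\<bar>t\<bar> < T" "\<bar>s\<bar> < T"
  shows "norm (D x t (v, 0) - D y s (v, 0)) \<le> 3 * norm (\<Phi> (x, t) - \<Phi> (y, s)) * norm v"
proof -
  have "D x t (v, 0) - D y s (v, 0) = (\<Sum>i\<in>UNIV. v $ i *\<^sub>R ((\<Phi> (x, t) - \<Phi> (y, s)) $ i))"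
    by (simp add: D_basis[OF assms(1), of x v] D_basis[OF assms(2), of y v] \<Phi>_def scaleR_diff_right sum_subtractf)
  also have "norm \<dots> \<le> (\<Sum>i\<in>(UNIV::3 set). norm v * norm (\<Phi> (x, t) - \<Phi> (y, s)))"
  proof (intro order_trans[OF norm_sum] sum_mono)
    fix i :: 3
    show "norm (v $ i *\<^sub>R ((\<Phi> (x, t) - \<Phi> (y, s)) $ i)) \<le> norm v * norm (\<Phi> (x, t) - \<Phi> (y, s))"
      unfolding norm_scaleR
      by (intro mult_mono component_le_norm_cart Finite_Cartesian_Product.norm_nth_le) auto
  qed
  finally show ?thesis by (simp add: mult.commute)
qed

lemma D_le:
  assumes "\<bar>t\<bar> < T"
  shows "norm (D x t (v, 0)) \<le> 3 * norm (\<Phi> (x, t)) * norm v"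
proof -
  have "D x t (v, 0) = (\<Sum>i\<in>UNIV. v $ i *\<^sub>R (\<Phi> (x, t) $ i))"
    by (simp add: D_basis[OF assms, of x v] \<Phi>_def)
  also have "norm \<dots> \<le> (\<Sum>i\<in>(UNIV::3 set). norm v * norm (\<Phi> (x, t)))"
  proof (intro order_trans[OF norm_sum] sum_mono)
    fix i :: 3
    show "norm (v $ i *\<^sub>R (\<Phi> (x, t) $ i)) \<le> norm v * norm (\<Phi> (x, t))"
      unfolding norm_scaleR
      by (intro mult_mono component_le_norm_cart Finite_Cartesian_Product.norm_nth_le) auto
  qed
  finally show ?thesis by (simp add: mult.commute)
qed

lemma D_bound:
  assumes S: "S < T"
  obtains L where "0 < L" "\<And>x t v. \<lbrakk>x \<in> cball 0 r; \<bar>t\<bar> \<le> S\<rbrakk> \<Longrightarrow> norm (D x t (v, 0)) \<le> L * norm v"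
proof -
  have "bounded (\<Phi> ` (cball 0 r \<times> {-S..S}))"
    by (intro compact_imp_bounded compact_continuous_image \<Phi>_continuous S compact_Times) auto
  then obtain K where K: "\<forall>y\<in>\<Phi> ` (cball 0 r \<times> {-S..S}). norm y \<le> K" unfolding bounded_iff by (rule exE)
  define L where "L = 3 * max K 1"
  have "norm (D x t (v, 0)) \<le> L * norm v" if "x \<in> cball 0 r" "\<bar>t\<bar> \<le> S" for x t v
  proof -
    have "norm (\<Phi> (x, t)) \<le> K" using K that by force
    then have "3 * norm (\<Phi> (x, t)) \<le> L" by (simp add: L_def)
    then show ?thesis
      using D_le[of t x v] that S by (meson le_less_trans mult_right_mono norm_ge_zero order_trans)
  qed
  moreover have "0 < L" by (simp add: L_def)
  ultimately show ?thesis using that by blast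
qed

lemma f_lipschitz:
  assumes L: "\<And>x v. x \<in> cball 0 r \<Longrightarrow> norm (D x t (v, 0)) \<le> L * norm v" and t: "\<bar>t\<bar> < T"
    and xy: "x \<in> cball 0 r" "y \<in> cball 0 r"
  shows "norm (f x t - f y t) \<le> L * norm (x - y)"
  by (rule differentiable_bound[of "cball 0 r" "\<lambda>y. f y t" "\<lambda>x v. D x t (v, 0)"])
    (use L xy in \<open>auto intro: onorm_le has_derivative_at_withinI[OF D_space[OF t]]\<close>)

text \<open>The mean value inequality for f minus its linearisation at x, with the derivative
  controlled by the uniform continuity of \<open>\<Phi>\<close>. Uniformity in t is what a remainder
  estimate along a whole trajectory requires.\<close>

lemma f_uniformly_differentiable:
  assumes S: "S < T" and e: "0 < e"
  obtains \<delta> where "0 < \<delta>" "\<And>x y t. \<lbrakk>x \<in> cball 0 r; y \<in> cball 0 r; \<bar>t\<bar> \<le> S; norm (y - x) < \<delta>\<rbrakk>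
    \<Longrightarrow> norm (f y t - f x t - D x t (y - x, 0)) \<le> e * norm (y - x)"
proof -
  have uc: "uniformly_continuous_on (cball 0 r \<times> {-S..S}) \<Phi>"
    by (intro compact_uniformly_continuous \<Phi>_continuous S compact_Times) auto
  have e3: "0 < e / 3" using e by simp
  obtain \<delta> where \<delta>: "\<delta> > 0" "\<And>p p'. \<lbrakk>p \<in> cball 0 r \<times> {-S..S}; p' \<in> cball 0 r \<times> {-S..S}; dist p' p < \<delta>\<rbrakk> \<Longrightarrow> dist (\<Phi> p') (\<Phi> p) < e / 3"
    by (rule uniformly_continuous_onE[OF uc e3]) (rule that)
  have "norm (f y t - f x t - D x t (y - x, 0)) \<le> e * norm (y - x)"
    if x: "x \<in> cball 0 r" and y: "y \<in> cball 0 r" and t: "\<bar>t\<bar> \<le> S" and yx: "norm (y - x) < \<delta>" for x y t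
  proof -
    have tT: "\<bar>t\<bar> < T" using t S by simp
    let ?C = "cball 0 r \<inter> ball x \<delta>"
    have lin: "linear (\<lambda>v. D x t (v, 0))" using has_derivative_linear[OF D_space[OF tT]] .
    have "norm ((f y t - D x t (y, 0)) - (f x t - D x t (x, 0))) \<le> e * norm (y - x)"
    proof (rule differentiable_bound[of ?C "\<lambda>z. f z t - D x t (z, 0)" "\<lambda>z v. D z t (v, 0) - D x t (v, 0)"])
      fix z assume z: "z \<in> ?C"
      have "((\<lambda>z. D x t (z, 0)) has_derivative (\<lambda>v. D x t (v, 0))) (at z)"
        by (rule linear_imp_has_derivative[OF lin])
      then show "((\<lambda>z. f z t - D x t (z, 0)) has_derivative (\<lambda>v. D z t (v, 0) - D x t (v, 0))) (at z within ?C)"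
        by (rule has_derivative_at_withinI[OF has_derivative_diff[OF D_space[OF tT]]])
      show "onorm (\<lambda>v. D z t (v, 0) - D x t (v, 0)) \<le> e"
      proof (rule onorm_le)
        fix v :: space
        have "dist (\<Phi> (z, t)) (\<Phi> (x, t)) < e / 3"
          using z x t by (intro \<delta>(2)) (auto simp: dist_Pair_Pair dist_commute)
        then have "3 * norm (\<Phi> (z, t) - \<Phi> (x, t)) * norm v \<le> e * norm v"
          by (intro mult_right_mono) (auto simp: dist_norm)
        then show "norm (D z t (v, 0) - D x t (v, 0)) \<le> e * norm v"
          using D_diff_le[OF tT tT, of z v x] by linarith
      qed
    qed (use x y yx \<delta> in \<open>auto simp: dist_norm norm_minus_commute convex_Int\<close>)
    moreover have "D x t (y - x, 0) = D x t (y, 0) - D x t (x, 0)" using linear_diff[OF lin] by simp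
    moreover have "f y t - f x t - (D x t (y, 0) - D x t (x, 0)) = (f y t - D x t (y, 0)) - (f x t - D x t (x, 0))" by simp
    ultimately show ?thesis by (simp only:)
  qed
  then show ?thesis by (rule that[OF \<delta>(1)])
qed

end

section \<open>The Lagrangian equation\<close>

lemma lborel_integrable_translate:
  fixes f :: "'a::euclidean_space \<Rightarrow> 'b::{banach, second_countable_topology}"
  assumes "integrable lborel f"
  shows "integrable lborel (\<lambda>y. f (y + h))"
proof -
  have "integrable (distr lborel borel ((+) h)) f" using assms by (simp add: lborel_distr_plus)
  then have "integrable lborel (\<lambda>y. f (h + y))" by (rule integrable_distr[rotated]) simp
  then show ?thesis by (simp only: add.commute)
qed

lemma sum_Basis_axis: "(\<Sum>i\<in>Basis. f i) = (\<Sum>i\<in>UNIV. f (axis i 1 :: space))"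
proof -
  have B: "(Basis :: space set) = range (\<lambda>i. axis i 1)" by (auto simp: Basis_vec_def)
  have "inj (\<lambda>i. axis i 1 :: space)" by (auto intro!: injI simp: axis_eq_axis)
  then show ?thesis unfolding B by (subst sum.reindex) auto
qed

text \<open>Jacobi's formula: columns evolving by a common linear system multiply the determinant's
  rate by the trace. Written over the six Leibniz products it is a polynomial identity; i numbers
  the columns, k the components.\<close>

lemma det3_has_derivative:
  fixes a :: "3 \<Rightarrow> 3 \<Rightarrow> real \<Rightarrow> real" and m :: "3 \<Rightarrow> 3 \<Rightarrow> real"
  assumes a: "\<And>i k. (a i k has_real_derivative a i 1 s * m k 1 + a i 2 s * m k 2 + a i 3 s * m k 3) (at s)"
  shows "((\<lambda>s. a 1 1 s * a 2 2 s * a 3 3 s + a 2 1 s * a 3 2 s * a 1 3 s + a 3 1 s * a 1 2 s * a 2 3 s - a 1 1 s * a 3 2 s * a 2 3 s - a 2 1 s * a 1 2 s * a 3 3 s - a 3 1 s * a 2 2 s * a 1 3 s) has_real_derivative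
    (m 1 1 + m 2 2 + m 3 3) * (a 1 1 s * a 2 2 s * a 3 3 s + a 2 1 s * a 3 2 s * a 1 3 s + a 3 1 s * a 1 2 s * a 2 3 s - a 1 1 s * a 3 2 s * a 2 3 s - a 2 1 s * a 1 2 s * a 3 3 s - a 3 1 s * a 2 2 s * a 1 3 s)) (at s)"
proof -
  have p: "((\<lambda>s. a i k s * a i' k' s * a i'' k'' s) has_real_derivative
      ((a i 1 s * m k 1 + a i 2 s * m k 2 + a i 3 s * m k 3) * a i' k' s + (a i' 1 s * m k' 1 + a i' 2 s * m k' 2 + a i' 3 s * m k' 3) * a i k s) * a i'' k'' s
      + (a i'' 1 s * m k'' 1 + a i'' 2 s * m k'' 2 + a i'' 3 s * m k'' 3) * (a i k s * a i' k' s)) (at s)" for i k i' k' i'' k''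
    by (rule DERIV_mult[OF DERIV_mult[OF a a] a])
  show ?thesis
    by (rule DERIV_cong, (rule DERIV_diff DERIV_add p)+) (simp add: algebra_simps)
qed

section \<open>The flow on the whole time interval\<close>

locale flow =
  fixes q T :: real and \<rho>0 :: "space \<Rightarrow> real" and u0 :: "space \<Rightarrow> space"
    and \<rho> :: "space \<Rightarrow> real \<Rightarrow> real" and u X :: "space \<Rightarrow> real \<Rightarrow> space"
  assumes sol: "euler_poisson_solution q T \<rho>0 u0 \<rho> u" and traj: "trajectory_map T u X"

sublocale flow \<subseteq> U: C1_field T u
  using sol by (simp add: C1_field_def euler_poisson_solution_def)

sublocale flow \<subseteq> D: C1_field T \<rho>
  using sol by (simp add: C1_field_def euler_poisson_solution_def)

context flow
begin

lemma T_pos: "0 < T"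
  using sol by (simp add: euler_poisson_solution_def)

lemma u_0: "u x 0 = u0 x" and \<rho>_0: "\<rho> x 0 = \<rho>0 x"
  using sol by (simp_all add: euler_poisson_solution_def)

lemma X_0: "X a 0 = a"
  using traj by (simp add: trajectory_map_def)

lemma X_deriv: "\<bar>t\<bar> < T \<Longrightarrow> (X a has_vector_derivative u (X a t) t) (at t)"
  using traj by (simp add: trajectory_map_def abs_less_iff)

lemma X_cont: "S < T \<Longrightarrow> continuous_on {-S..S} (X a)"
  by (intro continuous_at_imp_continuous_on ballI has_vector_derivative_continuous[OF X_deriv]) (auto simp: abs_less_iff)

lemma u_bound:
  assumes "S < T"
  obtains K where "0 < K" "\<And>x t. \<bar>t\<bar> \<le> S \<Longrightarrow> norm (u x t) \<le> K"
proof -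
  have "bounded {u x t |x t. t \<in> {-S..S}}" using sol assms by (simp add: euler_poisson_solution_def)
  then obtain K where K: "\<forall>y\<in>{u x t |x t. t \<in> {-S..S}}. norm y \<le> K" unfolding bounded_iff by (rule exE)
  have "norm (u x t) \<le> max K 1" if "\<bar>t\<bar> \<le> S" for x t
  proof -
    have "u x t \<in> {u x t |x t. t \<in> {-S..S}}"
      by (intro CollectI exI[of _ x] exI[of _ t] conjI refl) (use that in auto)
    then have "norm (u x t) \<le> K" using K by blast
    then show ?thesis by simp
  qed
  moreover have "0 < max K 1" by simp
  ultimately show ?thesis using that by blast
qed

definition force :: "space \<Rightarrow> real \<Rightarrow> space" where
  "force a t = grad_inv_laplacian (\<lambda>y. \<rho> y t) (X a t)"

lemma u_path:
  assumes t: "\<bar>t\<bar> < T"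
  shows "((\<lambda>t. u (X a t) t) has_vector_derivative q *\<^sub>R force a t) (at t)"
proof -
  have t': "t \<in> {-T<..<T}" using t by (auto simp: abs_less_iff)
  have "vector_derivative (\<lambda>\<tau>. u (X a t) \<tau>) (at t) + advect (\<lambda>y. u y t) (\<lambda>y. u y t) (X a t) = q *\<^sub>R force a t"
    using sol t' unfolding euler_poisson_solution_def force_def by blast
  then have "U.D (X a t) t (0, 1) + U.D (X a t) t (u (X a t) t, 0) = q *\<^sub>R force a t"
    by (simp only: U.D_time[OF t] advect_def U.frechet_space[OF t])
  then show ?thesis
    using U.D_path[OF t X_deriv[OF t, of a]] by (simp add: U.D_split[OF t, of _ "u (X a t) t" 1] add.commute)
qed

definition dv :: "space \<Rightarrow> real \<Rightarrow> real" where
  "dv x t = (\<Sum>i\<in>UNIV. U.D x t (axis i 1, 0) $ i)"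

lemma \<rho>_path:
  assumes t: "\<bar>t\<bar> < T"
  shows "((\<lambda>t. \<rho> (X a t) t) has_vector_derivative - \<rho> (X a t) t * dv (X a t) t) (at t)"
proof -
  have t': "t \<in> {-T<..<T}" using t by (auto simp: abs_less_iff)
  have "divergence (\<lambda>y. u y t) (X a t) = dv (X a t) t"
    unfolding divergence_def dv_def sum_Basis_axis U.frechet_space[OF t] by (simp add: inner_axis)
  moreover have "vector_derivative (\<lambda>\<tau>. \<rho> (X a t) \<tau>) (at t) + advect (\<lambda>y. u y t) (\<lambda>y. \<rho> y t) (X a t)
      = - \<rho> (X a t) t * divergence (\<lambda>y. u y t) (X a t)"
    using sol t' unfolding euler_poisson_solution_def by blast
  ultimately have "D.D (X a t) t (0, 1) + D.D (X a t) t (u (X a t) t, 0) = - \<rho> (X a t) t * dv (X a t) t"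
    by (simp only: D.D_time[OF t] advect_def D.frechet_space[OF t])
  then show ?thesis
    using D.D_path[OF t X_deriv[OF t, of a]] by (simp add: D.D_split[OF t, of _ "u (X a t) t" 1] add.commute)
qed

lemma dv_le:
  assumes "\<And>v. norm (U.D x t (v, 0)) \<le> L * norm v"
  shows "\<bar>dv x t\<bar> \<le> 3 * L"
proof -
  have "\<bar>dv x t\<bar> \<le> (\<Sum>i\<in>UNIV. \<bar>U.D x t (axis i 1, 0) $ i\<bar>)" unfolding dv_def by (rule sum_abs)
  also have "\<dots> \<le> (\<Sum>i\<in>(UNIV :: 3 set). L)"
    by (intro sum_mono order_trans[OF component_le_norm_cart]) (use assms[of "axis _ 1"] in simp)
  finally show ?thesis by simp
qed

lemma X_near:
  assumes K: "\<And>x t. \<bar>t\<bar> \<le> S \<Longrightarrow> norm (u x t) \<le> K" and S: "S < T" and t: "\<bar>t\<bar> \<le> S"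
  shows "norm (X a t - a) \<le> K * \<bar>t\<bar>"
  using vector_derivative_bound_0[of S "X a" "\<lambda>t. u (X a t) t" K t] X_deriv K S t by (simp add: X_0)

lemma X_in_cball:
  assumes K: "\<And>x t. \<bar>t\<bar> \<le> S \<Longrightarrow> norm (u x t) \<le> K" "0 < K" and S: "S < T" and t: "\<bar>t\<bar> \<le> S"
    and a: "a \<in> cball 0 r"
  shows "X a t \<in> cball 0 (r + K * S)"
proof -
  have "norm (X a t) \<le> norm a + norm (X a t - a)" using norm_triangle_ineq[of a "X a t - a"] by simp
  also have "\<dots> \<le> r + K * S"
  proof -
    have "norm a \<le> r" using a by simp
    with X_near[OF K(1) S t, of a] mult_left_mono[OF t less_imp_le[OF K(2)]] show ?thesis by linarith
  qed
  finally show ?thesis by simp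
qed

text \<open>Along a trajectory the density solves a homogeneous linear equation whose coefficient is
  bounded, because the trajectory stays in a compact set. With \<open>X_surj\<close> this confines
  the support of the density to the image of the initial support.\<close>

lemma \<rho>_vanishes:
  assumes "\<rho>0 a = 0" and t: "\<bar>t\<bar> < T"
  shows "\<rho> (X a t) t = 0"
proof -
  obtain K where K: "0 < K" "\<And>x s. \<bar>s\<bar> \<le> \<bar>t\<bar> \<Longrightarrow> norm (u x s) \<le> K" using u_bound[OF t] by blast
  obtain L where L: "0 < L" "\<And>x s v. \<lbrakk>x \<in> cball 0 (norm a + K * \<bar>t\<bar>); \<bar>s\<bar> \<le> \<bar>t\<bar>\<rbrakk> \<Longrightarrow> norm (U.D x s (v, 0)) \<le> L * norm v"
    using U.D_bound[OF t] by blast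
  have "norm (\<rho> (X a t) t) \<le> exp (3 * L * \<bar>t\<bar>) * norm (\<rho> (X a 0) 0)"
  proof (rule gronwall[of t "\<lambda>t. \<rho> (X a t) t"])
    fix s assume s: "\<bar>s\<bar> \<le> \<bar>t\<bar>"
    show "((\<lambda>t. \<rho> (X a t) t) has_vector_derivative - \<rho> (X a s) s * dv (X a s) s) (at s)"
      by (rule \<rho>_path) (use s t in simp)
    have "X a s \<in> cball 0 (norm a + K * \<bar>t\<bar>)" by (rule X_in_cball[OF K(2,1) t s]) simp_all
    then have "\<bar>dv (X a s) s\<bar> \<le> 3 * L" by (intro dv_le L(2) s)
    then have "\<bar>\<rho> (X a s) s\<bar> * \<bar>dv (X a s) s\<bar> \<le> \<bar>\<rho> (X a s) s\<bar> * (3 * L)" by (rule mult_left_mono) simp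
    then show "norm (- \<rho> (X a s) s * dv (X a s) s) \<le> 3 * L * norm (\<rho> (X a s) s)"
      by (simp add: abs_mult mult.commute)
  qed
  then show ?thesis using assms(1) by (simp add: X_0 \<rho>_0)
qed

text \<open>The displacement is bounded and continuous, so Brouwer's theorem replaces solving the
  equation backwards in time.\<close>

lemma X_surj:
  assumes t: "\<bar>t\<bar> < T"
  shows "\<exists>a. X a t = y"
proof -
  obtain K where K: "0 < K" "\<And>x s. \<bar>s\<bar> \<le> \<bar>t\<bar> \<Longrightarrow> norm (u x s) \<le> K" using u_bound[OF t] by blast
  \<comment> \<open>The radius exceeds every displacement, so
    \<open>\<lambda>a. y - (X a t - a)\<close> maps the ball about y into itself; its fixed points
    are the preimages of y. The 1 keeps the radius positive at t = 0.\<close>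
  define e where "e = K * \<bar>t\<bar> + 1"
  have e: "0 < e" using K by (simp add: e_def add_nonneg_pos)
  define r where "r = norm y + e"
  obtain L where L: "0 < L" "\<And>x s v. \<lbrakk>x \<in> cball 0 (r + K * \<bar>t\<bar>); \<bar>s\<bar> \<le> \<bar>t\<bar>\<rbrakk> \<Longrightarrow> norm (U.D x s (v, 0)) \<le> L * norm v"
    using U.D_bound[OF t] by blast
  have sub: "a \<in> cball 0 r" if "a \<in> cball y e" for a
    using that norm_triangle_ineq[of y "a - y"] by (simp add: r_def dist_norm norm_minus_commute)
  have lip: "norm (X a t - X b t) \<le> exp (L * \<bar>t\<bar>) * norm (a - b)" if ab: "a \<in> cball y e" "b \<in> cball y e" for a b
  proof -
    have "norm (X a t - X b t) \<le> exp (L * \<bar>t\<bar>) * norm (X a 0 - X b 0)"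
    proof (rule gronwall[of t "\<lambda>t. X a t - X b t"])
      fix s assume s: "\<bar>s\<bar> \<le> \<bar>t\<bar>"
      then have sT: "\<bar>s\<bar> < T" using t by simp
      show "((\<lambda>t. X a t - X b t) has_vector_derivative u (X a s) s - u (X b s) s) (at s)"
        by (intro has_vector_derivative_diff X_deriv sT)
      show "norm (u (X a s) s - u (X b s) s) \<le> L * norm (X a s - X b s)"
        by (rule U.f_lipschitz[OF L(2) sT X_in_cball[OF K(2,1) t s] X_in_cball[OF K(2,1) t s]])
          (use s sub ab in simp_all)
    qed
    then show ?thesis by (simp add: X_0)
  qed
  have c: "continuous_on (cball y e) (\<lambda>a. X a t)"
    by (rule lipschitz_on_continuous_on[of "exp (L * \<bar>t\<bar>)"], rule lipschitz_onI)
      (use lip in \<open>auto simp: dist_norm\<close>)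
  have "(\<lambda>a. y - (X a t - a)) \<in> cball y e \<rightarrow> cball y e"
  proof
    fix a assume "a \<in> cball y e"
    have "norm (X a t - a) \<le> K * \<bar>t\<bar>" by (rule X_near[OF K(2) t]) simp_all
    then show "y - (X a t - a) \<in> cball y e" by (simp add: dist_norm e_def)
  qed
  from this obtain a where "a \<in> cball y e" "y - (X a t - a) = a"
  proof (rule brouwer_ball[OF e, rotated])
    show "continuous_on (cball y e) (\<lambda>a. y - (X a t - a))" by (intro continuous_intros c)
  qed (rule that)
  then have "X a t = y" by (simp add: algebra_simps)
  then show ?thesis by blast
qed

end

text \<open>The margin 1 beyond r leaves room for neighbouring labels in difference quotients, and
  \<open>K * S\<close> bounds how far particles travel. \<open>L * d \<le> 1/16\<close> yields the
  displacement constant 1/8 demanded by \<open>lip_on\<close>; \<open>K * d \<le> 1\<close> yields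
  the unit bound that starts the comparison with the iterates.\<close>

locale local_flow = flow +
  fixes r S K L d :: real
  assumes r: "0 < r" and S: "S < T" and K: "0 < K" "\<And>x t. \<bar>t\<bar> \<le> S \<Longrightarrow> norm (u x t) \<le> K"
    and L: "0 < L" "\<And>x t v. \<lbrakk>x \<in> cball 0 (r + 1 + K * S); \<bar>t\<bar> \<le> S\<rbrakk> \<Longrightarrow> norm (U.D x t (v, 0)) \<le> L * norm v"
    and d: "0 < d" "d \<le> S" "L * d \<le> 1/16" "K * d \<le> 1"
begin

lemma time: "\<bar>t\<bar> \<le> d \<Longrightarrow> \<bar>t\<bar> \<le> S" "\<bar>t\<bar> \<le> d \<Longrightarrow> \<bar>t\<bar> < T"
  using d S by auto

lemma X_in: "a \<in> cball 0 (r + 1) \<Longrightarrow> \<bar>t\<bar> \<le> d \<Longrightarrow> X a t \<in> cball 0 (r + 1 + K * S)"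
  by (rule X_in_cball[OF K(2,1) S time(1)])

lemma DU_le: "a \<in> cball 0 (r + 1) \<Longrightarrow> \<bar>t\<bar> \<le> d \<Longrightarrow> norm (U.D (X a t) t (v, 0)) \<le> L * norm v"
  by (rule L(2)[OF X_in time(1)])

lemma X_lip:
  assumes a: "a \<in> cball 0 (r + 1)" and b: "b \<in> cball 0 (r + 1)" and t: "\<bar>t\<bar> \<le> d"
  shows "norm ((X a t - X b t) - (a - b)) \<le> norm (a - b) / 8" "norm (X a t - X b t) \<le> 2 * norm (a - b)"
proof -
  have w: "((\<lambda>t. X a t - X b t) has_vector_derivative u (X a s) s - u (X b s) s) (at s)" if "\<bar>s\<bar> \<le> d" for s
    by (intro has_vector_derivative_diff X_deriv time that)
  have b': "norm (u (X a s) s - u (X b s) s) \<le> L * norm (X a s - X b s) + 0" if s: "\<bar>s\<bar> \<le> d" for s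
    using U.f_lipschitz[OF L(2)[OF _ time(1)[OF s]] time(2)[OF s] X_in[OF a s] X_in[OF b s]] by simp
  have Ld: "L * d \<le> 1/2" using d by simp
  have "norm (X a t - X b t) \<le> 2 * (norm (X a 0 - X b 0) + d * 0)"
    by (rule short_time_gronwall(1)[OF w b' less_imp_le[OF L(1)] Ld order_refl t])
  then show "norm (X a t - X b t) \<le> 2 * norm (a - b)" by (simp add: X_0)
  have "norm ((X a t - X b t) - (X a 0 - X b 0)) \<le> d * (2 * L * (norm (X a 0 - X b 0) + d * 0) + 0)"
    by (rule short_time_gronwall(2)[OF w b' less_imp_le[OF L(1)] Ld order_refl t])
  then have "norm ((X a t - X b t) - (a - b)) \<le> 2 * (L * d) * norm (a - b)"
    by (simp add: X_0 ac_simps)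
  also have "\<dots> \<le> 2 * (1/16) * norm (a - b)" using d by (intro mult_right_mono mult_left_mono) auto
  finally show "norm ((X a t - X b t) - (a - b)) \<le> norm (a - b) / 8" by simp
qed

lemma X_inj: "\<bar>t\<bar> \<le> d \<Longrightarrow> inj_on (\<lambda>a. X a t) (cball 0 r)"
proof (rule inj_onI)
  fix a b assume t: "\<bar>t\<bar> \<le> d" and ab: "a \<in> cball 0 r" "b \<in> cball 0 r" "X a t = X b t"
  then have "norm (a - b) \<le> norm (a - b) / 8" using X_lip(1)[of a b t] by (simp add: norm_minus_commute)
  then show "a = b" by simp
qed

text \<open>The columns of the Jacobian matrix of the flow, constructed as solutions of the
  variational equation before the flow is known to be differentiable.\<close>

lemma columns_exist:
  assumes a: "a \<in> cball 0 r"
  shows "\<exists>A :: 3 \<Rightarrow> real \<Rightarrow> space. \<forall>i. A i 0 = axis i 1 \<and>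
    (\<forall>t. \<bar>t\<bar> < d \<longrightarrow> (A i has_vector_derivative U.D (X a t) t (A i t, 0)) (at t))"
proof (rule choice, rule allI)
  fix i :: 3
  have a': "a \<in> cball 0 (r + 1)" using a by simp
  define M where "M s v = (if \<bar>s\<bar> \<le> d then U.D (X a s) s (v, 0) else 0)" for s v
  have "\<exists>A. A 0 = axis i 1 \<and> (\<forall>t. \<bar>t\<bar> < d \<longrightarrow> (A has_vector_derivative M t (A t)) (at t))"
  proof (rule linear_ode_exists)
    show "linear (M s)" for s
    proof (cases "\<bar>s\<bar> \<le> d")
      case True
      then show ?thesis
        unfolding M_def using has_derivative_linear[OF U.D_space[OF time(2)[OF True]]] by simp
    next
      case False
      then show ?thesis unfolding M_def by (simp add: module_hom_zero linear_zero)
    qed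
    show "continuous_on {-d..d} (\<lambda>s. M s v)" for v
    proof -
      have "continuous_on {-d..d} (\<lambda>s. U.D (fst (X a s, s)) (snd (X a s, s)) (v, 0))"
        by (rule continuous_on_compose2[OF U.D_continuous])
          (use X_cont[of d a] d S time(2) in \<open>auto intro!: continuous_intros simp: abs_le_iff abs_less_iff\<close>)
      then show ?thesis by (rule continuous_on_eq) (auto simp: M_def abs_le_iff)
    qed
    show "norm (M s v) \<le> L * norm v" if "\<bar>s\<bar> \<le> d" for s v
      using DU_le[OF a' that] that by (simp add: M_def)
  qed (use d L in auto)
  then obtain A where A: "A 0 = axis i 1 \<and> (\<forall>t. \<bar>t\<bar> < d \<longrightarrow> (A has_vector_derivative M t (A t)) (at t))" ..
  have "(A has_vector_derivative U.D (X a t) t (A t, 0)) (at t)" if "\<bar>t\<bar> < d" for t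
  proof -
    have "M t (A t) = U.D (X a t) t (A t, 0)" using that by (simp add: M_def)
    then show ?thesis using A that by metis
  qed
  then show "\<exists>y. y 0 = axis i 1 \<and> (\<forall>t. \<bar>t\<bar> < d \<longrightarrow> (y has_vector_derivative U.D (X a t) t (y t, 0)) (at t))"
    using A by (intro exI[of _ A] conjI allI impI) auto
qed

text \<open>The linearisation error satisfies the variational equation up to a source of size
  \<epsilon> * 2 |v|, and starts at zero; the short-time Gronwall bound keeps it small relative to
  |v|.\<close>

lemma X_frechet:
  assumes a: "a \<in> cball 0 r" and t: "\<bar>t\<bar> < d"
    and A: "\<And>i. A i 0 = axis i 1" "\<And>i t. \<bar>t\<bar> < d \<Longrightarrow> (A i has_vector_derivative U.D (X a t) t (A i t, 0)) (at t)"
  shows "((\<lambda>b. X b t) has_derivative (\<lambda>v. \<Sum>i\<in>UNIV. v $ i *\<^sub>R A i t)) (at a)"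
  unfolding has_derivative_at_alt
proof (intro conjI allI impI)
  show "bounded_linear (\<lambda>v::space. \<Sum>i\<in>UNIV. v $ i *\<^sub>R A i t)"
    by (intro bounded_linear_sum bounded_linear_compose[OF bounded_linear_scaleR_left bounded_linear_vec_nth])
  fix e :: real assume e: "0 < e"
  \<comment> \<open>Gronwall contributes a factor 2 and the distance of neighbouring trajectories
    another, whence the 4.\<close>
  define \<epsilon> where "\<epsilon> = e / (4 * d)"
  have \<epsilon>: "0 < \<epsilon>" "4 * d * \<epsilon> = e" using e d by (simp_all add: \<epsilon>_def)
  obtain \<delta> where \<delta>: "0 < \<delta>" "\<And>x y t. \<lbrakk>x \<in> cball 0 (r + 1 + K * S); y \<in> cball 0 (r + 1 + K * S); \<bar>t\<bar> \<le> S; norm (y - x) < \<delta>\<rbrakk>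
      \<Longrightarrow> norm (u y t - u x t - U.D x t (y - x, 0)) \<le> \<epsilon> * norm (y - x)"
    by (rule U.f_uniformly_differentiable[OF S \<epsilon>(1), of "r + 1 + K * S"]) (rule that)
  have a1: "a \<in> cball 0 (r + 1)" using a by simp
  have "norm (X b t - X a t - (\<Sum>i\<in>UNIV. (b - a) $ i *\<^sub>R A i t)) \<le> e * norm (b - a)"
    if b: "norm (b - a) < min 1 (\<delta> / 2)" for b
  proof -
    define v where "v = b - a"
    have b1: "b \<in> cball 0 (r + 1)"
      using norm_triangle_ineq[of a "b - a"] b a by simp
    define w where "w s = X b s - X a s - (\<Sum>i\<in>UNIV. v $ i *\<^sub>R A i s)" for s
    define w' where "w' s = u (X b s) s - u (X a s) s - (\<Sum>i\<in>UNIV. v $ i *\<^sub>R U.D (X a s) s (A i s, 0))" for s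
    have wd: "(w has_vector_derivative w' s) (at s)" if s: "\<bar>s\<bar> \<le> \<bar>t\<bar>" for s
    proof -
      have s1: "\<bar>s\<bar> < d" using s t by simp
      have "((\<lambda>s. v $ i *\<^sub>R A i s) has_vector_derivative v $ i *\<^sub>R U.D (X a s) s (A i s, 0)) (at s)" for i
        using bounded_linear.has_vector_derivative[OF bounded_linear_scaleR_right A(2)[OF s1]] .
      then show ?thesis
        unfolding w_def w'_def
        by (intro has_vector_derivative_diff has_vector_derivative_sum X_deriv time(2) less_imp_le[OF s1])
    qed
    have wb: "norm (w' s) \<le> L * norm (w s) + \<epsilon> * (2 * norm v)" if s: "\<bar>s\<bar> \<le> \<bar>t\<bar>" for s
    proof -
      have s1: "\<bar>s\<bar> \<le> d" using s t by simp
      have lin: "linear (\<lambda>v. U.D (X a s) s (v, 0))" using has_derivative_linear[OF U.D_space[OF time(2)[OF s1]]] .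
      have X2: "norm (X b s - X a s) \<le> 2 * norm v" using X_lip(2)[OF b1 a1 s1] by (simp add: v_def)
      have "(\<Sum>i\<in>UNIV. v $ i *\<^sub>R U.D (X a s) s (A i s, 0)) = U.D (X a s) s (\<Sum>i\<in>UNIV. v $ i *\<^sub>R A i s, 0)"
        by (simp add: linear_sum[OF lin] linear_scale[OF lin])
      moreover have "U.D (X a s) s (w s, 0) = U.D (X a s) s (X b s - X a s, 0) - U.D (X a s) s (\<Sum>i\<in>UNIV. v $ i *\<^sub>R A i s, 0)"
        unfolding w_def by (rule linear_diff[OF lin])
      ultimately have "w' s = U.D (X a s) s (w s, 0) + (u (X b s) s - u (X a s) s - U.D (X a s) s (X b s - X a s, 0))"
        by (simp add: w'_def)
      moreover have "norm (U.D (X a s) s (w s, 0)) \<le> L * norm (w s)" by (rule DU_le[OF a1 s1])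
      moreover have "norm (u (X b s) s - u (X a s) s - U.D (X a s) s (X b s - X a s, 0)) \<le> \<epsilon> * (2 * norm v)"
      proof -
        have "norm (X b s - X a s) < \<delta>" using X2 b by (simp add: v_def)
        from \<delta>(2)[OF X_in[OF a1 s1] X_in[OF b1 s1] time(1)[OF s1] this]
        have "norm (u (X b s) s - u (X a s) s - U.D (X a s) s (X b s - X a s, 0)) \<le> \<epsilon> * norm (X b s - X a s)" .
        also have "\<dots> \<le> \<epsilon> * (2 * norm v)" using X2 \<epsilon> by (intro mult_left_mono) auto
        finally show ?thesis .
      qed
      ultimately show ?thesis by (simp only:) (rule norm_triangle_le, rule add_mono)
    qed
    have w0: "w 0 = 0"
    proof -
      have "v = (\<Sum>i\<in>UNIV. v $ i *\<^sub>R axis i 1)"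
        by (simp add: vec_eq_iff axis_def if_distrib[of "\<lambda>x. _ * x"] cong: if_cong)
      then show ?thesis by (simp only: w_def X_0 A(1) v_def[symmetric] diff_self)
    qed
    have "L * \<bar>t\<bar> \<le> L * d" using t L by (intro mult_left_mono) auto
    then have Lt: "L * \<bar>t\<bar> \<le> 1/2" using d by linarith
    have e0: "0 \<le> \<epsilon> * (2 * norm v)" using \<epsilon> by simp
    have "norm (w t) \<le> 2 * (norm (w 0) + \<bar>t\<bar> * (\<epsilon> * (2 * norm v)))"
      by (rule short_time_gronwall(1)[OF wd wb less_imp_le[OF L(1)] Lt e0 order_refl])
    then have "norm (w t) \<le> 2 * (\<bar>t\<bar> * (\<epsilon> * (2 * norm v)))" by (simp add: w0)
    also have "\<dots> \<le> 2 * (d * (\<epsilon> * (2 * norm v)))" using t \<epsilon> by (intro mult_left_mono mult_right_mono) auto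
    also have "\<dots> = (4 * d * \<epsilon>) * norm v" by simp
    finally show ?thesis using \<epsilon>(2) by (simp add: w_def v_def)
  qed
  then show "\<exists>da>0. \<forall>y. norm (y - a) < da \<longrightarrow> norm (X y t - X a t - (\<Sum>i\<in>UNIV. (y - a) $ i *\<^sub>R A i t)) \<le> e * norm (y - a)"
    using \<delta>(1) by (intro exI[of _ "min 1 (\<delta> / 2)"]) auto
qed

text \<open>Both factors satisfy linear equations along the trajectory, with opposite coefficients
  \<open>\<mp> div u\<close>.\<close>

lemma liouville:
  assumes a: "a \<in> cball 0 r" and t: "\<bar>t\<bar> < d"
    and A: "\<And>i. A i 0 = axis i 1" "\<And>i t. \<bar>t\<bar> < d \<Longrightarrow> (A i has_vector_derivative U.D (X a t) t (A i t, 0)) (at t)"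
  shows "\<rho> (X a t) t * \<bar>det (matrix (\<lambda>v. \<Sum>i\<in>UNIV. v $ i *\<^sub>R A i t))\<bar> = \<rho>0 a"
proof -
  define J where "J t = det (\<chi> k i. A i t $ k)" for t
  have a1: "a \<in> cball 0 (r + 1)" using a by simp
  have Jd: "(J has_real_derivative dv (X a s) s * J s) (at s)" if s: "\<bar>s\<bar> < d" for s
  proof -
    define m where "m i k = U.D (X a s) s (axis k 1, 0) $ i" for i k
    have Dk: "U.D (X a s) s (v, 0) $ k = v $ 1 * m k 1 + v $ 2 * m k 2 + v $ 3 * m k 3" for v k
    proof -
      have "U.D (X a s) s (v, 0) $ k = (\<Sum>i\<in>UNIV. v $ i *\<^sub>R U.D (X a s) s (axis i 1, 0)) $ k"
        by (simp only: U.D_basis[OF time(2)[OF less_imp_le[OF s]], of "X a s" v])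
      also have "\<dots> = v $ 1 * m k 1 + v $ 2 * m k 2 + v $ 3 * m k 3"
        unfolding sum_3 m_def by simp
      finally show ?thesis .
    qed
    have "((\<lambda>s. A i s $ k) has_vector_derivative U.D (X a s) s (A i s, 0) $ k) (at s)" for i k
      using bounded_linear.has_vector_derivative[OF bounded_linear_vec_nth A(2)[OF s]] .
    then have c: "((\<lambda>s. A i s $ k) has_real_derivative A i s $ 1 * m k 1 + A i s $ 2 * m k 2 + A i s $ 3 * m k 3) (at s)" for i k
      by (simp add: Dk has_real_derivative_iff_has_vector_derivative)
    have J3: "J = (\<lambda>s. A 1 s $ 1 * A 2 s $ 2 * A 3 s $ 3 + A 2 s $ 1 * A 3 s $ 2 * A 1 s $ 3 + A 3 s $ 1 * A 1 s $ 2 * A 2 s $ 3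
        - A 1 s $ 1 * A 3 s $ 2 * A 2 s $ 3 - A 2 s $ 1 * A 1 s $ 2 * A 3 s $ 3 - A 3 s $ 1 * A 2 s $ 2 * A 1 s $ 3)"
      by (rule ext) (simp only: J_def det_3 vec_lambda_beta)
    have tr: "dv (X a s) s = m 1 1 + m 2 2 + m 3 3" by (simp add: dv_def sum_3 m_def)
    show ?thesis
      unfolding tr J3
      by (rule det3_has_derivative[where a = "\<lambda>i k s. A i s $ k" and m = m]) (rule c)
  qed
  have J0: "J 0 = 1"
  proof -
    have "(\<chi> k i. A i 0 $ k) = (mat 1 :: real ^ 3 ^ 3)" by (simp add: A(1) vec_eq_iff mat_def axis_def)
    then show ?thesis by (simp add: J_def)
  qed
  have Jpos: "0 < J t"
  proof -
    have w: "(J has_vector_derivative dv (X a s) s * J s) (at s)" if "\<bar>s\<bar> \<le> \<bar>t\<bar>" for s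
      using Jd[of s] that t by (simp add: has_real_derivative_iff_has_vector_derivative)
    have b: "norm (dv (X a s) s * J s) \<le> 3 * L * norm (J s) + 0" if "\<bar>s\<bar> \<le> \<bar>t\<bar>" for s
      using dv_le[of "X a s" s L] DU_le[OF a1, of s] that t by (auto simp: abs_mult intro!: mult_right_mono)
    have "L * \<bar>t\<bar> \<le> L * d" using t L by (intro mult_left_mono) auto
    then have Lt: "L * \<bar>t\<bar> \<le> 1/16" using d by linarith
    have "norm (J t - J 0) \<le> \<bar>t\<bar> * (2 * (3 * L) * (norm (J 0) + \<bar>t\<bar> * 0) + 0)"
      by (rule short_time_gronwall(2)[OF w b]) (use L Lt in auto)
    then have "\<bar>J t - 1\<bar> \<le> 6 * (L * \<bar>t\<bar>)" by (simp add: J0 ac_simps)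
    then show ?thesis using Lt by linarith
  qed
  have "\<bar>\<rho> (X a t) t * J t - \<rho> (X a 0) 0 * J 0\<bar> \<le> 0 * \<bar>t\<bar>"
  proof (rule vector_derivative_bound_0[of "\<bar>t\<bar>" "\<lambda>t. \<rho> (X a t) t * J t" "\<lambda>_. 0" 0 t, unfolded real_norm_def])
    fix s assume s: "\<bar>s\<bar> \<le> \<bar>t\<bar>"
    then have s1: "\<bar>s\<bar> < d" using t by simp
    have "((\<lambda>t. \<rho> (X a t) t) has_real_derivative - \<rho> (X a s) s * dv (X a s) s) (at s)"
      using \<rho>_path[OF time(2)[OF less_imp_le[OF s1]]] by (simp add: has_real_derivative_iff_has_vector_derivative)
    from DERIV_mult[OF this Jd[OF s1]]
    have "((\<lambda>t. \<rho> (X a t) t * J t) has_real_derivative 0) (at s)" by (simp add: algebra_simps)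
    then show "((\<lambda>t. \<rho> (X a t) t * J t) has_vector_derivative 0) (at s)"
      by (simp add: has_real_derivative_iff_has_vector_derivative)
  qed auto
  then have "\<rho> (X a t) t * J t = \<rho>0 a" by (simp add: J0 X_0 \<rho>_0)
  moreover have "matrix (\<lambda>v. \<Sum>i\<in>UNIV. v $ i *\<^sub>R A i t) = (\<chi> k i. A i t $ k)"
    by (simp add: matrix_def vec_eq_iff axis_def if_distrib[of "\<lambda>x. x * _"] cong: if_cong)
  ultimately show ?thesis using Jpos by (simp add: J_def)
qed

text \<open>By \<open>liouville\<close> the Jacobian converts the density at time t into the initial
  one. The change of variables covers only the image of the ball; off that image the transported
  density is zero.\<close>

lemma pull_back_integral:
  fixes h :: "space \<Rightarrow> space"
  assumes t: "\<bar>t\<bar> < d" and supp: "\<And>y. \<rho>0 y \<noteq> 0 \<Longrightarrow> y \<in> cball 0 r"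
    and int: "integrable lborel (\<lambda>\<beta>. \<rho>0 \<beta> *\<^sub>R h (X \<beta> t))"
  shows "(LINT y|lebesgue. \<rho> y t *\<^sub>R h y) = (LINT \<beta>|lborel. \<rho>0 \<beta> *\<^sub>R h (X \<beta> t))"
proof -
  let ?S = "cball 0 r :: space set"
  define g where "g \<beta> = X \<beta> t" for \<beta>
  define k where "k \<beta> = \<rho>0 \<beta> *\<^sub>R h (X \<beta> t)" for \<beta>
  have "\<exists>A. \<forall>a\<in>?S. \<forall>i. A a i 0 = axis i 1 \<and>
      (\<forall>t. \<bar>t\<bar> < d \<longrightarrow> (A a i has_vector_derivative U.D (X a t) t (A a i t, 0)) (at t))"
    by (rule bchoice, rule ballI, rule columns_exist)
  then obtain A where A: "\<forall>a\<in>?S. \<forall>i. A a i 0 = axis i 1 \<and>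
      (\<forall>t. \<bar>t\<bar> < d \<longrightarrow> (A a i has_vector_derivative U.D (X a t) t (A a i t, 0)) (at t))" ..
  have A1: "A a i 0 = axis i 1" if "a \<in> ?S" for a i
    by (rule bspec[OF A that, THEN spec, THEN conjunct1])
  have A2: "(A a i has_vector_derivative U.D (X a t) t (A a i t, 0)) (at t)" if "a \<in> ?S" "\<bar>t\<bar> < d" for a i t
    by (rule bspec[OF A that(1), THEN spec, THEN conjunct2, THEN spec, THEN mp, OF that(2)])
  define g' where "g' a = (\<lambda>v. \<Sum>i\<in>UNIV. v $ i *\<^sub>R A a i t)" for a
  have der: "(g has_derivative g' a) (at a within ?S)" if "a \<in> ?S" for a
    unfolding g_def g'_def
    by (rule has_derivative_at_withinI[OF X_frechet[OF that t A1[OF that] A2[OF that]]])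
  have jac: "\<bar>det (matrix (g' a))\<bar> *\<^sub>R (\<rho> (g a) t *\<^sub>R h (g a)) = k a" if "a \<in> ?S" for a
  proof -
    have "\<rho> (X a t) t * \<bar>det (matrix (\<lambda>v. \<Sum>i\<in>UNIV. v $ i *\<^sub>R A a i t))\<bar> = \<rho>0 a"
      by (rule liouville[OF that t A1[OF that] A2[OF that]])
    then show ?thesis by (simp add: g_def g'_def k_def mult.commute)
  qed
  have inj: "inj_on g ?S" using X_inj[of t] t by (simp add: g_def[abs_def])
  have km: "k \<in> borel_measurable lborel" using borel_measurable_integrable[OF int] unfolding k_def .
  have "integrable lborel k" using int by (simp add: k_def[abs_def])
  then have kint: "integrable lebesgue k" using km by (simp add: integrable_completion)
  have k0: "(\<lambda>\<beta>. indicator ?S \<beta> *\<^sub>R k \<beta>) = k"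
  proof
    fix \<beta> show "indicator ?S \<beta> *\<^sub>R k \<beta> = k \<beta>"
      using supp[of \<beta>] by (cases "\<beta> \<in> ?S") (auto simp: k_def)
  qed
  have kS: "k absolutely_integrable_on ?S" unfolding set_integrable_def k0 by (rule kint)
  define f where "f y = \<rho> y t *\<^sub>R h y" for y
  let ?F = "\<lambda>a. \<bar>det (matrix (g' a))\<bar> *\<^sub>R f (g a)"
  have F: "?F a = k a" if "a \<in> ?S" for a using jac[OF that] by (simp only: f_def)
  have Fk: "(\<lambda>a. indicator ?S a *\<^sub>R ?F a) = k"
  proof
    fix a show "indicator ?S a *\<^sub>R ?F a = k a"
      using F[of a] fun_cong[OF k0, of a] by (cases "a \<in> ?S") auto
  qed
  have "?F absolutely_integrable_on ?S \<and> integral ?S ?F = integral ?S k"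
  proof
    show "?F absolutely_integrable_on ?S" unfolding set_integrable_def Fk by (rule kint)
    show "integral ?S ?F = integral ?S k" by (rule Henstock_Kurzweil_Integration.integral_cong) (rule F)
  qed
  then have fg: "f absolutely_integrable_on g ` ?S" "integral (g ` ?S) f = integral ?S k"
    using has_absolute_integral_change_of_variables[of ?S g g' f "integral ?S k", OF _ der inj] by simp_all
  \<comment> \<open>A point outside the image still lies on some trajectory by
    \<open>X_surj\<close>; its label is outside the initial support, so
    \<open>\<rho>_vanishes\<close> applies.\<close>
  have f0: "(\<lambda>y. indicator (g ` ?S) y *\<^sub>R f y) = f"
  proof
    fix y show "indicator (g ` ?S) y *\<^sub>R f y = f y"
    proof (cases "y \<in> g ` ?S")
      case False
      obtain a where a: "X a t = y" using X_surj[OF time(2)[OF less_imp_le[OF t]], of y] by blast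
      then have "a \<notin> ?S" using False by (auto simp: g_def)
      then have "\<rho>0 a = 0" using supp by blast
      then have "\<rho> y t = 0" using \<rho>_vanishes[OF _ time(2)[OF less_imp_le[OF t]], of a] a by simp
      then show ?thesis by (simp add: f_def)
    qed simp
  qed
  have "(LINT y|lebesgue. f y) = (LINT y:g ` ?S|lebesgue. f y)"
    unfolding set_lebesgue_integral_def f0 ..
  also have "\<dots> = integral (g ` ?S) f" by (rule set_lebesgue_integral_eq_integral(2)[OF fg(1)])
  also have "\<dots> = integral ?S k" by (rule fg(2))
  also have "\<dots> = (LINT \<beta>:?S|lebesgue. k \<beta>)" by (rule set_lebesgue_integral_eq_integral(2)[OF kS, symmetric])
  also have "\<dots> = (LINT \<beta>|lebesgue. k \<beta>)" unfolding set_lebesgue_integral_def k0 ..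
  also have "\<dots> = (LINT \<beta>|lborel. k \<beta>)" by (rule integral_completion) (use km in simp)
  finally show ?thesis unfolding f_def k_def .
qed

section \<open>The trajectories satisfy the Lagrangian integral equation\<close>

lemma displacement_lip: "\<bar>t\<bar> \<le> d \<Longrightarrow> lip_on (cball 0 r) (\<lambda>a. cvec (X a t - a))"
  unfolding lip_on_def
proof (intro ballI)
  fix a b :: space assume t: "\<bar>t\<bar> \<le> d" and ab: "a \<in> cball 0 r" "b \<in> cball 0 r"
  have "cvec (X a t - a) - cvec (X b t - b) = cvec ((X a t - X b t) - (a - b))"
    by (simp add: cvec_diff)
  then show "norm (cvec (X a t - a) - cvec (X b t - b)) \<le> norm (a - b) / 8"
    using X_lip(1)[of a b t] ab t by simp
qed

text \<open>\<open>pull_back_integral\<close> passes to labels and a translation by b puts the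
  singularity at z = 0. Integrability of the singular integrand is taken from the complex side,
  since \<open>G\<close> has the real integrand as its components.\<close>

lemma lag_force_eq_force:
  assumes dens: "compact_density \<rho>0 R M" and Rr: "R \<le> r" and b: "b \<in> cball 0 r" and t: "\<bar>t\<bar> < d"
  shows "lag_force \<rho>0 (\<lambda>a. cvec (X a t - a)) b = cvec (force b t)"
proof -
  interpret compact_density \<rho>0 R M by (rule dens)
  define V where "V a = cvec (X a t - a)" for a
  have sub: "cball 0 R \<subseteq> cball (0 :: space) r" using Rr by (rule subset_cball)
  have lip: "lip_on (cball 0 r) V" unfolding V_def by (rule displacement_lip) (use t in simp)
  define k where "k \<beta> = \<rho>0 \<beta> *\<^sub>R newton_kernel (X b t - X \<beta> t)" for \<beta>
  have Geq: "G \<rho>0 V b i z = complex_of_real (k (z + b) $ i)" for i z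
  proof -
    have "Zd V b z = cvec (X b t - X (b + z) t)" by (simp add: Zd_def V_def flip: cvec_diff)
    then show ?thesis by (simp add: G_def k_def Kc_cvec add.commute) (simp add: cvec_def)
  qed
  have "integrable lborel (\<lambda>z. complex_of_real (k (z + b) $ i))" for i
    using G_integrable(1)[OF lip closed_cball sub b, of i] unfolding Geq[abs_def] by (simp add: Geq[abs_def])
  then have ki: "integrable lborel (\<lambda>z. k (z + b) $ i)" for i by (simp only: complex_of_real_integrable_eq)
  have vec: "w = (\<Sum>i\<in>UNIV. w $ i *\<^sub>R axis i 1)" for w :: space
    by (simp add: vec_eq_iff axis_def if_distrib[of "\<lambda>x. _ * x"] cong: if_cong)
  have "integrable lborel (\<lambda>z. \<Sum>i\<in>UNIV. k (z + b) $ i *\<^sub>R (axis i 1 :: space))"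
    by (intro Bochner_Integration.integrable_sum integrable_scaleR_left ki)
  then have kb: "integrable lborel (\<lambda>z. k (z + b))" by (simp only: vec[symmetric])
  have kint: "integrable lborel k" using lborel_integrable_translate[OF kb, of "- b"] by simp
  have "force b t = (LINT y|lebesgue. \<rho> y t *\<^sub>R newton_kernel (X b t - y))"
    by (simp add: force_def grad_inv_laplacian_def)
  also have "\<dots> = (LINT \<beta>|lborel. \<rho>0 \<beta> *\<^sub>R newton_kernel (X b t - X \<beta> t))"
  proof (rule pull_back_integral[OF t])
    show "y \<in> cball 0 r" if "\<rho>0 y \<noteq> 0" for y using supp[OF that] sub by blast
    show "integrable lborel (\<lambda>\<beta>. \<rho>0 \<beta> *\<^sub>R newton_kernel (X b t - X \<beta> t))" using kint by (simp add: k_def[abs_def])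
  qed
  also have "\<dots> = (LINT \<beta>|lborel. k \<beta>)" by (simp add: k_def)
  also have "\<dots> = (LINT z|lborel. k (z + b))"
    by (rule lborel_integral_translate[symmetric]) (use borel_measurable_integrable[OF kint] in simp)
  finally have force: "force b t = (LINT z|lborel. k (z + b))" .
  have "lag_force \<rho>0 V b $ i = cvec (force b t) $ i" for i
  proof -
    have "lag_force \<rho>0 V b $ i = (LINT z|lborel. complex_of_real (k (z + b) $ i))" by (simp add: lag_force_def Geq)
    also have "\<dots> = complex_of_real (LINT z|lborel. k (z + b) $ i)" by (rule integral_complex_of_real)
    also have "(LINT z|lborel. k (z + b) $ i) = (LINT z|lborel. k (z + b)) $ i"
      by (rule integral_bounded_linear[OF bounded_linear_vec_nth kb])
    finally show ?thesis by (simp add: force cvec_def)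
  qed
  then show ?thesis unfolding V_def by (simp add: vec_eq_iff)
qed

text \<open>Continuity in time is read off the momentum equation instead of the singular integral: q
  times the force is the derivative of u along the trajectory, which the chain rule expresses by
  continuous partial derivatives, and \<open>q * q = 1\<close>.\<close>

lemma force_cont:
  assumes q: "q \<in> {1, -1}"
  shows "continuous_on {-S..S} (force b)"
proof -
  have st: "\<bar>s\<bar> < T" if "s \<in> {-S..S}" for s using that S by auto
  have Dc: "continuous_on {-S..S} (\<lambda>s. U.D (X b s) s v)" for v
  proof -
    have "continuous_on {-S..S} (\<lambda>s. U.D (fst (X b s, s)) (snd (X b s, s)) v)"
      by (rule continuous_on_compose2[OF U.D_continuous])
        (use X_cont[OF S, of b] S in \<open>auto intro!: continuous_intros\<close>)
    then show ?thesis by simp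
  qed
  have uc: "continuous_on {-S..S} (\<lambda>s. u (X b s) s)"
    by (intro continuous_at_imp_continuous_on ballI has_vector_derivative_continuous[OF u_path] st)
  have "continuous_on {-S..S} (\<lambda>s. q *\<^sub>R ((\<Sum>i\<in>UNIV. u (X b s) s $ i *\<^sub>R U.D (X b s) s (axis i 1, 0)) + U.D (X b s) s (0, 1)))"
    by (intro continuous_intros Dc uc)
  then show ?thesis
  proof (rule continuous_on_eq)
    fix s assume s: "s \<in> {-S..S}"
    have "q *\<^sub>R force b s = U.D (X b s) s (u (X b s) s, 1)"
      by (rule vector_derivative_unique_at[OF u_path[OF st[OF s]] U.D_path[OF st[OF s] X_deriv[OF st[OF s]]]])
    also have "\<dots> = (\<Sum>i\<in>UNIV. u (X b s) s $ i *\<^sub>R U.D (X b s) s (axis i 1, 0)) + U.D (X b s) s (0, 1)"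
      by (simp add: U.D_split[OF st[OF s], of _ "u (X b s) s" 1] U.D_basis[OF st[OF s], of _ "u (X b s) s"])
    finally have "q *\<^sub>R q *\<^sub>R force b s = q *\<^sub>R ((\<Sum>i\<in>UNIV. u (X b s) s $ i *\<^sub>R U.D (X b s) s (axis i 1, 0)) + U.D (X b s) s (0, 1))"
      by (rule arg_cong)
    moreover have "q *\<^sub>R q *\<^sub>R force b s = force b s" using q by auto
    ultimately show "q *\<^sub>R ((\<Sum>i\<in>UNIV. u (X b s) s $ i *\<^sub>R U.D (X b s) s (axis i 1, 0)) + U.D (X b s) s (0, 1)) = force b s"
      by (simp only:)
  qed
qed

lemma theta_time: "\<theta> \<in> {0..1} \<Longrightarrow> \<bar>t\<bar> < c \<Longrightarrow> \<bar>\<theta> * t\<bar> < (c :: real)"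
  using mult_right_mono[of \<theta> 1 "\<bar>t\<bar>"] by (simp add: abs_mult)

lemma taylor:
  assumes t: "\<bar>t\<bar> < d"
  shows "((\<lambda>\<theta>. ((1 - \<theta>) * t * t) *\<^sub>R q *\<^sub>R force b (\<theta> * t)) has_integral (X b t - b - t *\<^sub>R u0 b)) {0..1}"
proof -
  \<comment> \<open>In the derivative of this function the velocity terms cancel and only the
    weighted acceleration remains.\<close>
  define H where "H \<theta> = X b (\<theta> * t) + ((1 - \<theta>) * t) *\<^sub>R u (X b (\<theta> * t)) (\<theta> * t)" for \<theta>
  have "((\<lambda>\<theta>. ((1 - \<theta>) * t * t) *\<^sub>R q *\<^sub>R force b (\<theta> * t)) has_integral (H 1 - H 0)) {0..1}"
  proof (rule fundamental_theorem_of_calculus)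
    fix \<theta> :: real assume \<theta>: "\<theta> \<in> {0..1}"
    have tt: "\<bar>\<theta> * t\<bar> < T" using theta_time[OF \<theta> t] d S by simp
    have m: "((\<lambda>\<theta>. \<theta> * t) has_vector_derivative t) (at \<theta>)"
      by (auto intro!: derivative_eq_intros simp: has_vector_derivative_def)
    have x: "((\<lambda>\<theta>. X b (\<theta> * t)) has_vector_derivative t *\<^sub>R u (X b (\<theta> * t)) (\<theta> * t)) (at \<theta>)"
      using vector_diff_chain_at[OF m X_deriv[OF tt]] by (simp add: o_def)
    have uu: "((\<lambda>\<theta>. u (X b (\<theta> * t)) (\<theta> * t)) has_vector_derivative t *\<^sub>R q *\<^sub>R force b (\<theta> * t)) (at \<theta>)"
      using vector_diff_chain_at[OF m u_path[OF tt]] by (simp add: o_def)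
    have c: "((\<lambda>\<theta>. (1 - \<theta>) * t) has_real_derivative - t) (at \<theta>)"
      by (auto intro!: derivative_eq_intros)
    have "(H has_vector_derivative ((1 - \<theta>) * t * t) *\<^sub>R q *\<^sub>R force b (\<theta> * t)) (at \<theta>)"
      unfolding H_def using has_vector_derivative_add[OF x has_vector_derivative_scaleR[OF c uu]]
      by (simp add: algebra_simps)
    then show "(H has_vector_derivative ((1 - \<theta>) * t * t) *\<^sub>R q *\<^sub>R force b (\<theta> * t)) (at \<theta> within {0..1})"
      by (rule has_vector_derivative_at_within)
  qed simp
  moreover have "H 1 - H 0 = X b t - b - t *\<^sub>R u0 b" by (simp add: H_def X_0 u_0)
  ultimately show ?thesis by (simp only:)
qed

lemma trajectory_analytic:
  assumes pic: "picard \<rho>0 R M u0 q N dp" and Rr: "R \<le> r" and q1: "q \<in> {1, -1}" and a: "a \<in> cball 0 r"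
  shows "real_analytic_at (X a) 0"
proof -
  note d0 = d
  note S0 = S
  note K0 = K
  have dp: "0 < dp" using pic by (simp add: picard_def picard_axioms_def)
  interpret picard \<rho>0 R M u0 q N dp by (rule pic)
  have dens: "compact_density \<rho>0 R M" ..
  define d' where "d' = min dp d"
  have d': "0 < d'" "d' \<le> dp" "d' \<le> d" using dp d0 by (auto simp: d'_def)
  have FFe: "lag_force \<rho>0 (\<lambda>b. cvec (X b (\<theta> * t) - b)) b $ i = complex_of_real (force b (\<theta> * t) $ i)"
    if "\<theta> \<in> {0..1}" "\<bar>t\<bar> < d'" "b \<in> cball 0 r" for \<theta> t b i
  proof -
    have "\<bar>\<theta> * t\<bar> < d" using theta_time[OF that(1,2)] d' by simp
    from lag_force_eq_force[OF dens Rr that(3) this] show ?thesis by (simp add: cvec_def)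
  qed
  have fc: "continuous_on {0..1} (\<lambda>\<theta>. force b (\<theta> * t) $ i)" if t: "\<bar>t\<bar> < d'" for b t i
  proof -
    have "continuous_on {0..1} (\<lambda>\<theta>. force b (\<theta> * t))"
    proof (rule continuous_on_compose2[OF force_cont[OF q1]])
      show "(\<lambda>\<theta>. \<theta> * t) ` {0..1} \<subseteq> {-S..S}"
        using theta_time[OF _ t] d' d0 by (force simp: abs_less_iff)
    qed (intro continuous_intros)
    then show ?thesis by (intro continuous_intros)
  qed
  have an: "real_analytic_at (\<lambda>t. X a t - a) 0"
  proof (rule analytic_limit[of "cball 0 r" a d' "\<lambda>t b. X b t - b"])
    show "closed (cball (0::space) r)" "a \<in> cball 0 r" "0 < d'" "d' \<le> dp" using a d' by auto
    show "cball 0 R \<subseteq> cball (0::space) r" using Rr by (rule subset_cball)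
    show "lip_on (cball 0 r) (\<lambda>b. cvec (X b t - b))" if "\<bar>t\<bar> < d'" for t
      by (rule displacement_lip) (use that d' in simp)
    show "norm (X b t - b) \<le> 1" if "\<bar>t\<bar> < d'" for t b
    proof -
      have "norm (X b t - b) \<le> K * \<bar>t\<bar>" by (rule X_near[OF K0(2) S0]) (use that d' d0 in auto)
      also have "\<dots> \<le> K * d" using that d' K0 by (intro mult_left_mono) auto
      finally show ?thesis using d0 by simp
    qed
    fix t :: real and b :: space and i assume t: "\<bar>t\<bar> < d'" and b: "b \<in> cball 0 r"
    show "continuous_on {0..1} (\<lambda>\<theta>. lag_force \<rho>0 (\<lambda>b. cvec (X b (\<theta> * t) - b)) b $ i)"
    proof (rule continuous_on_eq)
      show "continuous_on {0..1} (\<lambda>\<theta>. complex_of_real (force b (\<theta> * t) $ i))"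
        by (intro continuous_intros fc t)
    qed (simp only: FFe[OF _ t b])
    let ?I = "\<lambda>\<theta>. complex_of_real (1 - \<theta>) * lag_force \<rho>0 (\<lambda>b. cvec (X b (\<theta> * t) - b)) b $ i"
    let ?R = "\<lambda>\<theta>. (((1 - \<theta>) * t * t) *\<^sub>R q *\<^sub>R force b (\<theta> * t)) $ i"
    have "\<bar>t\<bar> < d" using t d' by simp
    from has_integral_linear[OF has_integral_linear[OF taylor[OF this, of b] bounded_linear_vec_nth[of i]] bounded_linear_of_real]
    have "((\<lambda>\<theta>. complex_of_real (?R \<theta>)) has_integral complex_of_real ((X b t - b - t *\<^sub>R u0 b) $ i)) {0..1}"
      by (simp add: o_def)
    then have "complex_of_real ((X b t - b - t *\<^sub>R u0 b) $ i) = integral {0..1} (\<lambda>\<theta>. complex_of_real (?R \<theta>))"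
      by (rule integral_unique[symmetric])
    also have "\<dots> = integral {0..1} (\<lambda>\<theta>. (of_real q * (of_real t)\<^sup>2) * ?I \<theta>)"
      by (rule Henstock_Kurzweil_Integration.integral_cong) (simp add: FFe[OF _ t b] power2_eq_square)
    also have "\<dots> = (of_real q * (of_real t)\<^sup>2) * integral {0..1} ?I" by (rule Henstock_Kurzweil_Integration.integral_mult_right)
    finally show "cvec (X b t - b) $ i = of_real t * cvec (u0 b) $ i + of_real q * (of_real t)\<^sup>2 * integral {0..1} ?I"
      by (simp add: cvec_def algebra_simps)
  qed
  then obtain c \<epsilon> where c: "0 < \<epsilon>" "\<And>t. \<bar>t - 0\<bar> < \<epsilon> \<Longrightarrow> (\<lambda>n. (t - 0) ^ n *\<^sub>R c n) sums (X a t - a)"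
    unfolding real_analytic_at_def by (elim exE conjE) (rule that, auto)
  \<comment> \<open>Passing from the displacement to the trajectory only adds the label to the
    constant coefficient.\<close>
  have "(\<lambda>n. (t - 0) ^ n *\<^sub>R (c n + (if n = 0 then a else 0))) sums X a t" if "\<bar>t - 0\<bar> < \<epsilon>" for t
  proof -
    have "(\<lambda>n. if n = 0 then a else 0) sums a" using sums_single[of 0 "\<lambda>_. a"] by simp
    from sums_add[OF c(2)[OF that] this] have "(\<lambda>n. (t - 0) ^ n *\<^sub>R c n + (if n = 0 then a else 0)) sums X a t" by simp
    moreover have "(t - 0) ^ n *\<^sub>R c n + (if n = 0 then a else 0) = (t - 0) ^ n *\<^sub>R (c n + (if n = 0 then a else 0))" for n
      by (simp add: scaleR_add_right)
    ultimately show ?thesis by (simp only:)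
  qed
  then show ?thesis
    unfolding real_analytic_at_def by (intro exI[of _ "\<lambda>n. c n + (if n = 0 then a else 0)"] exI[of _ \<epsilon>] conjI allI impI c(1))
qed

end

section \<open>Difference bounds for the initial density\<close>

lemma compactly_supported_deriv:
  fixes f :: "space \<Rightarrow> real"
  assumes "x \<notin> closure {x. f x \<noteq> 0}"
  shows "frechet_derivative f (at x) v = 0"
proof -
  have "(f has_derivative (\<lambda>_. 0)) (at x)"
  proof (rule has_derivative_transform_within_open[of "\<lambda>_. 0"])
    show "open (- closure {x. f x \<noteq> 0})" by (rule open_Compl[OF closed_closure])
    show "0 = f y" if "y \<in> - closure {x. f x \<noteq> 0}" for y using that closure_subset[of "{x. f x \<noteq> 0}"] by auto
  qed (use assms in auto)
  from frechet_derivative_at[OF this] show ?thesis by metis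
qed

lemma Ck_c_lipschitz:
  fixes f :: "space \<Rightarrow> real"
  assumes "Ck_on 1 UNIV f" "compactly_supported f"
  obtains K where "0 \<le> K" "\<And>x v. \<bar>frechet_derivative f (at x) v\<bar> \<le> K * norm v" "\<And>a h. \<bar>f (a + h) - f a\<bar> \<le> K * norm h"
proof -
  have D: "(f has_derivative frechet_derivative f (at x)) (at x)" for x
    using assms(1) by (simp flip: frechet_derivative_works)
  have c: "continuous_on UNIV (\<lambda>x. frechet_derivative f (at x) v)" for v using assms(1) by simp
  let ?g = "\<lambda>x. \<Sum>i\<in>UNIV. \<bar>frechet_derivative f (at x) (axis i 1)\<bar>"
  have "bounded (?g ` closure {x. f x \<noteq> 0})"
    using assms(2) by (intro compact_imp_bounded compact_continuous_image continuous_intros continuous_on_subset[OF c])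
      (auto simp: compactly_supported_def)
  then obtain K' where K': "\<forall>y\<in>?g ` closure {x. f x \<noteq> 0}. norm y \<le> K'" unfolding bounded_iff by (rule exE)
  define K where "K = max K' 0"
  have gK: "?g x \<le> K" for x
  proof (cases "x \<in> closure {x. f x \<noteq> 0}")
    case True
    then have "norm (?g x) \<le> K'" using K' by blast
    then show ?thesis unfolding K_def real_norm_def by linarith
  next
    case False
    then show ?thesis by (simp add: compactly_supported_deriv K_def)
  qed
  have b: "\<bar>frechet_derivative f (at x) v\<bar> \<le> K * norm v" for x v
  proof -
    have lin: "linear (frechet_derivative f (at x))" using has_derivative_linear[OF D] .
    have "v = (\<Sum>i\<in>UNIV. v $ i *\<^sub>R axis i 1)"
      by (simp add: vec_eq_iff axis_def if_distrib[of "\<lambda>x. _ * x"] cong: if_cong)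
    then have "frechet_derivative f (at x) v = frechet_derivative f (at x) (\<Sum>i\<in>UNIV. v $ i *\<^sub>R axis i 1)" by simp
    also have "\<dots> = (\<Sum>i\<in>UNIV. v $ i * frechet_derivative f (at x) (axis i 1))"
      unfolding linear_sum[OF lin] linear_scale[OF lin] by simp
    also have "\<bar>\<dots>\<bar> \<le> (\<Sum>i\<in>UNIV. norm v * \<bar>frechet_derivative f (at x) (axis i 1)\<bar>)"
      by (intro order_trans[OF sum_abs] sum_mono) (simp add: abs_mult mult_right_mono component_le_norm_cart)
    also have "\<dots> = norm v * ?g x" by (simp only: sum_distrib_left)
    also have "\<dots> \<le> norm v * K" using gK by (intro mult_left_mono) auto
    finally show ?thesis by (simp only: mult.commute)
  qed
  have "\<bar>f (a + h) - f a\<bar> \<le> K * norm h" for a h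
  proof -
    have "norm (f (a + h) - f a) \<le> K * norm ((a + h) - a)"
      by (rule differentiable_bound[of UNIV f "\<lambda>x. frechet_derivative f (at x)"]) (use D b in \<open>auto intro!: onorm_le\<close>)
    then show ?thesis by simp
  qed
  moreover have "0 \<le> K" by (simp add: K_def)
  ultimately show ?thesis using that b by blast
qed

lemma Ck_on_SucD: "Ck_on (Suc n) UNIV f \<Longrightarrow> Ck_on n UNIV f"
proof (induction n arbitrary: f)
  case 0
  then show ?case by (auto intro!: continuous_at_imp_continuous_on differentiable_imp_continuous_within)
next
  case (Suc n)
  have "Ck_on n UNIV (\<lambda>x. frechet_derivative f (at x) v)" for v
    by (rule Suc.IH) (use Suc.prems in simp)
  then show ?case using Suc.prems by simp
qed

lemma Ck_on_le: "m \<le> n \<Longrightarrow> Ck_on n UNIV f \<Longrightarrow> Ck_on m UNIV f"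
  by (induction n rule: dec_induct) (auto dest: Ck_on_SucD simp del: Ck_on.simps)

text \<open>The second difference is bounded by the Lipschitz constants of the first derivatives.
  Exponents below 1 come from |k| \<le> |k|^g for short k; for long k the bound of one order less is
  used, with 1 \<le> |k|^g.\<close>

lemma Ck_c_compact_density:
  assumes "Ck_c s \<rho>" "2 \<le> s"
  obtains R M where "compact_density \<rho> R M"
proof -
  have cs: "compactly_supported \<rho>" and C2: "Ck_on (Suc 1) UNIV \<rho>"
    using assms Ck_on_le[of "Suc 1" s \<rho>] by (auto simp: Ck_c_def simp del: Ck_on.simps)
  have C1: "Ck_on 1 UNIV \<rho>" using C2 by (rule Ck_on_SucD)
  have C0: "continuous_on UNIV \<rho>" using Ck_on_SucD[of 0 \<rho>] C1 by simp
  obtain K where K: "0 \<le> K" "\<And>x v. \<bar>frechet_derivative \<rho> (at x) v\<bar> \<le> K * norm v" "\<And>a h. \<bar>\<rho> (a + h) - \<rho> a\<bar> \<le> K * norm h"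
    by (rule Ck_c_lipschitz[OF C1 cs]) (rule that)
  have D: "(\<rho> has_derivative frechet_derivative \<rho> (at x)) (at x)" for x
    using C1 by (simp flip: frechet_derivative_works)
  let ?d = "\<lambda>i x. frechet_derivative \<rho> (at x) (axis i 1)"
  have "\<exists>L. 0 \<le> L \<and> (\<forall>a h. \<bar>?d i (a + h) - ?d i a\<bar> \<le> L * norm h)" for i :: 3
  proof -
    have c1: "Ck_on 1 UNIV (?d i)" using C2 by (subst (asm) Ck_on.simps) blast
    have "{x. ?d i x \<noteq> 0} \<subseteq> closure {x. \<rho> x \<noteq> 0}"
    proof
      fix x assume "x \<in> {x. ?d i x \<noteq> 0}"
      then show "x \<in> closure {x. \<rho> x \<noteq> 0}" using compactly_supported_deriv[of x \<rho> "axis i 1"] by fastforce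
    qed
    then have sub: "closure {x. ?d i x \<noteq> 0} \<subseteq> closure {x. \<rho> x \<noteq> 0}" by (rule closure_minimal) simp
    have "bounded (closure {x. \<rho> x \<noteq> 0})"
      using cs unfolding compactly_supported_def by (rule compact_imp_bounded)
    then have "bounded (closure {x. ?d i x \<noteq> 0})" using sub by (rule bounded_subset)
    then have cs1: "compactly_supported (?d i)" by (simp add: compactly_supported_def compact_eq_bounded_closed)
    obtain L where "0 \<le> L" "\<And>x v. \<bar>frechet_derivative (?d i) (at x) v\<bar> \<le> L * norm v" "\<And>a h. \<bar>?d i (a + h) - ?d i a\<bar> \<le> L * norm h"
      by (rule Ck_c_lipschitz[OF c1 cs1]) (rule that)
    then show ?thesis by (intro exI[of _ L] conjI allI)
  qed
  then have "\<exists>L. \<forall>i. 0 \<le> L i \<and> (\<forall>a h. \<bar>?d i (a + h) - ?d i a\<bar> \<le> L i * norm h)" by (intro choice allI)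
  then obtain L where "\<forall>i. 0 \<le> L i \<and> (\<forall>a h. \<bar>?d i (a + h) - ?d i a\<bar> \<le> L i * norm h)" ..
  then have L: "0 \<le> L i" "\<bar>?d i (a + h) - ?d i a\<bar> \<le> L i * norm h" for i a h by simp_all
  define L0 where "L0 = (\<Sum>i\<in>UNIV. L i)"
  have L0: "0 \<le> L0" unfolding L0_def by (intro sum_nonneg L)
  have dd: "\<bar>\<rho> (a + h + k) - \<rho> (a + h) - \<rho> (a + k) + \<rho> a\<bar> \<le> L0 * norm h * norm k" for a h k
  proof -
    have "norm ((\<rho> (a + h + k) - \<rho> (a + h)) - (\<rho> (a + k) - \<rho> a)) \<le> (L0 * norm k) * norm ((a + h) - a)"
    proof (rule differentiable_bound[of UNIV "\<lambda>x. \<rho> (x + k) - \<rho> x" "\<lambda>x v. frechet_derivative \<rho> (at (x + k)) v - frechet_derivative \<rho> (at x) v"])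
      fix x :: space
      have "((\<lambda>x. x + k) has_derivative (\<lambda>v. v)) (at x)" by (auto intro!: derivative_eq_intros)
      from has_derivative_diff[OF has_derivative_compose[OF this D] D]
      show "((\<lambda>x. \<rho> (x + k) - \<rho> x) has_derivative (\<lambda>v. frechet_derivative \<rho> (at (x + k)) v - frechet_derivative \<rho> (at x) v)) (at x within UNIV)"
        by simp
      show "onorm (\<lambda>v. frechet_derivative \<rho> (at (x + k)) v - frechet_derivative \<rho> (at x) v) \<le> L0 * norm k"
      proof (rule onorm_le)
        fix v :: space
        have lin: "linear (\<lambda>v. frechet_derivative \<rho> (at (x + k)) v - frechet_derivative \<rho> (at x) v)" (is "linear ?l")
          using has_derivative_linear[OF D] by (intro linear_compose_sub)
        have "v = (\<Sum>i\<in>UNIV. v $ i *\<^sub>R axis i 1)"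
          by (simp add: vec_eq_iff axis_def if_distrib[of "\<lambda>x. _ * x"] cong: if_cong)
        then have "?l v = ?l (\<Sum>i\<in>UNIV. v $ i *\<^sub>R axis i 1)" by simp
        also have "\<dots> = (\<Sum>i\<in>UNIV. v $ i * ?l (axis i 1))"
          unfolding linear_sum[OF lin] linear_scale[OF lin] by simp
        also have "norm \<dots> \<le> (\<Sum>i\<in>UNIV. norm v * (L i * norm k))"
        proof (intro order_trans[OF norm_sum] sum_mono)
          fix i :: 3
          show "norm (v $ i * ?l (axis i 1)) \<le> norm v * (L i * norm k)"
            unfolding norm_mult using L(2)[where i = i and a = x and h = k] component_le_norm_cart[of v i] by (intro mult_mono) auto
        qed
        also have "\<dots> = L0 * norm k * norm v" by (simp add: L0_def sum_distrib_left sum_distrib_right ac_simps)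
        finally show "norm (?l v) \<le> L0 * norm k * norm v" .
      qed
    qed auto
    moreover have "(\<rho> (a + h + k) - \<rho> (a + h)) - (\<rho> (a + k) - \<rho> a) = \<rho> (a + h + k) - \<rho> (a + h) - \<rho> (a + k) + \<rho> a" by simp
    ultimately show ?thesis by (simp add: ac_simps)
  qed
  have bdd: "bounded (closure {x. \<rho> x \<noteq> 0})"
    using cs unfolding compactly_supported_def by (rule compact_imp_bounded)
  obtain R where R: "0 < R" "closure {x. \<rho> x \<noteq> 0} \<subseteq> ball 0 R" using bounded_subset_ballD[OF bdd, of 0] by blast
  have supp: "y \<in> cball 0 R" if "\<rho> y \<noteq> 0" for y
    using that R(2) closure_subset[of "{x. \<rho> x \<noteq> 0}"] by force
  have "bounded (\<rho> ` cball 0 R)"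
    by (intro compact_imp_bounded compact_continuous_image continuous_on_subset[OF C0]) auto
  then obtain M' where M': "\<forall>y\<in>\<rho> ` cball 0 R. norm y \<le> M'" unfolding bounded_iff by (rule exE)
  define M0 where "M0 = max M' 0"
  have M0: "\<bar>\<rho> y\<bar> \<le> M0" "0 \<le> M0" for y
  proof -
    show "\<bar>\<rho> y\<bar> \<le> M0"
    proof (cases "\<rho> y = 0")
      case False
      then have "norm (\<rho> y) \<le> M'" using M' supp by blast
      then show ?thesis by (simp add: M0_def)
    qed (simp add: M0_def)
  qed (simp add: M0_def)
  define M where "M = 2 * M0 + 2 * K + L0"
  have "compact_density \<rho> R M"
  proof
    show "0 \<le> R" "continuous_on UNIV \<rho>" using R C0 by auto
    show "y \<in> cball 0 R" if "\<rho> y \<noteq> 0" for y by (rule supp[OF that])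
    show "\<bar>\<rho> y\<bar> \<le> M" for y using M0(1)[of y] M0(2) K(1) L0 unfolding M_def by linarith
    show "\<bar>\<rho> (a + h) - \<rho> a\<bar> \<le> M * norm h" for a h
    proof -
      have "K * norm h \<le> M * norm h" using M0 K L0 by (intro mult_right_mono) (auto simp: M_def)
      then show ?thesis using K(3)[of a h] by linarith
    qed
    fix g :: real assume g: "0 < g" "g \<le> 1"
    have small: "norm h \<le> norm h powr g" if "norm h \<le> 1" for h :: space
    proof (cases "h = 0")
      case False
      then show ?thesis using that g powr_mono'[of g 1 "norm h"] by simp
    qed simp
    have big: "1 \<le> norm h powr g" if "\<not> norm h \<le> 1" for h :: space
      using that g by (simp add: ge_one_powr_ge_zero)
    show "\<bar>\<rho> (a + h) - \<rho> a\<bar> \<le> M * norm h powr g" for a h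
    proof (cases "norm h \<le> 1")
      case True
      have "K * norm h \<le> M * norm h powr g" using M0 K L0 small[OF True] by (intro mult_mono) (auto simp: M_def)
      then show ?thesis using K(3)[of a h] by linarith
    next
      case False
      have "2 * M0 * 1 \<le> M * norm h powr g" using M0 K L0 big[OF False] by (intro mult_mono) (auto simp: M_def)
      then show ?thesis using M0(1)[of "a + h"] M0(1)[of a] by linarith
    qed
    show "\<bar>\<rho> (a + h + k) - \<rho> (a + h) - \<rho> (a + k) + \<rho> a\<bar> \<le> M * norm h * norm k powr g" for a h k
    proof (cases "norm k \<le> 1")
      case True
      have "L0 * norm h * norm k \<le> M * norm h * norm k powr g"
        using M0 K L0 small[OF True] by (intro mult_mono mult_nonneg_nonneg) (auto simp: M_def)
      then show ?thesis using dd[of a h k] by linarith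
    next
      case False
      have "2 * K * norm h * 1 \<le> M * norm h * norm k powr g"
        using M0 K L0 big[OF False] by (intro mult_mono mult_nonneg_nonneg) (auto simp: M_def)
      moreover have "\<bar>\<rho> (a + h + k) - \<rho> (a + k)\<bar> \<le> K * norm h"
        using K(3)[of "a + k" h] by (simp add: add.commute add.left_commute)
      ultimately show ?thesis using K(3)[of a h] by linarith
    qed
  qed
  then show ?thesis by (rule that)
qed

theorem theorem4p17:
  fixes s :: nat and q T :: real
    and \<rho>0 :: "space \<Rightarrow> real" and u0 :: "space \<Rightarrow> space"
    and \<rho> :: "space \<Rightarrow> real \<Rightarrow> real" and u X :: "space \<Rightarrow> real \<Rightarrow> space"
  assumes "6 \<le> s"
    and "q \<in> {1, -1}"
    and "Ck_c s \<rho>0"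
    and "sobolev_H s u0"
    and "euler_poisson_solution q T \<rho>0 u0 \<rho> u"
    and "trajectory_map T u X"
  shows "\<forall>\<alpha>. real_analytic_at (X \<alpha>) 0"
proof
  fix \<alpha> :: space
  interpret flow q T \<rho>0 u0 \<rho> u X by (rule flow.intro) fact+
  obtain R M where dens: "compact_density \<rho>0 R M"
    by (rule Ck_c_compact_density[OF assms(3)]) (use assms(1) in simp, rule that)
  interpret dens: compact_density \<rho>0 R M by (rule dens)
  \<comment> \<open>As a time slice of the C^1 field \<open>u\<close>, the initial velocity is
    itself the continuous representative, so its Sobolev bounds hold at every point.\<close>
  have "continuous_on UNIV (\<lambda>x. u x 0)"
    using T_pos by (intro continuous_at_imp_continuous_on ballI has_derivative_continuous[OF U.D_space]) simp
  then have u0c: "continuous_on UNIV u0" by (simp add: u_0)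
  have s5: "5 \<le> s" using assms(1) by simp
  obtain N where N: "0 \<le> N" "\<And>a. norm (u0 a) \<le> N" "\<And>a h. norm (u0 (a + h) - u0 a) \<le> N * norm h"
    "\<And>a h k g. \<lbrakk>0 \<le> g; g \<le> 1\<rbrakk> \<Longrightarrow> norm (u0 (a + h + k) - u0 (a + h) - u0 (a + k) + u0 a) \<le> N * (norm h * norm k powr g)"
    by (rule sobolev_C11_bounds[OF assms(4) s5 u0c]) (rule that)
  define Q where "Q = N + 12 * dens.CI + 1"
  have Q: "1 \<le> Q" using N(1) dens.CI_nonneg by (simp add: Q_def)
  \<comment> \<open>Chosen so that \<open>3 * (dp * Q) = 1/8\<close>, the bound asked for by
    \<open>small\<close>; the 1 in \<open>Q\<close> makes \<open>dp\<close> well defined and at most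
    1.\<close>
  define dp where "dp = 1 / (24 * Q)"
  have dp: "0 < dp" "dp \<le> 1" using Q by (simp_all add: dp_def divide_le_eq)
  have "3 * (dp * N + 12 * dp * dens.CI) \<le> 3 * (dp * Q)"
    using dp by (simp add: Q_def algebra_simps)
  also have "3 * (dp * Q) = 1/8" using Q by (simp add: dp_def)
  finally have pic: "picard \<rho>0 R M u0 q N dp"
    using dp assms(2) N by (intro picard.intro[OF dens] picard_axioms.intro) auto
  define S where "S = T / 2"
  have S: "0 < S" "S < T" using T_pos by (simp_all add: S_def)
  obtain K where K: "0 < K" "\<And>x t. \<bar>t\<bar> \<le> S \<Longrightarrow> norm (u x t) \<le> K" by (rule u_bound[OF S(2)]) (rule that)
  \<comment> \<open>The ball has to contain both the label under study and the support of the
    density.\<close>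
  define r where "r = norm \<alpha> + R + 1"
  have r: "0 < r" "R \<le> r" "\<alpha> \<in> cball 0 r" using dens.R by (simp_all add: r_def add_nonneg_pos)
  obtain L where L: "0 < L" "\<And>x t v. \<lbrakk>x \<in> cball 0 (r + 1 + K * S); \<bar>t\<bar> \<le> S\<rbrakk> \<Longrightarrow> norm (U.D x t (v, 0)) \<le> L * norm v"
    by (rule U.D_bound[OF S(2), of "r + 1 + K * S"]) (rule that)
  define d where "d = min S (min (1 / (16 * L)) (1 / K))"
  have "d \<le> 1 / (16 * L)" "d \<le> 1 / K" "d \<le> S" by (simp_all add: d_def)
  then have d: "0 < d" "d \<le> S" "L * d \<le> 1/16" "K * d \<le> 1"
    using S L(1) K(1) by (simp_all add: d_def field_simps)
  have "local_flow q T \<rho>0 u0 \<rho> u X r S K L d"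
    by (intro local_flow.intro local_flow_axioms.intro flow_axioms r S K L d)
  from local_flow.trajectory_analytic[OF this pic r(2) assms(2) r(3)]
  show "real_analytic_at (X \<alpha>) 0" .
qed

end
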